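(* Let $\alpha=(\alpha_1,\ldots,\alpha_d)\in(-1,\infty)^d$. Then $\{T_t^{\alpha,\ell}\}_{t\ge0}$ is a submarkovian (but not Markovian) symmetric diffusion semigroup on $(\mathbb{R}_+^d,\mu_\alpha)$ satisfying, for $1\le p\le\infty$, $$\|T_t^{\alpha,\ell}\|_{p\to p}\le(\cosh 2t)^{-(|\alpha|+d)},\qquad t>0.$$
   Context: Notation: $d\ge 1$, $\mathbb{R}_+=(0,\infty)$, $d\mu_\alpha(x)=\big(\prod_{i=1}^d x_i^{2\alpha_i+1}\big)dx$ on $\mathbb{R}_+^d$, $L^p=L^p(\mathbb{R}_+^d,\mu_\alpha)$, $\|\cdot\|_{p\to p}$ is the operator norm on $L^p$, $\|x\|$ is the Euclidean norm, $\mathbf 1$ is the constant function $1$, $|\alpha|=\alpha_1+\ldots+\alpha_d$, and $I_\nu$ is the modified Bessel function of the first kind of order $\nu$. The semigroup. For $k\in\mathbb{N}^d$, $\mathbb N=\{0,1,2,\ldots\}$, the Laguerre functions of convolution type are $\ell_k^\alpha(x)=\prod_{i=1}^d\sqrt2\big(\frac{\Gamma(k_i+1)}{\Gamma(k_i+\alpha_i+1)}\big)^{1/2}L_{k_i}^{\alpha_i}(x_i^2)e^{-x_i^2/2}$, where $L_n^{a}$ is the Laguerre polynomial of degree $n$ and order $a$; they form an orthonormal basis of $L^2(\mathbb{R}_+^d,\mu_\alpha)$ and are eigenfunctions, with eigenvalues $4|k|+2|\alpha|+2d$ ($|k|=k_1+\ldots+k_d$), of $L_\alpha^\ell=-\Delta+\|x\|^2-\sum_{i=1}^d\frac{2\alpha_i+1}{x_i}\partial_{x_i}$.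 Using the same symbol for the self-adjoint extension of this operator whose spectral decomposition is given by the $\ell_k^\alpha$, one puts $T_t^{\alpha,\ell}=\exp(-tL_\alpha^\ell)$ on $L^2$. For $t>0$ this has the integral representation $$T_t^{\alpha,\ell}f(x)=\int_{\mathbb{R}_+^d}G_t^{\alpha,\ell}(x,y)f(y)\,d\mu_\alpha(y),\quad x\in\mathbb{R}_+^d,$$ $$G_t^{\alpha,\ell}(x,y)=(\sinh 2t)^{-d}\exp\Big(-\tfrac12\coth(2t)\big(\|x\|^2+\|y\|^2\big)\Big)\prod_{i=1}^d(x_iy_i)^{-\alpha_i}I_{\alpha_i}\Big(\frac{x_iy_i}{\sinh 2t}\Big),$$ and this formula defines $T_t^{\alpha,\ell}$ on $L^1+L^\infty$; $T_0^{\alpha,\ell}=\mathrm{Id}$. Definitions. On a $\sigma$-finite measure space $(X,\mu)$, a symmetric diffusion semigroup is a family of linear operators $\{T_t\}_{t\ge0}$, $T_0=\mathrm{Id}$, mapping a linear subspace of the measurable functions that contains all $L^p(X,\mu)$, $1\le p\le\infty$ (e.g. $L^1+L^\infty$) into measurable functions, such that: (i) for each $1\le p\le\infty$ every $T_t$ is a contraction on $L^p$ and $\{T_t\}_{t\ge0}$ is a semigroup there; (ii) each $T_t$ is self-adjoint on $L^2$; (iii) $\lim_{t\to0^+}T_tf=f$ in $L^2$ for each $f\in L^2$. It is Markovian if in addition (iv) $T_tf\ge0$ whenever $f\ge0$, for all $t$, and (v) $T_t\mathbf 1=\mathbf 1$ for all $t$. It is submarkovian if (i)-(iv) hold and (v')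 $T_t\mathbf 1\le\mathbf 1$ for all $t$. *)

theory Defs
  imports "HOL-Probability.Probability" "HOL-Library.Complex_Order"
begin

section \<open>Lebesgue spaces and operator norms\<close>

text \<open>Functions are complex-valued and not identified modulo null sets.  The exponent \<open>p\<close>
  ranges over \<open>ennreal\<close>, with \<open>\<infinity>\<close> giving the essential supremum.\<close>

definition Lp_norm :: "'a measure \<Rightarrow> ennreal \<Rightarrow> ('a \<Rightarrow> complex) \<Rightarrow> ennreal" where
  "Lp_norm M p f =
    (if p = \<infinity> then esssup M (\<lambda>x. ennreal (cmod (f x)))
     else let I = (\<integral>\<^sup>+ x. ennreal (cmod (f x) powr enn2real p) \<partial>M)
          in if I = \<infinity> then \<infinity> else ennreal (enn2real I powr (1 / enn2real p)))"

definition Lp_space :: "'a measure \<Rightarrow> ennreal \<Rightarrow> ('a \<Rightarrow> complex) set" where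
  "Lp_space M p = {f \<in> borel_measurable M. Lp_norm M p f < \<infinity>}"

definition Lp_opnorm :: "'a measure \<Rightarrow> ennreal \<Rightarrow> (('a \<Rightarrow> complex) \<Rightarrow> 'a \<Rightarrow> complex) \<Rightarrow> ennreal" where
  "Lp_opnorm M p S = (SUP f\<in>{f \<in> Lp_space M p. Lp_norm M p f \<le> 1}. Lp_norm M p (S f))"

definition L1_plus_Linf :: "'a measure \<Rightarrow> ('a \<Rightarrow> complex) set" where
  "L1_plus_Linf M = {\<lambda>x. g x + h x | g h. g \<in> Lp_space M 1 \<and> h \<in> Lp_space M \<infinity>}"

section \<open>Diffusion semigroups\<close>

text \<open>\<open>D\<close> is the common domain of the operators \<open>T t\<close>.  Operators act on representatives, so
  all identities hold almost everywhere, and \<open>T_cong\<close> says that \<open>T t\<close> is well defined on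
  equivalence classes.  Only the values \<open>T t\<close> for \<open>t \<ge> 0\<close> matter.\<close>

locale symmetric_diffusion_semigroup = sigma_finite_measure M
  for M :: "'a measure" +
  fixes D :: "('a \<Rightarrow> complex) set"
    and T :: "real \<Rightarrow> ('a \<Rightarrow> complex) \<Rightarrow> 'a \<Rightarrow> complex"
  assumes D_measurable: "D \<subseteq> borel_measurable M"
    and D_subspace: "\<And>a b f g. f \<in> D \<Longrightarrow> g \<in> D \<Longrightarrow> (\<lambda>x. a * f x + b * g x) \<in> D"
    and Lp_subset_D: "\<And>p. 1 \<le> p \<Longrightarrow> Lp_space M p \<subseteq> D"
    and T_measurable: "\<And>t f. 0 \<le> t \<Longrightarrow> f \<in> D \<Longrightarrow> T t f \<in> borel_measurable M"
    and T_cong: "\<And>t f g. 0 \<le> t \<Longrightarrow> f \<in> D \<Longrightarrow> g \<in> D \<Longrightarrow> (AE x in M. f x = g x)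
                   \<Longrightarrow> (AE x in M. T t f x = T t g x)"
    and T_linear: "\<And>t a b f g. 0 \<le> t \<Longrightarrow> f \<in> D \<Longrightarrow> g \<in> D
                   \<Longrightarrow> (AE x in M. T t (\<lambda>y. a * f y + b * g y) x = a * T t f x + b * T t g x)"
    and T_zero: "\<And>f. f \<in> D \<Longrightarrow> (AE x in M. T 0 f x = f x)"
    and T_Lp: "\<And>t p f. 0 \<le> t \<Longrightarrow> 1 \<le> p \<Longrightarrow> f \<in> Lp_space M p \<Longrightarrow> T t f \<in> Lp_space M p"
    and T_contraction: "\<And>t p. 0 \<le> t \<Longrightarrow> 1 \<le> p \<Longrightarrow> Lp_opnorm M p (T t) \<le> 1"
    and T_semigroup: "\<And>s t p f. 0 \<le> s \<Longrightarrow> 0 \<le> t \<Longrightarrow> 1 \<le> p \<Longrightarrow> f \<in> Lp_space M p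
                   \<Longrightarrow> (AE x in M. T (s + t) f x = T s (T t f) x)"
    and T_selfadjoint: "\<And>t f g. 0 \<le> t \<Longrightarrow> f \<in> Lp_space M 2 \<Longrightarrow> g \<in> Lp_space M 2
                   \<Longrightarrow> (\<integral>x. T t f x * cnj (g x) \<partial>M) = (\<integral>x. f x * cnj (T t g x) \<partial>M)"
    and T_continuous: "\<And>f. f \<in> Lp_space M 2
                   \<Longrightarrow> ((\<lambda>t. Lp_norm M 2 (\<lambda>x. T t f x - f x)) \<longlongrightarrow> 0) (at_right 0)"

text \<open>The order on \<open>complex\<close> is the one of \<open>Complex_Order\<close>: \<open>z \<le> w\<close> means that \<open>w - z\<close> is a
  nonnegative real number.\<close>

locale markovian_semigroup = symmetric_diffusion_semigroup +
  assumes T_nonneg: "\<And>t f. 0 \<le> t \<Longrightarrow> f \<in> D \<Longrightarrow> (AE x in M. 0 \<le> f x) \<Longrightarrow> (AE x in M. 0 \<le> T t f x)"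
    and T_one: "\<And>t. 0 \<le> t \<Longrightarrow> (AE x in M. T t (\<lambda>_. 1) x = 1)"

locale submarkovian_semigroup = symmetric_diffusion_semigroup +
  assumes T_nonneg: "\<And>t f. 0 \<le> t \<Longrightarrow> f \<in> D \<Longrightarrow> (AE x in M. 0 \<le> f x) \<Longrightarrow> (AE x in M. 0 \<le> T t f x)"
    and T_one_le: "\<And>t. 0 \<le> t \<Longrightarrow> (AE x in M. T t (\<lambda>_. 1) x \<le> 1)"

section \<open>The Laguerre semigroup of convolution type\<close>

definition orthant :: "(real ^ 'n) set" where
  "orthant = {x. \<forall>i. 0 < x $ i}"

definition laguerre_measure :: "real ^ 'n \<Rightarrow> (real ^ 'n) measure" where
  "laguerre_measure \<alpha> =
     density (restrict_space lborel orthant) (\<lambda>x. ennreal (\<Prod>i\<in>UNIV. x $ i powr (2 * \<alpha> $ i + 1)))"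

text \<open>The modified Bessel function of the first kind, for positive argument; \<open>rGamma\<close> is the
  entire function \<open>1/\<Gamma>\<close>.\<close>

definition bessel_I :: "real \<Rightarrow> real \<Rightarrow> real" where
  "bessel_I \<nu> z = (\<Sum>k. (z / 2) powr (2 * real k + \<nu>) * rGamma (real k + \<nu> + 1) / fact k)"

definition laguerre_kernel :: "real ^ 'n \<Rightarrow> real \<Rightarrow> real ^ 'n \<Rightarrow> real ^ 'n \<Rightarrow> real" where
  "laguerre_kernel \<alpha> t x y =
     inverse (sinh (2 * t) ^ CARD('n)) *
     exp (- (1 / 2) * (cosh (2 * t) / sinh (2 * t)) * ((norm x)\<^sup>2 + (norm y)\<^sup>2)) *
     (\<Prod>i\<in>UNIV. (x $ i * y $ i) powr (- \<alpha> $ i) * bessel_I (\<alpha> $ i) (x $ i * y $ i / sinh (2 * t)))"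

text \<open>Defined on \<open>L\<^sup>1 + L\<^sup>\<infinity>\<close>.  For \<open>t > 0\<close> and \<open>\<alpha> \<in> (-1, \<infinity>)\<^sup>d\<close>, \<open>laguerre_kernel \<alpha> t x\<close> is bounded and
  integrable on the orthant for each fixed \<open>x\<close> there, so the Bochner integral always converges.\<close>

definition laguerre_semigroup ::
    "real ^ 'n \<Rightarrow> real \<Rightarrow> (real ^ 'n \<Rightarrow> complex) \<Rightarrow> real ^ 'n \<Rightarrow> complex" where
  "laguerre_semigroup \<alpha> t f x =
     (if t = 0 then f x
      else (\<integral>y. complex_of_real (laguerre_kernel \<alpha> t x y) * f y \<partial>laguerre_measure \<alpha>))"

end

theory Submission
  imports Defs
begin

text \<open>
  In the power series of \<open>I\<^sub>\<nu>\<close> everything can be integrated term by term against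
  \<open>y\<^sup>2\<^sup>\<nu>\<^sup>+\<^sup>1 exp (- q y\<^sup>2)\<close>; the Chu--Vandermonde identity then yields Weber's second exponential integral,
  which contains both the Chapman--Kolmogorov equation of the one-dimensional kernel and the fact that
  Gaussians are mapped to explicit Gaussians.  For the constant function this is
  \<open>T\<^sub>t 1 (x) = (cosh 2t) powr (- (|\<alpha>| + d)) * exp (- tanh (2t) |x|\<^sup>2 / 2)\<close>, so Schur's test (the kernel is
  nonnegative and symmetric) bounds the norm on every \<open>L\<^sup>p\<close> and the semigroup is not Markovian.  Strong
  continuity on \<open>L\<^sup>2\<close> follows from contractivity and self-adjointness once \<open>T\<^sub>t 1\<^sub>U \<rightarrow> 1\<close> pointwise on
  each open \<open>U\<close>, which is Chebyshev's inequality for Gaussian observables.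
\<close>

section \<open>Integral operators with symmetric kernels\<close>

text \<open>The semigroup is given by its kernel, so the semigroup law, self-adjointness and strong
  continuity are all drawn from explicit integrals instead of a spectral decomposition. Two facts
  keep this free of convergence questions. Up to a constant,
  \<open>(x y) powr (-a) * I_a (x y / sinh 2t)\<close> is a power series in \<open>(x y)^2\<close>
  with nonnegative coefficients, so the kernel is regular at the boundary and sums and integrals are
  exchanged by Tonelli in \<open>ennreal\<close>. And Chapman-Kolmogorov, as an identity of extended
  nonnegative integrals, integrated against |f| supplies the integrability that Fubini asks for when
  f is complex.

  Why Gaussians as observables: their images under the operators are computable exactly, and on the
  positive half-line \<open>exp (- y^2 / 2)\<close> is injective. Control of this one function per
  coordinate therefore forces the mass of the kernel into every neighbourhood of x. Open sets are
  enough because their traces are an intersection-stable generator of the sigma-algebra.\<close>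

lemma Lp_norm_ennreal:
  assumes "1 \<le> r"
  shows "Lp_norm M (ennreal r) f =
    (let I = (\<integral>\<^sup>+ x. ennreal (cmod (f x) powr r) \<partial>M)
     in if I = \<infinity> then \<infinity> else ennreal (enn2real I powr (1 / r)))"
proof -
  have "enn2real (ennreal r) = r" using assms by simp
  then show ?thesis unfolding Lp_norm_def by (simp only: ennreal_neq_top if_False
      infinity_ennreal_def)
qed

lemma Lp_space_ennreal_iff:
  assumes "1 \<le> r"
  shows "f \<in> Lp_space M (ennreal r) \<longleftrightarrow>
    f \<in> borel_measurable M \<and> (\<integral>\<^sup>+ x. ennreal (cmod (f x) powr r) \<partial>M) < \<infinity>"
  unfolding Lp_space_def Lp_norm_ennreal[OF assms] by (auto simp: Let_def top.not_eq_extremum)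

lemma Lp_space_1_iff: "f \<in> Lp_space M 1 \<longleftrightarrow> integrable M f"
  using Lp_space_ennreal_iff[of 1 f M] by (simp add: integrable_iff_bounded)

lemma Lp_space_2_iff:
  "f \<in> Lp_space M 2 \<longleftrightarrow> f \<in> borel_measurable M \<and> (\<integral>\<^sup>+ x. ennreal ((cmod (f x))\<^sup>2) \<partial>M) < \<infinity>"
  using Lp_space_ennreal_iff[of 2 f M] by simp

lemma Lp_space_top_iff:
  "f \<in> Lp_space M top \<longleftrightarrow> f \<in> borel_measurable M \<and> (\<exists>c\<ge>0. AE x in M. cmod (f x) \<le> c)"
proof safe
  assume f: "f \<in> Lp_space M top"
  then show [measurable]: "f \<in> borel_measurable M" by (simp add: Lp_space_def)
  from f obtain c where "0 \<le> c" "esssup M (\<lambda>x. ennreal (cmod (f x))) = ennreal c"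
    by (auto simp: Lp_space_def Lp_norm_def less_top_ennreal)
  with esssup_AE[of "\<lambda>x. ennreal (cmod (f x))" M] show "\<exists>c\<ge>0. AE x in M. cmod (f x) \<le> c"
    by auto
next
  fix c :: real assume f[measurable]: "f \<in> borel_measurable M" and c: "0 \<le> c" "AE x in M. cmod (f x)
      \<le> c"
  have "esssup M (\<lambda>x. ennreal (cmod (f x))) \<le> ennreal c"
    using c by (intro esssup_I) auto
  then show "f \<in> Lp_space M top"
    by (auto simp: Lp_space_def Lp_norm_def intro: le_less_trans)
qed

lemma ennreal_exponent_cases:
  assumes "1 \<le> (p::ennreal)"
  obtains "p = \<infinity>" | r where "1 \<le> r" "p = ennreal r"
  using assms that by (cases p) auto

lemma L1_plus_Linf_I:
  "integrable M g \<Longrightarrow> h \<in> Lp_space M top \<Longrightarrow> (\<lambda>x. g x + h x) \<in> L1_plus_Linf M"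
  unfolding L1_plus_Linf_def Lp_space_1_iff infinity_ennreal_def by blast

lemma L1_plus_Linf_measurable: "L1_plus_Linf M \<subseteq> borel_measurable M"
  by (auto simp: L1_plus_Linf_def Lp_space_def)

lemma L1_plus_Linf_lincomb:
  assumes "f \<in> L1_plus_Linf M" "g \<in> L1_plus_Linf M"
  shows "(\<lambda>x. a * f x + b * g x) \<in> L1_plus_Linf M"
proof -
  obtain f1 f2 where f: "f = (\<lambda>x. f1 x + f2 x)" "integrable M f1" "f2 \<in> Lp_space M top"
    using assms(1) by (auto simp: L1_plus_Linf_def Lp_space_1_iff)
  obtain g1 g2 where g: "g = (\<lambda>x. g1 x + g2 x)" "integrable M g1" "g2 \<in> Lp_space M top"
    using assms(2) by (auto simp: L1_plus_Linf_def Lp_space_1_iff)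
  have "integrable M (\<lambda>x. a * f1 x + b * g1 x)" using f g by auto
  moreover have "(\<lambda>x. a * f2 x + b * g2 x) \<in> Lp_space M top"
  proof -
    obtain c d where c: "0 \<le> c" "AE x in M. cmod (f2 x) \<le> c" and d: "0 \<le> d" "AE x in M. cmod (g2 x)
        \<le> d"
      using f g by (auto simp: Lp_space_top_iff)
    have "AE x in M. cmod (a * f2 x + b * g2 x) \<le> cmod a * c + cmod b * d"
      using c(2) d(2)
    proof eventually_elim
      case (elim x)
      have "cmod (a * f2 x + b * g2 x) \<le> cmod a * cmod (f2 x) + cmod b * cmod (g2 x)"
        by (metis norm_triangle_ineq norm_mult)
      also have "\<dots> \<le> cmod a * c + cmod b * d" using elim by (intro add_mono mult_left_mono) auto
      finally show ?case .
    qed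
    moreover have "f2 \<in> borel_measurable M" "g2 \<in> borel_measurable M"
      using f g by (auto simp: Lp_space_def)
    ultimately show ?thesis using c(1) d(1)
      by (auto simp: Lp_space_top_iff intro!: exI[of _ "cmod a * c + cmod b * d"])
  qed
  ultimately have "(\<lambda>x. (a * f1 x + b * g1 x) + (a * f2 x + b * g2 x)) \<in> L1_plus_Linf M"
    by (rule L1_plus_Linf_I)
  then show ?thesis unfolding f g by (simp add: algebra_simps)
qed

text \<open>Cut \<open>f\<close> at modulus 1: where the modulus exceeds 1 it is dominated by its
  \<open>r\<close>-th power, hence integrable, and the rest is bounded by 1.\<close>

lemma Lp_space_subset_L1_plus_Linf:
  assumes "1 \<le> p"
  shows "Lp_space M p \<subseteq> L1_plus_Linf M"
proof
  fix f assume f: "f \<in> Lp_space M p"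
  then have [measurable]: "f \<in> borel_measurable M" by (simp add: Lp_space_def)
  show "f \<in> L1_plus_Linf M"
    using assms
  proof (cases rule: ennreal_exponent_cases)
    case 1
    then show ?thesis using f L1_plus_Linf_I[of M "\<lambda>_. 0" f] by simp
  next
    case (2 r)
    define g where "g x = (if cmod (f x) > 1 then f x else 0)" for x
    define h where "h x = (if cmod (f x) > 1 then 0 else f x)" for x
    have gm[measurable]: "g \<in> borel_measurable M" and hm: "h \<in> borel_measurable M"
      unfolding g_def h_def by measurable
    have "v \<le> v powr r" if "v > 1" for v :: real
      using that 2(1) powr_mono[of 1 r v] by auto
    then have "(\<integral>\<^sup>+x. ennreal (norm (g x)) \<partial>M) \<le> (\<integral>\<^sup>+x. ennreal (cmod (f x) powr r) \<partial>M)"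
      by (intro nn_integral_mono) (auto simp: g_def intro!: ennreal_leI)
    also have "\<dots> < \<infinity>" using f 2 by (simp add: Lp_space_ennreal_iff)
    finally have "integrable M g" using gm by (simp add: integrable_iff_bounded)
    moreover have "h \<in> Lp_space M top"
      unfolding Lp_space_top_iff using hm by (auto simp: h_def intro!: exI[of _ 1])
    ultimately have "(\<lambda>x. g x + h x) \<in> L1_plus_Linf M" by (rule L1_plus_Linf_I)
    moreover have "f = (\<lambda>x. g x + h x)" by (auto simp: g_def h_def)
    ultimately show ?thesis by simp
  qed
qed

text \<open>The right side is the tangent line at \<open>v = s\<close> of the concave function
  \<open>v powr p \<mapsto> v\<close>; it comes from Young's inequality for \<open>v\<close> and
  \<open>s powr (p - 1)\<close>. Being affine in \<open>v powr p\<close>, the bound can be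
  integrated directly against a kernel, and \<open>s\<close> is chosen afterwards.\<close>

lemma Young_linearized:
  fixes p s v :: real
  assumes p: "1 \<le> p" and s: "0 < s" and v: "0 \<le> v"
  shows "v \<le> s powr (1 - p) / p * v powr p + (1 - 1 / p) * s"
proof (cases "p = 1")
  case True then show ?thesis using s v by simp
next
  case False
  define q where "q = p / (p - 1)"
  have pq: "1 < p" "1 < q" "1 / p + 1 / q = 1" using False p by (auto simp: q_def field_simps)
  have "(s powr (p - 1)) powr q = s powr p" using pq by (simp add: powr_powr q_def)
  then have "v * s powr (p - 1) \<le> v powr p / p + s powr p / q"
    using Youngs_inequality[OF pq(1,2,3) v, of "s powr (p - 1)"] by simp
  then have "s powr (1 - p) * (v * s powr (p - 1)) \<le> s powr (1 - p) * (v powr p / p + s powr p / q)"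
    by (intro mult_left_mono) auto
  moreover have "s powr (1 - p) * s powr (p - 1) = 1" "s powr (1 - p) * s powr p = s"
    using s by (simp_all add: powr_add[symmetric])
  moreover have "1 / q = 1 - 1 / p" using pq by simp
  ultimately show ?thesis
    by (simp add: distrib_left mult.assoc[symmetric] divide_inverse)
       (simp add: mult_ac)
qed

lemma borel_measurable_cnj[measurable (raw)]:
  "f \<in> borel_measurable M \<Longrightarrow> (\<lambda>x. cnj (f x)) \<in> borel_measurable M"
  by (rule borel_measurable_continuous_on[OF continuous_on_cnj[OF continuous_on_id]])

section \<open>Schur's test for nonnegative symmetric kernels\<close>

definition kernel_op :: "'a measure \<Rightarrow> ('a \<Rightarrow> 'a \<Rightarrow> real) \<Rightarrow> ('a \<Rightarrow> complex) \<Rightarrow> 'a \<Rightarrow> complex" where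
  "kernel_op M k f x = (\<integral>y. complex_of_real (k x y) * f y \<partial>M)"

text \<open>Symmetry lets one marginal bound serve for both variables. The constant \<open>C\<close>
  is kept free because the same kernel is used with two values: \<open>C = 1\<close> for the axioms
  of a semigroup, and the power of cosh for the norm estimate.\<close>

locale symmetric_kernel = sigma_finite_measure M for M :: "'a measure" +
  fixes k :: "'a \<Rightarrow> 'a \<Rightarrow> real" and C :: real
  assumes kernel_measurable: "case_prod k \<in> borel_measurable (M \<Otimes>\<^sub>M M)"
    and kernel_nonneg: "\<And>x y. x \<in> space M \<Longrightarrow> y \<in> space M \<Longrightarrow> 0 \<le> k x y"
    and kernel_sym: "\<And>x y. x \<in> space M \<Longrightarrow> y \<in> space M \<Longrightarrow> k x y = k y x"
    and kernel_bound: "\<And>x. x \<in> space M \<Longrightarrow> (\<integral>\<^sup>+y. ennreal (k x y) \<partial>M) \<le> ennreal C"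
    and C_pos: "0 < C"
begin

lemma kernel_measurable'[measurable (raw)]:
  assumes "f \<in> N \<rightarrow>\<^sub>M M" "g \<in> N \<rightarrow>\<^sub>M M"
  shows "(\<lambda>x. k (f x) (g x)) \<in> borel_measurable N"
  using measurable_compose[OF measurable_Pair[OF assms] kernel_measurable] by simp

lemma kernel_op_measurable[measurable]:
  assumes [measurable]: "f \<in> borel_measurable M"
  shows "kernel_op M k f \<in> borel_measurable M"
  unfolding kernel_op_def[abs_def] by measurable

lemma cmod_kernel_op_le:
  assumes [measurable]: "f \<in> borel_measurable M" and x[measurable]: "x \<in> space M"
  shows "ennreal (cmod (kernel_op M k f x)) \<le> (\<integral>\<^sup>+y. ennreal (k x y * cmod (f y)) \<partial>M)"
proof (cases "integrable M (\<lambda>y. complex_of_real (k x y) * f y)")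
  case True
  have "ennreal (cmod (kernel_op M k f x)) \<le> (\<integral>\<^sup>+y. ennreal (norm (complex_of_real (k x y) * f y))
      \<partial>M)"
    unfolding kernel_op_def using True by (rule integral_norm_bound_ennreal)
  also have "\<dots> = (\<integral>\<^sup>+y. ennreal (k x y * cmod (f y)) \<partial>M)"
    using x kernel_nonneg by (intro nn_integral_cong) (simp add: norm_mult)
  finally show ?thesis .
next
  \<comment> \<open>A divergent Bochner integral is 0 by convention, so the bound needs no
    integrability hypothesis.\<close>
  case False
  then show ?thesis by (simp add: kernel_op_def not_integrable_integral_eq)
qed

text \<open>Tonelli makes \<open>x\<close> the inner variable, and symmetry turns the resulting
  marginal into the one that \<open>kernel_bound\<close> controls.\<close>

lemma nn_integral_kernel_le:
  assumes [measurable]: "u \<in> borel_measurable M"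
  shows "(\<integral>\<^sup>+x. (\<integral>\<^sup>+y. ennreal (k x y) * u y \<partial>M) \<partial>M) \<le> ennreal C * (\<integral>\<^sup>+y. u y \<partial>M)"
proof -
  interpret pair_sigma_finite M M ..
  have "(\<integral>\<^sup>+x. (\<integral>\<^sup>+y. ennreal (k x y) * u y \<partial>M) \<partial>M) = (\<integral>\<^sup>+y. (\<integral>\<^sup>+x. ennreal (k x y) * u y \<partial>M) \<partial>M)"
    by (rule Fubini'[symmetric]) measurable
  also have "\<dots> = (\<integral>\<^sup>+y. (\<integral>\<^sup>+x. ennreal (k x y) \<partial>M) * u y \<partial>M)"
    by (intro nn_integral_cong nn_integral_multc) measurable
  also have "\<dots> = (\<integral>\<^sup>+y. (\<integral>\<^sup>+x. ennreal (k y x) \<partial>M) * u y \<partial>M)"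
    by (intro nn_integral_cong arg_cong2[where f="(*)"] refl) (simp add: kernel_sym)
  also have "\<dots> \<le> (\<integral>\<^sup>+y. ennreal C * u y \<partial>M)"
    by (intro nn_integral_mono mult_right_mono kernel_bound) auto
  also have "\<dots> = ennreal C * (\<integral>\<^sup>+y. u y \<partial>M)" by (rule nn_integral_cmult) measurable
  finally show ?thesis .
qed

text \<open>Hoelder's inequality for the measure with density \<open>k x\<close> with respect to
  \<open>M\<close>, whose mass is at most \<open>C\<close>. Since it is pointwise in
  \<open>x\<close>, the bound in the p-th mean needs only Tonelli afterwards.\<close>

lemma kernel_op_powr_le:
  assumes [measurable]: "f \<in> borel_measurable M" and x[measurable]: "x \<in> space M" and p: "1 \<le> p"
  shows "ennreal (cmod (kernel_op M k f x) powr p)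
    \<le> ennreal (C powr (p - 1)) * (\<integral>\<^sup>+y. ennreal (k x y) * ennreal (cmod (f y) powr p) \<partial>M)"
    (is "_ \<le> _ * ?P")
proof -
  define A where "A = cmod (kernel_op M k f x)"
  \<comment> \<open>The linearization point \<open>A / C\<close> must be positive, so
    \<open>A = 0\<close> is split off; an infinite right side is split off too, which leaves an
    inequality between reals.\<close>
  consider "A = 0" | "?P = \<infinity>" | P where "0 < A" "0 \<le> P" "?P = ennreal P"
    by (cases ?P) (auto simp: A_def)
  then show ?thesis
  proof cases
    case 1 then show ?thesis unfolding A_def by simp
  next
    case 2 then show ?thesis using C_pos by (simp add: ennreal_mult_top)
  next
    case 3
    \<comment> \<open>Linearizing at \<open>s = A / C\<close> turns Young's inequality into the power mean inequality for the kernel.\<close>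
    define s where "s = A / C"
    have s: "0 < s" using 3 C_pos by (simp add: s_def)
    define a where "a = s powr (1 - p) / p"
    define b where "b = (1 - 1 / p) * s"
    have a0: "0 \<le> a" and b0: "0 \<le> b" using p s by (auto simp: a_def b_def)
    have "ennreal A \<le> (\<integral>\<^sup>+y. ennreal (k x y * cmod (f y)) \<partial>M)"
      unfolding A_def by (rule cmod_kernel_op_le) (use x in auto)
    also have "\<dots> \<le> (\<integral>\<^sup>+y. ennreal a * (ennreal (k x y) * ennreal (cmod (f y) powr p)) + ennreal b *
        ennreal (k x y) \<partial>M)"
    proof (rule nn_integral_mono)
      fix y assume y: "y \<in> space M"
      have "k x y * cmod (f y) \<le> k x y * (a * cmod (f y) powr p + b)"
        unfolding a_def b_def using kernel_nonneg[OF x y] p s by (intro mult_left_mono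
            Young_linearized) auto
      then have "ennreal (k x y * cmod (f y)) \<le> ennreal (a * (k x y * cmod (f y) powr p) + b * k x
          y)"
        by (intro ennreal_leI) (simp add: algebra_simps)
      then show "ennreal (k x y * cmod (f y)) \<le> ennreal a * (ennreal (k x y) * ennreal (cmod (f y)
          powr p)) + ennreal b * ennreal (k x y)"
        using a0 b0 kernel_nonneg[OF x y] by (simp add: ennreal_plus ennreal_mult)
    qed
    also have "\<dots> = ennreal a * ?P + ennreal b * (\<integral>\<^sup>+y. ennreal (k x y) \<partial>M)"
      by (simp add: nn_integral_add nn_integral_cmult)
    also have "\<dots> \<le> ennreal a * ?P + ennreal b * ennreal C"
      by (intro add_mono mult_left_mono kernel_bound x) auto
    also have "\<dots> = ennreal (a * P + b * C)"
      using a0 b0 3 C_pos by (simp add: ennreal_plus ennreal_mult)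
    finally have "A \<le> a * P + b * C" using a0 b0 3 C_pos by (subst (asm) ennreal_le_iff) auto
    \<comment> \<open>Since \<open>s = A / C\<close>, the term \<open>b * C\<close> equals
      \<open>(1 - 1 / p) * A\<close> and is absorbed into the left side.\<close>
    then have "A / p \<le> s powr (1 - p) / p * P"
      using C_pos by (simp add: a_def b_def s_def algebra_simps)
    then have "A \<le> s powr (1 - p) * P" using p by (simp add: field_simps)
    then have "s powr (p - 1) * A \<le> s powr (p - 1) * (s powr (1 - p) * P)" by (intro mult_left_mono)
        auto
    also have "\<dots> = P" using s by (simp add: mult.assoc[symmetric] powr_add[symmetric])
    finally have "s powr (p - 1) * A \<le> P" .
    then have "C powr (p - 1) * (s powr (p - 1) * A) \<le> C powr (p - 1) * P" by (intro mult_left_mono)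
        auto
    moreover have "C powr (p - 1) * (s powr (p - 1) * A) = A powr p"
      using 3 C_pos by (simp add: s_def powr_divide powr_diff)
    ultimately show ?thesis unfolding 3(3) A_def[symmetric]
      by (simp add: ennreal_mult[symmetric] 3 ennreal_leI)
  qed
qed

lemma nn_integral_kernel_op_powr_le:
  assumes [measurable]: "f \<in> borel_measurable M" and p: "1 \<le> p"
  shows "(\<integral>\<^sup>+x. ennreal (cmod (kernel_op M k f x) powr p) \<partial>M)
    \<le> ennreal (C powr p) * (\<integral>\<^sup>+y. ennreal (cmod (f y) powr p) \<partial>M)"
proof -
  have "(\<integral>\<^sup>+x. ennreal (cmod (kernel_op M k f x) powr p) \<partial>M)
     \<le> (\<integral>\<^sup>+x. ennreal (C powr (p - 1)) * (\<integral>\<^sup>+y. ennreal (k x y) * ennreal (cmod (f y) powr p) \<partial>M)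
         \<partial>M)"
    by (intro nn_integral_mono kernel_op_powr_le p assms)
  also have "\<dots> = ennreal (C powr (p - 1)) * (\<integral>\<^sup>+x. (\<integral>\<^sup>+y. ennreal (k x y) * ennreal (cmod (f y) powr
      p) \<partial>M) \<partial>M)"
    by (rule nn_integral_cmult) measurable
  also have "\<dots> \<le> ennreal (C powr (p - 1)) * (ennreal C * (\<integral>\<^sup>+y. ennreal (cmod (f y) powr p) \<partial>M))"
    by (intro mult_left_mono nn_integral_kernel_le) auto
  also have "\<dots> = ennreal (C powr p) * (\<integral>\<^sup>+y. ennreal (cmod (f y) powr p) \<partial>M)"
    using C_pos by (simp add: mult.assoc[symmetric] ennreal_mult[symmetric] powr_diff)
  finally show ?thesis .
qed

lemma Lp_norm_kernel_op_le:
  assumes [measurable]: "f \<in> borel_measurable M" and p: "1 \<le> p"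
  shows "Lp_norm M p (kernel_op M k f) \<le> ennreal C * Lp_norm M p f"
  using p
proof (cases rule: ennreal_exponent_cases)
  \<comment> \<open>For an infinite exponent there is no power to average; the essential supremum is
    pulled out of the kernel integral, whose mass is at most \<open>C\<close>.\<close>
  case 1
  define E where "E = esssup M (\<lambda>x. ennreal (cmod (f x)))"
  have "ennreal (cmod (kernel_op M k f x)) \<le> ennreal C * E" if x[measurable]: "x \<in> space M" for x
  proof -
    have "ennreal (cmod (kernel_op M k f x)) \<le> (\<integral>\<^sup>+y. ennreal (k x y * cmod (f y)) \<partial>M)"
      by (rule cmod_kernel_op_le[OF assms(1) x])
    also have "\<dots> \<le> (\<integral>\<^sup>+y. ennreal (k x y) * E \<partial>M)"
    proof (rule nn_integral_mono_AE)
      show "AE y in M. ennreal (k x y * cmod (f y)) \<le> ennreal (k x y) * E"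
        using esssup_AE[of "\<lambda>x. ennreal (cmod (f x))" M] AE_space[of M]
      proof eventually_elim
        case (elim y)
        have "ennreal (k x y) * ennreal (cmod (f y)) \<le> ennreal (k x y) * E"
          using elim(1) unfolding E_def by (rule mult_left_mono) simp
        then show ?case using kernel_nonneg[OF x elim(2)] by (simp only: ennreal_mult norm_ge_zero)
      qed
    qed
    also have "\<dots> = (\<integral>\<^sup>+y. ennreal (k x y) \<partial>M) * E"
      by (rule nn_integral_multc) measurable
    also have "\<dots> \<le> ennreal C * E" by (intro mult_right_mono kernel_bound x) auto
    finally show ?thesis .
  qed
  then have "esssup M (\<lambda>x. ennreal (cmod (kernel_op M k f x))) \<le> ennreal C * E"
    by (intro esssup_I) auto
  then show ?thesis using 1 by (simp add: Lp_norm_def E_def)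
next
  case (2 r)
  note le = nn_integral_kernel_op_powr_le[OF assms(1) 2(1)]
  show ?thesis
  proof (cases "(\<integral>\<^sup>+y. ennreal (cmod (f y) powr r) \<partial>M)")
    case (real I)
    then have le': "(\<integral>\<^sup>+x. ennreal (cmod (kernel_op M k f x) powr r) \<partial>M) \<le> ennreal (C powr r * I)"
      using le by (simp add: ennreal_mult)
    then obtain I' where I': "0 \<le> I'" "(\<integral>\<^sup>+x. ennreal (cmod (kernel_op M k f x) powr r) \<partial>M) =
        ennreal I'"
      by (cases "(\<integral>\<^sup>+x. ennreal (cmod (kernel_op M k f x) powr r) \<partial>M)") (auto simp: top_unique)
    have "I' \<le> C powr r * I" using le' real I' by (simp add: ennreal_le_iff)
    then have "I' powr (1 / r) \<le> (C powr r * I) powr (1 / r)" using I' 2 by (intro powr_mono2) auto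
    also have "\<dots> = C * I powr (1 / r)" using real C_pos 2 by (simp add: powr_mult powr_powr)
    finally show ?thesis using I' real 2 C_pos
      by (simp add: Lp_norm_ennreal ennreal_mult[symmetric] ennreal_leI)
  next
    case top
    \<comment> \<open>Positivity of \<open>C\<close> matters: it keeps
      \<open>C * \<infinity> = \<infinity>\<close>, whereas \<open>0 * \<infinity>\<close> is 0 in
      \<open>ennreal\<close>.\<close>
    then show ?thesis using 2 C_pos by (simp add: Lp_norm_ennreal ennreal_mult_top)
  qed
qed

lemma kernel_op_Lp:
  assumes "f \<in> Lp_space M p" "1 \<le> p"
  shows "kernel_op M k f \<in> Lp_space M p"
proof -
  have [measurable]: "f \<in> borel_measurable M" using assms by (simp add: Lp_space_def)
  have "Lp_norm M p (kernel_op M k f) \<le> ennreal C * Lp_norm M p f" using assms(2) by (intro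
      Lp_norm_kernel_op_le) auto
  also have "\<dots> < \<infinity>" using assms by (simp add: Lp_space_def ennreal_mult_less_top)
  finally show ?thesis by (simp add: Lp_space_def)
qed

lemma Lp_opnorm_kernel_op_le:
  assumes "1 \<le> p"
  shows "Lp_opnorm M p (kernel_op M k) \<le> ennreal C"
  unfolding Lp_opnorm_def
proof (rule SUP_least)
  fix f assume f: "f \<in> {f \<in> Lp_space M p. Lp_norm M p f \<le> 1}"
  then have "Lp_norm M p (kernel_op M k f) \<le> ennreal C * Lp_norm M p f"
    using assms by (intro Lp_norm_kernel_op_le) (auto simp: Lp_space_def)
  also have "\<dots> \<le> ennreal C * 1" using f by (intro mult_left_mono) auto
  finally show "Lp_norm M p (kernel_op M k f) \<le> ennreal C" by simp
qed

lemma kernel_op_cong: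
  assumes [measurable]: "f \<in> borel_measurable M" "g \<in> borel_measurable M"
    and "AE x in M. f x = g x" and x[measurable]: "x \<in> space M"
  shows "kernel_op M k f x = kernel_op M k g x"
  unfolding kernel_op_def using assms(3)
  by (intro integral_cong_AE) (measurable, auto elim!: eventually_mono)

text \<open>The integrable part has a finite double integral by
  \<open>nn_integral_kernel_le\<close>, so its inner integral is finite almost everywhere; the
  bounded part is controlled at every point by the mass of the kernel. This is what makes the
  Bochner integral in \<open>kernel_op\<close> meaningful on the whole domain.\<close>

lemma AE_kernel_finite:
  assumes "f \<in> L1_plus_Linf M"
  shows "AE x in M. (\<integral>\<^sup>+y. ennreal (k x y * cmod (f y)) \<partial>M) < \<infinity>"
proof -
  obtain g h where f: "f = (\<lambda>x. g x + h x)" and g: "integrable M g" and h: "h \<in> Lp_space M top"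
    using assms by (auto simp: L1_plus_Linf_def Lp_space_1_iff)
  obtain c where c: "0 \<le> c" "AE x in M. cmod (h x) \<le> c" using h by (auto simp: Lp_space_top_iff)
  have [measurable]: "g \<in> borel_measurable M" "h \<in> borel_measurable M"
    using g h by (auto simp: Lp_space_def)
  have "(\<integral>\<^sup>+x. (\<integral>\<^sup>+y. ennreal (k x y) * ennreal (cmod (g y)) \<partial>M) \<partial>M) \<le> ennreal C * (\<integral>\<^sup>+y. ennreal
      (cmod (g y)) \<partial>M)"
    by (rule nn_integral_kernel_le) measurable
  also have "\<dots> < \<infinity>" using g by (simp add: integrable_iff_bounded ennreal_mult_less_top)
  finally have "AE x in M. (\<integral>\<^sup>+y. ennreal (k x y) * ennreal (cmod (g y)) \<partial>M) \<noteq> \<infinity>"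
    by (intro nn_integral_PInf_AE) auto
  then show ?thesis using AE_space[of M]
  proof eventually_elim
    case (elim x)
    note [measurable] = elim(2)
    have "(\<integral>\<^sup>+y. ennreal (k x y * cmod (f y)) \<partial>M)
       \<le> (\<integral>\<^sup>+y. ennreal (k x y) * ennreal (cmod (g y)) + ennreal (k x y) * ennreal c \<partial>M)"
      using c(2) AE_space[of M]
    proof (intro nn_integral_mono_AE, eventually_elim)
      fix y assume y: "cmod (h y) \<le> c" "y \<in> space M"
      have "k x y * cmod (f y) \<le> k x y * (cmod (g y) + c)"
        unfolding f using y kernel_nonneg[OF elim(2) y(2)] norm_triangle_ineq[of "g y" "h y"]
        by (intro mult_left_mono) auto
      then show "ennreal (k x y * cmod (f y)) \<le> ennreal (k x y) * ennreal (cmod (g y)) + ennreal (k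
          x y) * ennreal c"
        using kernel_nonneg[OF elim(2) y(2)] c(1)
        by (simp add: ennreal_mult[symmetric] ennreal_plus[symmetric] distrib_left ennreal_leI del:
            ennreal_plus)
    qed
    also have "\<dots> = (\<integral>\<^sup>+y. ennreal (k x y) * ennreal (cmod (g y)) \<partial>M) + (\<integral>\<^sup>+y. ennreal (k x y) \<partial>M) *
        ennreal c"
      by (simp add: nn_integral_add nn_integral_multc)
    also have "\<dots> < \<infinity>" using elim(1) le_less_trans[OF kernel_bound[OF elim(2)] ennreal_less_top]
      by (simp add: ennreal_mult_less_top less_top)
    finally show ?case .
  qed
qed

lemma integrable_kernel:
  assumes [measurable]: "f \<in> borel_measurable M" and x[measurable]: "x \<in> space M"
    and "(\<integral>\<^sup>+y. ennreal (k x y * cmod (f y)) \<partial>M) < \<infinity>"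
  shows "integrable M (\<lambda>y. complex_of_real (k x y) * f y)"
proof (rule integrableI_bounded)
  have "(\<integral>\<^sup>+y. ennreal (norm (complex_of_real (k x y) * f y)) \<partial>M) = (\<integral>\<^sup>+y. ennreal (k x y * cmod (f
      y)) \<partial>M)"
    using kernel_nonneg[OF x] by (intro nn_integral_cong) (simp add: norm_mult)
  then show "(\<integral>\<^sup>+y. ennreal (norm (complex_of_real (k x y) * f y)) \<partial>M) < \<infinity>" using assms(3) by simp
qed measurable

lemma AE_integrable_kernel:
  assumes "f \<in> L1_plus_Linf M"
  shows "AE x in M. integrable M (\<lambda>y. complex_of_real (k x y) * f y)"
  using AE_kernel_finite[OF assms] AE_space[of M]
proof eventually_elim
  case (elim x)
  then show ?case using assms L1_plus_Linf_measurable by (intro integrable_kernel) auto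
qed

text \<open>Additivity of the Bochner integral needs both integrals to converge, which is known only
  almost everywhere; hence the exceptional null set.\<close>

lemma kernel_op_linear:
  assumes "f \<in> L1_plus_Linf M" "g \<in> L1_plus_Linf M"
  shows "AE x in M. kernel_op M k (\<lambda>y. a * f y + b * g y) x = a * kernel_op M k f x + b * kernel_op
      M k g x"
  using AE_integrable_kernel[OF assms(1)] AE_integrable_kernel[OF assms(2)]
proof eventually_elim
  case (elim x)
  have "kernel_op M k (\<lambda>y. a * f y + b * g y) x
      = (\<integral>y. a * (complex_of_real (k x y) * f y) + b * (complex_of_real (k x y) * g y) \<partial>M)"
    unfolding kernel_op_def by (intro Bochner_Integration.integral_cong refl) (simp add:
        algebra_simps)
  also have "\<dots> = a * kernel_op M k f x + b * kernel_op M k g x"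
    unfolding kernel_op_def using elim by (subst Bochner_Integration.integral_add) auto
  finally show ?case .
qed

lemma kernel_op_nonneg:
  assumes [measurable]: "f \<in> borel_measurable M" and f: "AE x in M. 0 \<le> f x" and x[measurable]: "x \<in>
      space M"
  shows "0 \<le> kernel_op M k f x"
proof -
  have "kernel_op M k f x = (\<integral>y. complex_of_real (k x y * Re (f y)) \<partial>M)"
    unfolding kernel_op_def using f
    by (intro integral_cong_AE) (measurable, auto simp: less_eq_complex_def complex_eq_iff)
  also have "\<dots> = complex_of_real (\<integral>y. k x y * Re (f y) \<partial>M)" by (rule integral_complex_of_real)
  finally have "kernel_op M k f x = complex_of_real (\<integral>y. k x y * Re (f y) \<partial>M)" .
  moreover have "0 \<le> (\<integral>y. k x y * Re (f y) \<partial>M)"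
    using f AE_space[of M]
  proof (intro integral_nonneg_AE, eventually_elim)
    case (elim y) then show ?case using kernel_nonneg[OF x, of y] by (auto simp:
        less_eq_complex_def)
  qed
  ultimately show ?thesis by (simp add: less_eq_complex_def)
qed

text \<open>Bounding the product of \<open>cmod (f y)\<close> and \<open>cmod (g x)\<close> by the
  sum of their squares separates the variables, so that each term is integrated with one marginal of
  the kernel. The result is the hypothesis of Fubini's theorem for self-adjointness.\<close>

lemma integrable_kernel_L2_pair:
  assumes "f \<in> Lp_space M 2" "g \<in> Lp_space M 2"
  shows "integrable (M \<Otimes>\<^sub>M M) (\<lambda>(x, y). complex_of_real (k x y) * f y * cnj (g x))"
proof (rule integrableI_bounded)
  note fst = nn_integral_fst
  interpret pair_sigma_finite M M ..
  have [measurable]: "f \<in> borel_measurable M" "g \<in> borel_measurable M"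
    using assms by (auto simp: Lp_space_def)
  define F where "F = (\<lambda>(x, y). complex_of_real (k x y) * f y * cnj (g x))"
  have F[measurable]: "F \<in> borel_measurable (M \<Otimes>\<^sub>M M)" unfolding F_def by measurable
  then show "(\<lambda>(x, y). complex_of_real (k x y) * f y * cnj (g x)) \<in> borel_measurable (M \<Otimes>\<^sub>M M)"
    by (simp add: F_def)
  have "(\<integral>\<^sup>+z. ennreal (norm (F z)) \<partial>(M \<Otimes>\<^sub>M M)) = (\<integral>\<^sup>+x. (\<integral>\<^sup>+y. ennreal (norm (F (x, y))) \<partial>M) \<partial>M)"
    by (rule fst[symmetric]) measurable
  also have "\<dots> = (\<integral>\<^sup>+x. (\<integral>\<^sup>+y. ennreal (norm (complex_of_real (k x y) * f y * cnj (g x))) \<partial>M) \<partial>M)"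
    by (simp add: F_def)
  also have "\<dots> \<le> (\<integral>\<^sup>+x. (\<integral>\<^sup>+y. ennreal (k x y) * ennreal ((cmod (f y))\<^sup>2) + ennreal ((cmod (g x))\<^sup>2)
      * ennreal (k x y) \<partial>M) \<partial>M)"
  proof (intro nn_integral_mono)
    fix x y assume "x \<in> space M" "y \<in> space M"
    then have k: "0 \<le> k x y" by (rule kernel_nonneg)
    have "cmod (f y) * cmod (g x) \<le> (cmod (f y))\<^sup>2 + (cmod (g x))\<^sup>2"
      using sum_squares_bound[of "cmod (f y)" "cmod (g x)"] mult_nonneg_nonneg[OF norm_ge_zero[of "f
          y"] norm_ge_zero[of "g x"]] by linarith
    then have "k x y * (cmod (f y) * cmod (g x)) \<le> k x y * ((cmod (f y))\<^sup>2 + (cmod (g x))\<^sup>2)"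
      using k by (rule mult_left_mono)
    then have "norm (complex_of_real (k x y) * f y * cnj (g x)) \<le> k x y * (cmod (f y))\<^sup>2 + (cmod (g
        x))\<^sup>2 * k x y"
      using k by (simp add: norm_mult algebra_simps)
    then show "ennreal (norm (complex_of_real (k x y) * f y * cnj (g x))) \<le>
        ennreal (k x y) * ennreal ((cmod (f y))\<^sup>2) + ennreal ((cmod (g x))\<^sup>2) * ennreal (k x y)"
      using k by (simp add: ennreal_mult[symmetric] ennreal_plus[symmetric] ennreal_leI del:
          ennreal_plus)
  qed
  also have "\<dots> = (\<integral>\<^sup>+x. (\<integral>\<^sup>+y. ennreal (k x y) * ennreal ((cmod (f y))\<^sup>2) \<partial>M) + ennreal ((cmod (g
      x))\<^sup>2) * (\<integral>\<^sup>+y. ennreal (k x y) \<partial>M) \<partial>M)"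
    by (intro nn_integral_cong) (simp add: nn_integral_add nn_integral_cmult)
  also have "\<dots> \<le> (\<integral>\<^sup>+x. (\<integral>\<^sup>+y. ennreal (k x y) * ennreal ((cmod (f y))\<^sup>2) \<partial>M) + ennreal ((cmod (g
      x))\<^sup>2) * ennreal C \<partial>M)"
    by (intro nn_integral_mono add_mono mult_left_mono kernel_bound) auto
  also have "\<dots> = (\<integral>\<^sup>+x. (\<integral>\<^sup>+y. ennreal (k x y) * ennreal ((cmod (f y))\<^sup>2) \<partial>M) \<partial>M) + (\<integral>\<^sup>+x. ennreal
      ((cmod (g x))\<^sup>2) \<partial>M) * ennreal C"
    by (simp add: nn_integral_add nn_integral_multc)
  also have "\<dots> \<le> ennreal C * (\<integral>\<^sup>+y. ennreal ((cmod (f y))\<^sup>2) \<partial>M) + (\<integral>\<^sup>+x. ennreal ((cmod (g x))\<^sup>2)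
      \<partial>M) * ennreal C"
    by (intro add_mono nn_integral_kernel_le) auto
  also have "\<dots> < \<infinity>" using assms by (auto simp: Lp_space_2_iff ennreal_mult_less_top)
  finally show "(\<integral>\<^sup>+z. ennreal (norm ((\<lambda>(x, y). complex_of_real (k x y) * f y * cnj (g x)) z)) \<partial>(M
      \<Otimes>\<^sub>M M)) < \<infinity>"
    by (simp only: F_def)
qed

text \<open>Fubini followed by the symmetry of the kernel, which passes through the conjugation
  because it is real.\<close>

lemma kernel_op_selfadjoint:
  assumes "f \<in> Lp_space M 2" "g \<in> Lp_space M 2"
  shows "(\<integral>x. kernel_op M k f x * cnj (g x) \<partial>M) = (\<integral>x. f x * cnj (kernel_op M k g x) \<partial>M)"
proof -
  interpret pair_sigma_finite M M ..
  note I = integrable_kernel_L2_pair[OF assms]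
  have "(\<integral>x. kernel_op M k f x * cnj (g x) \<partial>M) = (\<integral>x. (\<integral>y. complex_of_real (k x y) * f y * cnj (g x)
      \<partial>M) \<partial>M)"
    by (simp add: kernel_op_def)
  also have "\<dots> = (\<integral>y. (\<integral>x. complex_of_real (k x y) * f y * cnj (g x) \<partial>M) \<partial>M)"
    using integral_fst[OF I] integral_snd[OF I] by simp
  also have "\<dots> = (\<integral>y. f y * cnj (kernel_op M k g y) \<partial>M)"
  proof (intro Bochner_Integration.integral_cong refl)
    fix y assume y: "y \<in> space M"
    have "(\<integral>x. complex_of_real (k x y) * f y * cnj (g x) \<partial>M) = (\<integral>x. f y * cnj (complex_of_real (k y
        x) * g x) \<partial>M)"
      using y by (intro Bochner_Integration.integral_cong refl) (simp add: kernel_sym)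
    also have "\<dots> = f y * cnj (kernel_op M k g y)"
      unfolding kernel_op_def Bochner_Integration.integral_cnj[symmetric] by (rule
          integral_mult_right_zero)
    finally show "(\<integral>x. complex_of_real (k x y) * f y * cnj (g x) \<partial>M) = f y * cnj (kernel_op M k g
        y)" .
  qed
  finally show ?thesis .
qed

end

text \<open>The identity for the kernels does double duty. Integrated against
  \<open>cmod (f y)\<close> it evaluates the absolute double integral as that of
  \<open>k3 x y * cmod (f y)\<close>, finite for almost every \<open>x\<close>, so Fubini applies;
  after the exchange of integrals it evaluates the inner one. Working on the sum space treats all
  exponents at once.\<close>

lemma kernel_op_compose:
  assumes "symmetric_kernel M k1 C1" "symmetric_kernel M k2 C2" "symmetric_kernel M k3 C3"
    and CK: "\<And>x y. x \<in> space M \<Longrightarrow> y \<in> space M \<Longrightarrow>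
      (\<integral>\<^sup>+z. ennreal (k1 x z) * ennreal (k2 z y) \<partial>M) = ennreal (k3 x y)"
    and f: "f \<in> L1_plus_Linf M"
  shows "AE x in M. kernel_op M k3 f x = kernel_op M k1 (kernel_op M k2 f) x"
proof -
  interpret k1: symmetric_kernel M k1 C1 by fact
  interpret k2: symmetric_kernel M k2 C2 by fact
  interpret k3: symmetric_kernel M k3 C3 by fact
  interpret pair_sigma_finite M M ..
  have [measurable]: "f \<in> borel_measurable M" using f L1_plus_Linf_measurable by auto
  show ?thesis
    using k3.AE_kernel_finite[OF f] AE_space[of M]
  proof eventually_elim
    case (elim x)
    note x[measurable] = elim(2)
    define F where "F = (\<lambda>(z, y). complex_of_real (k1 x z) * (complex_of_real (k2 z y) * f y))"
    have F[measurable]: "F \<in> borel_measurable (M \<Otimes>\<^sub>M M)"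
      unfolding F_def by measurable
    have "(\<integral>\<^sup>+w. ennreal (norm (F w)) \<partial>(M \<Otimes>\<^sub>M M)) < \<infinity>"
    proof -
      have "(\<integral>\<^sup>+w. ennreal (norm (F w)) \<partial>(M \<Otimes>\<^sub>M M)) = (\<integral>\<^sup>+y. (\<integral>\<^sup>+z. ennreal (norm (F (z, y))) \<partial>M)
          \<partial>M)"
        by (rule nn_integral_snd[symmetric]) measurable
      also have "\<dots> = (\<integral>\<^sup>+y. (\<integral>\<^sup>+z. ennreal (k1 x z) * ennreal (k2 z y) * ennreal (cmod (f y)) \<partial>M)
          \<partial>M)"
        using k1.kernel_nonneg[OF x] k2.kernel_nonneg
        by (intro nn_integral_cong) (simp add: F_def norm_mult ennreal_mult mult_ac)
      also have "\<dots> = (\<integral>\<^sup>+y. (\<integral>\<^sup>+z. ennreal (k1 x z) * ennreal (k2 z y) \<partial>M) * ennreal (cmod (f y))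
          \<partial>M)"
        by (intro nn_integral_cong nn_integral_multc) measurable
      also have "\<dots> = (\<integral>\<^sup>+y. ennreal (k3 x y * cmod (f y)) \<partial>M)"
        using k3.kernel_nonneg[OF x] by (intro nn_integral_cong) (simp add: CK[OF x] ennreal_mult)
      finally show ?thesis using elim(1) by simp
    qed
    with F have I: "integrable (M \<Otimes>\<^sub>M M) (\<lambda>(z, y). complex_of_real (k1 x z) * (complex_of_real (k2 z
        y) * f y))"
      unfolding F_def by (rule integrableI_bounded)
    have "kernel_op M k1 (kernel_op M k2 f) x = (\<integral>z. (\<integral>y. complex_of_real (k1 x z) *
        (complex_of_real (k2 z y) * f y) \<partial>M) \<partial>M)"
      by (simp add: kernel_op_def)
    also have "\<dots> = (\<integral>y. (\<integral>z. complex_of_real (k1 x z) * (complex_of_real (k2 z y) * f y) \<partial>M) \<partial>M)"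
      using integral_fst[OF I] integral_snd[OF I] by simp
    also have "\<dots> = (\<integral>y. complex_of_real (k3 x y) * f y \<partial>M)"
    proof (intro Bochner_Integration.integral_cong refl)
      fix y assume y[measurable]: "y \<in> space M"
      have "(\<integral>z. complex_of_real (k1 x z) * (complex_of_real (k2 z y) * f y) \<partial>M)
         = (\<integral>z. complex_of_real (k1 x z * k2 z y) * f y \<partial>M)"
        by (simp add: mult.assoc)
      also have "\<dots> = complex_of_real (\<integral>z. k1 x z * k2 z y \<partial>M) * f y"
        by (simp only: integral_mult_left_zero integral_complex_of_real)
      also have "(\<integral>z. k1 x z * k2 z y \<partial>M) = k3 x y"
      proof (rule integral_eq_nn_integral[THEN trans])
        show "AE z in M. 0 \<le> k1 x z * k2 z y" using k1.kernel_nonneg[OF x] k2.kernel_nonneg[OF _ y]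
            by auto
        have "(\<integral>\<^sup>+z. ennreal (k1 x z * k2 z y) \<partial>M) = ennreal (k3 x y)"
          unfolding CK[OF x y, symmetric] using k1.kernel_nonneg[OF x] k2.kernel_nonneg[OF _ y]
          by (intro nn_integral_cong) (simp add: ennreal_mult)
        then show "enn2real (\<integral>\<^sup>+z. ennreal (k1 x z * k2 z y) \<partial>M) = k3 x y"
          using k3.kernel_nonneg[OF x y] by simp
      qed measurable
      finally show "(\<integral>z. complex_of_real (k1 x z) * (complex_of_real (k2 z y) * f y) \<partial>M) =
          complex_of_real (k3 x y) * f y" .
    qed
    finally show ?case by (simp add: kernel_op_def)
  qed
qed

section \<open>The modified Bessel series and the one-dimensional kernel\<close>

lemma suminf_swap_ennreal:
  fixes f :: "nat \<Rightarrow> nat \<Rightarrow> ennreal"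
  shows "(\<Sum>i. \<Sum>j. f i j) = (\<Sum>j. \<Sum>i. f i j)"
proof -
  have "(\<Sum>i. \<Sum>j. f i j) = (\<integral>\<^sup>+i. (\<Sum>j. f i j) \<partial>count_space UNIV)"
    by (simp add: nn_integral_count_space_nat)
  also have "\<dots> = (\<Sum>j. \<integral>\<^sup>+i. f i j \<partial>count_space UNIV)"
    by (rule nn_integral_suminf) simp
  finally show ?thesis by (simp add: nn_integral_count_space_nat)
qed

lemma suminf_ennreal_shift_zero:
  fixes f :: "nat \<Rightarrow> ennreal"
  assumes "\<And>i. i < m \<Longrightarrow> f i = 0"
  shows "(\<Sum>i. f i) = (\<Sum>i. f (i + m))"
  using suminf_offset[of f m] assms by simp

text \<open>This is the regularized hypergeometric function 0F1 with parameter \<open>a + 1\<close>,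
  that is, \<open>I_a\<close> stripped of its power:
  \<open>I_a z = (z / 2) powr a * bessel_series a ((z / 2)^2)\<close>. It is regular at 0, and for
  \<open>a > -1\<close> all its coefficients are positive.\<close>

definition bessel_series :: "real \<Rightarrow> real \<Rightarrow> real" where
  "bessel_series a w = (\<Sum>k. w ^ k * rGamma (real k + a + 1) / fact k)"

lemma rGamma_pos: "0 < x \<Longrightarrow> 0 < rGamma (x::real)"
  using Gamma_real_pos[of x] by (simp add: rGamma_inverse_Gamma)

lemma summable_bessel_series:
  assumes a: "-1 < a" and w: "0 \<le> w"
  shows "summable (\<lambda>k. w ^ k * rGamma (real k + a + 1) / fact k)"
\<comment> \<open>The ratio of consecutive terms is \<open>w / ((k + a + 1) * (k + 1))\<close>; from
  \<open>k \<ge> 2 * w\<close> on, the first factor exceeds \<open>2 * w\<close> because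
  \<open>a > -1\<close>.\<close>
proof (rule summable_ratio_test[of "1/2" "nat \<lceil>2 * w\<rceil> + 1"])
  fix k :: nat assume k: "nat \<lceil>2 * w\<rceil> + 1 \<le> k"
  then have k1: "1 \<le> real k" and k2: "2 * w \<le> real k" by linarith+
  have rec: "rGamma (real k + a + 1) = (real k + a + 1) * rGamma (real (Suc k) + a + 1)"
    using rGamma_plus1[of "real k + a + 1"] by (simp add: algebra_simps)
  have pos: "0 < rGamma (real (Suc k) + a + 1)" using a by (intro rGamma_pos) auto
  have "2 * w * 1 \<le> (real k + a + 1) * (real k + 1)"
    using k1 k2 w a by (intro mult_mono) auto
  then have "w * (w ^ k * rGamma (real (Suc k) + a + 1)) * 2
     \<le> (real k + a + 1) * (real k + 1) * (w ^ k * rGamma (real (Suc k) + a + 1))"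
    using mult_right_mono[of "2 * w" "(real k + a + 1) * (real k + 1)" "w ^ k * rGamma (real (Suc k)
        + a + 1)"]
      pos w by (simp add: mult_ac)
  then show "norm (w ^ Suc k * rGamma (real (Suc k) + a + 1) / fact (Suc k))
     \<le> 1 / 2 * norm (w ^ k * rGamma (real k + a + 1) / fact k)"
    using pos w a k1 unfolding rec by (simp add: abs_mult divide_simps) (simp add: algebra_simps)
qed simp

lemma bessel_series_nonneg: "-1 < a \<Longrightarrow> 0 \<le> w \<Longrightarrow> 0 \<le> bessel_series a w"
  unfolding bessel_series_def
  by (intro suminf_nonneg summable_bessel_series) (auto intro!: divide_nonneg_pos mult_nonneg_nonneg
      less_imp_le[OF rGamma_pos])

lemma ennreal_bessel_series:
  assumes "-1 < a" "0 \<le> w"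
  shows "ennreal (bessel_series a w) = (\<Sum>k. ennreal (w ^ k * rGamma (real k + a + 1) / fact k))"
  unfolding bessel_series_def
  by (intro suminf_ennreal2[symmetric] summable_bessel_series assms)
     (use assms in \<open>auto intro!: divide_nonneg_pos mult_nonneg_nonneg less_imp_le[OF rGamma_pos]\<close>)

lemma bessel_series_0: "bessel_series a 0 = rGamma (a + 1)"
  using powser_zero[of "\<lambda>k. rGamma (real k + a + 1) / fact k"] unfolding bessel_series_def
  by (simp add: mult.commute)

lemma bessel_I_eq_bessel_series:
  assumes "-1 < a" "0 < z"
  shows "bessel_I a z = (z / 2) powr a * bessel_series a ((z / 2)\<^sup>2)"
proof -
  have "(z / 2) powr (2 * real k + a) = (z / 2) powr a * ((z / 2)\<^sup>2) ^ k" for k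
  proof -
    have "(z / 2) powr (2 * real k) = ((z / 2)\<^sup>2) ^ k"
      using assms powr_realpow[of "z / 2" "2 * k"] by (simp add: power_mult)
    then show ?thesis by (simp add: powr_add)
  qed
  then have "bessel_I a z = (\<Sum>k. (z / 2) powr a * (((z / 2)\<^sup>2) ^ k * rGamma (real k + a + 1) / fact
      k))"
    unfolding bessel_I_def by (simp add: mult_ac)
  also have "\<dots> = (z / 2) powr a * bessel_series a ((z / 2)\<^sup>2)"
    unfolding bessel_series_def by (intro suminf_mult summable_bessel_series assms) simp
  finally show ?thesis .
qed

text \<open>Chu-Vandermonde for the binomial coefficient of \<open>j + (k + a)\<close> over
  \<open>k\<close>, rewritten with Gamma values. \<open>Gamma (real (j + k) + a + 1)\<close> couples
  the two indices; on the right each summand is a product of a function of \<open>j\<close> and a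
  function of \<open>k\<close>, so the double series below splits once \<open>m\<close> is
  fixed.\<close>

lemma rGamma_Vandermonde:
  assumes a: "-1 < a"
  shows "rGamma (real j + a + 1) * rGamma (real k + a + 1) * Gamma (real (j + k) + a + 1) / (fact j
      * fact k)
    = (\<Sum>m\<le>k. if m \<le> j then rGamma (real m + a + 1) / fact m / (fact (j - m) * fact (k - m)) else 0)"
        (is "_ = ?S")
proof -
  have gb: "(x + real n gchoose n) = Gamma (x + real n + 1) * rGamma (x + 1) / fact n"
    if "-1 < x" for x n
  proof -
    have "x + real n + 1 \<notin> \<int>\<^sub>\<le>\<^sub>0" using that by (auto elim!: nonpos_Ints_cases)
    from gbinomial_Gamma[of "x + real n" n] this that show ?thesis
      by (simp add: rGamma_inverse_Gamma field_simps)
  qed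
  have "rGamma (real k + a + 1) \<noteq> 0" "Gamma (real k + a + 1) \<noteq> 0"
    using rGamma_pos[of "real k + a + 1"] Gamma_real_pos[of "real k + a + 1"] a by linarith+
  have "rGamma (real j + a + 1) * Gamma (real (j + k) + a + 1) / fact k
      = (real j + (real k + a) gchoose k)"
    using gb[of "real j + a" k] a by (simp add: add_ac mult_ac)
  also have "\<dots> = (\<Sum>m\<le>k. (real j gchoose m) * (real k + a gchoose (k - m)))"
    by (simp add: gbinomial_Vandermonde[symmetric] atMost_atLeast0)
  also have "\<dots> = (\<Sum>m\<le>k. fact j * Gamma (real k + a + 1) *
      (if m \<le> j then rGamma (real m + a + 1) / fact m / (fact (j - m) * fact (k - m)) else 0))"
  proof (intro sum.cong refl)
    fix m assume "m \<in> {..k}"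
    then have "(real k + a gchoose (k - m)) = Gamma (real k + a + 1) * rGamma (real m + a + 1) /
        fact (k - m)"
      using gb[of "real m + a" "k - m"] a by (simp add: add_ac of_nat_diff)
    moreover have "(real j gchoose m) = (if m \<le> j then fact j / (fact m * fact (j - m)) else 0)"
      by (auto simp: binomial_gbinomial[symmetric] binomial_fact)
    ultimately show "(real j gchoose m) * (real k + a gchoose (k - m)) = fact j * Gamma (real k + a
        + 1) *
      (if m \<le> j then rGamma (real m + a + 1) / fact m / (fact (j - m) * fact (k - m)) else 0)"
      by simp
  qed
  also have "\<dots> = fact j * Gamma (real k + a + 1) * (\<Sum>m\<le>k.
      (if m \<le> j then rGamma (real m + a + 1) / fact m / (fact (j - m) * fact (k - m)) else 0))"
    by (simp only: sum_distrib_left)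
  finally have "rGamma (real j + a + 1) * Gamma (real (j + k) + a + 1) / fact k = fact j * Gamma
      (real k + a + 1) * ?S" .
  then have "rGamma (real k + a + 1) / fact j * (rGamma (real j + a + 1) * Gamma (real (j + k) + a +
      1) / fact k)
    = (rGamma (real k + a + 1) * Gamma (real k + a + 1)) * (fact j / fact j) * ?S" by simp
  moreover have "rGamma (real k + a + 1) * Gamma (real k + a + 1) = 1"
    using \<open>Gamma (real k + a + 1) \<noteq> 0\<close> by (simp add: rGamma_inverse_Gamma)
  ultimately show ?thesis by (simp add: mult_ac)
qed

lemma suminf_exp_shift:
  assumes "0 \<le> a"
  shows "(\<Sum>j. ennreal (if m \<le> j then a ^ j / fact (j - m) else 0)) = ennreal (a ^ m * exp a)"
proof -
  have s: "(\<lambda>j. a ^ m * (a ^ j / fact j)) sums (a ^ m * exp a)"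
    using exp_converges[of a] by (intro sums_mult) (simp add: divide_inverse mult.commute)
  have "(\<Sum>j. ennreal (if m \<le> j then a ^ j / fact (j - m) else 0)) = (\<Sum>j. ennreal (a ^ m * (a ^ j /
      fact j)))"
    by (subst suminf_ennreal_shift_zero[of m]) (auto simp: power_add mult.commute)
  also have "\<dots> = ennreal (a ^ m * exp a)"
    using s assms by (subst suminf_ennreal2) (auto simp: sums_iff)
  finally show ?thesis .
qed

text \<open>The algebraic core of Weber's integral. After the Vandermonde expansion the sums over
  \<open>k\<close> and \<open>j\<close> are shifted exponential series with values
  \<open>b ^ m * exp b\<close> and \<open>a ^ m * exp a\<close>; what remains over \<open>m\<close>
  is again a Bessel series, now in \<open>a * b\<close>. All terms are nonnegative, so the three
  sums commute.\<close>

lemma bessel_series_double_sum: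
  assumes al: "-1 < al" and a: "0 \<le> a" and b: "0 \<le> b"
  shows "(\<Sum>j. \<Sum>k. ennreal (a ^ j * b ^ k * (rGamma (real j + al + 1) * rGamma (real k + al + 1) *
     Gamma (real (j + k) + al + 1) / (fact j * fact k)))) = ennreal (exp (a + b) * bessel_series al
         (a * b))"
proof -
  define c where "c m = rGamma (real m + al + 1) / fact m" for m :: nat
  \<comment> \<open>Extended by 0 below the index \<open>m\<close>, so that every sum can run over
    all naturals before the order is changed; the sum of \<open>e x m\<close> is
    \<open>x ^ m * exp x\<close>.\<close>
  define e where "e x m j = (if m \<le> j then x ^ j / fact (j - m) else 0)" for x :: real and m j ::
      nat
  have c0: "0 \<le> c m" for m using al by (auto simp: c_def intro!: divide_nonneg_pos less_imp_le[OF
      rGamma_pos])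
  have e0: "0 \<le> x \<Longrightarrow> 0 \<le> e x m j" for x m j by (auto simp: e_def)
  have "ennreal (a ^ j * b ^ k * (rGamma (real j + al + 1) * rGamma (real k + al + 1) *
     Gamma (real (j + k) + al + 1) / (fact j * fact k)))
     = (\<Sum>m. ennreal (c m) * ennreal (e a m j) * ennreal (e b m k))" for j k
  proof -
    have "a ^ j * b ^ k * (rGamma (real j + al + 1) * rGamma (real k + al + 1) *
       Gamma (real (j + k) + al + 1) / (fact j * fact k)) = (\<Sum>m\<le>k. c m * e a m j * e b m k)"
      unfolding rGamma_Vandermonde[OF al] sum_distrib_left
      by (intro sum.cong refl) (simp add: c_def e_def mult_ac)
    also have "ennreal \<dots> = (\<Sum>m\<le>k. ennreal (c m) * ennreal (e a m j) * ennreal (e b m k))"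
      using c0 e0 a b by (subst sum_ennreal[symmetric]) (auto simp: ennreal_mult)
    also have "\<dots> = (\<Sum>m. ennreal (c m) * ennreal (e a m j) * ennreal (e b m k))"
      by (rule suminf_finite[symmetric]) (auto simp: e_def)
    finally show ?thesis .
  qed
  then have "(\<Sum>j. \<Sum>k. ennreal (a ^ j * b ^ k * (rGamma (real j + al + 1) * rGamma (real k + al + 1)
      *
     Gamma (real (j + k) + al + 1) / (fact j * fact k)))) =
     (\<Sum>j. \<Sum>k. \<Sum>m. ennreal (c m) * ennreal (e a m j) * ennreal (e b m k))" by simp
  also have "\<dots> = (\<Sum>j. \<Sum>m. ennreal (c m) * ennreal (e a m j) * ennreal (b ^ m * exp b))"
    unfolding suminf_exp_shift[OF b, symmetric] e_def[symmetric]
    by (subst suminf_swap_ennreal) simp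
  also have "\<dots> = (\<Sum>m. ennreal (c m) * ennreal (a ^ m * exp a) * ennreal (b ^ m * exp b))"
    unfolding suminf_exp_shift[OF a, symmetric] e_def[symmetric]
    by (subst suminf_swap_ennreal) simp
  also have "\<dots> = (\<Sum>m. ennreal (exp (a + b)) * ennreal ((a * b) ^ m * rGamma (real m + al + 1) / fact
      m))"
  proof (intro suminf_cong)
    fix m
    have "ennreal (c m) * ennreal (a ^ m * exp a) * ennreal (b ^ m * exp b) = ennreal (c m * (a ^ m
        * exp a) * (b ^ m * exp b))"
      using c0 a b by (simp add: ennreal_mult)
    also have "c m * (a ^ m * exp a) * (b ^ m * exp b) = exp (a + b) * ((a * b) ^ m * c m)"
      by (simp add: exp_add power_mult_distrib mult_ac)
    also have "ennreal \<dots> = ennreal (exp (a + b)) * ennreal ((a * b) ^ m * c m)"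
      using c0 a b by (simp add: ennreal_mult)
    finally show "ennreal (c m) * ennreal (a ^ m * exp a) * ennreal (b ^ m * exp b) =
      ennreal (exp (a + b)) * ennreal ((a * b) ^ m * rGamma (real m + al + 1) / fact m)"
      by (simp add: c_def)
  qed
  also have "\<dots> = ennreal (exp (a + b) * bessel_series al (a * b))"
    using al a b by (simp add: ennreal_bessel_series[symmetric] ennreal_mult bessel_series_nonneg)
  finally show ?thesis .
qed

text \<open>Euler's Gamma integral under the substitution \<open>w = q * y^2\<close>;
  \<open>g\<close> is its inverse and \<open>g'\<close> the derivative of \<open>g\<close>.
  Integrability is known first on the \<open>w\<close> side, where the integrand is a multiple of
  the Gamma integrand, and the substitution rule for nonnegative functions carries it back.\<close>

lemma nn_integral_powr_gauss:
  assumes a: "-1 < a" and q: "0 < q"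
  shows "(\<integral>\<^sup>+y. indicator {0<..} y * ennreal (y powr (2 * a + 1) * exp (- q * y\<^sup>2)) \<partial>lborel)
     = ennreal (Gamma (a + 1) / (2 * q powr (a + 1)))"
proof -
  define f where "f y = y powr (2 * a + 1) * exp (- q * y\<^sup>2)" for y :: real
  define g where "g w = sqrt (w / q)" for w :: real
  define g' where "g' w = 1 / (2 * sqrt (w * q))" for w :: real
  have fg: "f (g w) * g' w = (w powr (a + 1 - 1) / exp w) / (2 * q powr (a + 1))" if "0 < w" for w
  proof -
    have 1: "sqrt (w / q) = w powr (1/2) / q powr (1/2)" "sqrt (w * q) = w powr (1/2) * q powr
        (1/2)"
      using that q by (simp_all add: powr_half_sqrt[symmetric] powr_divide powr_mult)
    have "sqrt (w / q) powr (2 * a + 1) = w powr (a + 1/2) / q powr (a + 1/2)"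
      unfolding 1 using that q by (simp add: powr_divide powr_powr algebra_simps)
    moreover have eq: "w powr (a + 1/2) / q powr (a + 1/2) * (1 / (2 * sqrt (w * q))) = w powr (a +
        1 - 1) / (2 * q powr (a + 1))"
    proof -
      have "w powr (a + 1/2) = w powr a * w powr (1/2)" "q powr (a + 1) = q powr (a + 1/2) * q powr
          (1/2)"
        unfolding powr_add[symmetric] by (simp_all add: add_ac)
      then show ?thesis unfolding 1 using that q by simp
    qed
    moreover have "q * (sqrt (w / q))\<^sup>2 = w" using that q by simp
    ultimately have "f (g w) * g' w = w powr (a + 1/2) / q powr (a + 1/2) * exp (- w) * (1 / (2 *
        sqrt (w * q)))"
      unfolding f_def g_def g'_def by simp
    also have "\<dots> = w powr (a + 1/2) / q powr (a + 1/2) * (1 / (2 * sqrt (w * q))) * exp (- w)"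
      by (simp only: mult_ac)
    also have "\<dots> = w powr (a + 1 - 1) / (2 * q powr (a + 1)) * exp (- w)" by (simp only: eq)
    finally show ?thesis by (simp add: exp_minus field_simps)
  qed
  have G: "(\<integral>\<^sup>+w. ennreal (indicator {0<..} w *\<^sub>R (f (g w) * g' w)) \<partial>lborel) = ennreal (Gamma (a +
      1) / (2 * q powr (a + 1)))"
  proof -
    have "(\<integral>\<^sup>+w. ennreal (indicator {0<..} w *\<^sub>R (f (g w) * g' w)) \<partial>lborel)
       = (\<integral>\<^sup>+w. ennreal (indicator {0..} w * w powr (a + 1 - 1) / exp w) * ennreal (1 / (2 * q powr
           (a + 1))) \<partial>lborel)"
      \<comment> \<open>The open and closed half-lines agree even at \<open>w = 0\<close>, since 0
        raised by \<open>powr\<close> to any exponent is 0.\<close>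
      using fg by (intro nn_integral_cong) (auto simp: ennreal_mult[symmetric] indicator_def)
    also have "\<dots> = ennreal (Gamma (a + 1)) * ennreal (1 / (2 * q powr (a + 1)))"
      using a by (subst nn_integral_multc) (auto simp: Gamma_conv_nn_integral_real)
    finally show ?thesis using a q by (simp add: ennreal_mult[symmetric])
  qed
  have pos: "0 \<le> Gamma (a + 1) / (2 * q powr (a + 1))"
    using a q Gamma_real_pos[of "a + 1"] by auto
  have ei: "einterval 0 \<infinity> = {0<..}" by (auto simp: einterval_def)
  have G': "has_bochner_integral lborel (\<lambda>w. indicator {0<..} w *\<^sub>R (f (g w) * g' w)) (Gamma (a + 1)
      / (2 * q powr (a + 1)))"
  proof (rule has_bochner_integral_nn_integral[OF _ _ pos G])
    show "(\<lambda>w. indicator {0<..} w *\<^sub>R (f (g w) * g' w)) \<in> borel_measurable lborel"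
      unfolding f_def g_def g'_def by measurable
    show "AE w in lborel. 0 \<le> indicator {0<..} w *\<^sub>R (f (g w) * g' w)"
      using q by (auto simp: f_def g_def g'_def indicator_def)
  qed
  have deriv: "(g has_real_derivative g' x) (at x)" if "0 < x" for x
    unfolding g_def g'_def using that q
    by (auto intro!: derivative_eq_intros simp: real_sqrt_divide real_sqrt_mult field_simps)
  have lim1: "((ereal \<circ> g \<circ> real_of_ereal) \<longlongrightarrow> 0) (at_right 0)"
  proof -
    have "isCont g 0" unfolding g_def using q by (intro continuous_intros) simp
    then have "(g \<longlongrightarrow> g 0) (at_right 0)"
      by (auto simp: isCont_def intro: filterlim_mono[OF _ order_refl at_le])
    then have "(g \<longlongrightarrow> 0) (at_right 0)" by (simp add: g_def)
    then show ?thesis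
      unfolding zero_ereal_def by (simp add: ereal_tendsto_simps)
  qed
  have lim2: "((ereal \<circ> g \<circ> real_of_ereal) \<longlongrightarrow> \<infinity>) (at_left \<infinity>)"
  proof -
    have "filterlim g at_top at_top" unfolding g_def
      using q by (intro filterlim_compose[OF sqrt_at_top] filterlim_at_top_mult_tendsto_pos[OF
          tendsto_const _ filterlim_ident, of "1/q", simplified])
    then show ?thesis
      by (simp add: ereal_tendsto_simps)
  qed
  have isub: "set_integrable lborel (einterval 0 \<infinity>) (\<lambda>x. f (g x) * g' x)"
    unfolding set_integrable_def ei using G' by (simp add: has_bochner_integral_iff)
  have prem: "isCont f (g x)" "isCont g' x" "0 \<le> f (g x)" if "0 < x" for x
    using that q unfolding f_def g_def g'_def by (auto intro!: continuous_intros)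
  have prem4: "0 \<le> g' x" if "0 \<le> x" for x
    using that q unfolding g'_def by auto
  note S = interval_integral_substitution_nonneg[of 0 \<infinity> g g' f 0 \<infinity>, OF _ deriv prem prem4 lim1 lim2
      isub]
  have A: "set_integrable lborel (einterval 0 \<infinity>) f"
    by (rule S(1)) auto
  have B: "(LBINT x=0..\<infinity>. f x) = (LBINT x=0..\<infinity>. f (g x) * g' x)"
    using S(2) by (auto simp: mult.commute)
  have "(LBINT x=0..\<infinity>. f (g x) * g' x) = Gamma (a + 1) / (2 * q powr (a + 1))"
    using G' unfolding interval_lebesgue_integral_def ei set_lebesgue_integral_def
    by (simp add: has_bochner_integral_iff)
  then have "has_bochner_integral lborel (\<lambda>x. indicator {0<..} x *\<^sub>R f x) (Gamma (a + 1) / (2 * q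
      powr (a + 1)))"
    using A B unfolding interval_lebesgue_integral_def ei set_lebesgue_integral_def
        set_integrable_def
    by (simp add: has_bochner_integral_iff)
  then have "(\<integral>\<^sup>+x. ennreal (indicator {0<..} x *\<^sub>R f x) \<partial>lborel) = ennreal (Gamma (a + 1) / (2 * q
      powr (a + 1)))"
    by (subst nn_integral_eq_integral) (auto simp: has_bochner_integral_iff f_def)
  moreover have "ennreal (indicator {0<..} x *\<^sub>R f x) = indicator {0<..} x * ennreal (x powr (2 * a
      + 1) * exp (- q * x\<^sup>2))" for x
    by (simp add: f_def indicator_def)
  ultimately show ?thesis by simp
qed

text \<open>Weber's second exponential integral. Expanding both Bessel series leaves Gaussian
  moments; the term with indices \<open>j\<close>, \<open>k\<close> contributes
  \<open>Gamma (real (j + k) + al + 1)\<close>, exactly the coupling factor of the double series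
  just summed, with arguments \<open>a / q\<close> and \<open>b / q\<close>.\<close>

lemma nn_integral_bessel_series_product:
  assumes al: "-1 < al" and q: "0 < q" and a: "0 \<le> a" and b: "0 \<le> b"
  shows "(\<integral>\<^sup>+y. indicator {0<..} y * ennreal (y powr (2 * al + 1) * exp (- q * y\<^sup>2) *
      bessel_series al (a * y\<^sup>2) * bessel_series al (b * y\<^sup>2)) \<partial>lborel)
    = ennreal (exp ((a + b) / q) * bessel_series al (a * b / q\<^sup>2) / (2 * q powr (al + 1)))"
proof -
  define c where "c x k = x ^ k * rGamma (real k + al + 1) / fact k" for x :: real and k :: nat
  have c0: "0 \<le> c x k" if "0 \<le> x" for x k using al that
    by (auto simp: c_def intro!: divide_nonneg_pos mult_nonneg_nonneg less_imp_le[OF rGamma_pos])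
  have G0: "0 \<le> Gamma (real n + al + 1) / (2 * q powr (real n + al + 1))" for n
    using al Gamma_real_pos[of "real n + al + 1"] by auto
  have bs: "ennreal (bessel_series al (x * y\<^sup>2)) = (\<Sum>k. ennreal (c x k * y ^ (2 * k)))" if "0 \<le> x"
      for x y
  proof -
    have "(x * y\<^sup>2) ^ k * rGamma (real k + al + 1) / fact k = c x k * y ^ (2 * k)" for k
      by (simp add: c_def power_mult_distrib power_mult)
    then show ?thesis using ennreal_bessel_series[of al "x * y\<^sup>2"] al that by simp
  qed
  have "indicator {0<..} y * ennreal (y powr (2 * al + 1) * exp (- q * y\<^sup>2) *
      bessel_series al (a * y\<^sup>2) * bessel_series al (b * y\<^sup>2))
     = (\<Sum>j. \<Sum>k. ennreal (c a j * c b k) * (indicator {0<..} y * ennreal (y powr (2 * (real (j + k) +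
         al) + 1) * exp (- q * y\<^sup>2))))" for y
  proof (cases "0 < y")
    case True
    define w where "w = y powr (2 * al + 1) * exp (- q * y\<^sup>2)"
    have w0: "0 \<le> w" by (simp add: w_def)
    have yp: "y powr (2 * (real (j + k) + al) + 1) * exp (- q * y\<^sup>2) = w * y ^ (2 * j) * y ^ (2 *
        k)" for j k
    proof -
      have "y powr (2 * (real (j + k) + al) + 1) = y powr (2 * al + 1) * (y powr real (2 * j) * y
          powr real (2 * k))"
        unfolding powr_add[symmetric] by (simp add: algebra_simps)
      then show ?thesis using True unfolding w_def by (simp only: powr_realpow mult_ac)
    qed
    have "ennreal (w * bessel_series al (a * y\<^sup>2) * bessel_series al (b * y\<^sup>2))
      = ennreal w * (ennreal (bessel_series al (a * y\<^sup>2)) * ennreal (bessel_series al (b * y\<^sup>2)))"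
      using w0 al a b by (simp add: ennreal_mult bessel_series_nonneg mult.assoc)
    also have "\<dots> = (\<Sum>j. \<Sum>k. ennreal w * (ennreal (c a j * y ^ (2 * j)) * ennreal (c b k * y ^ (2 *
        k))))"
      unfolding bs[OF a] bs[OF b] by (simp add: ennreal_suminf_multc ennreal_suminf_cmult)
    also have "\<dots> = (\<Sum>j. \<Sum>k. ennreal (c a j * c b k) * ennreal (w * y ^ (2 * j) * y ^ (2 * k)))"
    proof (intro suminf_cong)
      fix j k
      have "0 \<le> y ^ (2 * j)" "0 \<le> y ^ (2 * k)" using True by auto
      then show "ennreal w * (ennreal (c a j * y ^ (2 * j)) * ennreal (c b k * y ^ (2 * k)))
        = ennreal (c a j * c b k) * ennreal (w * y ^ (2 * j) * y ^ (2 * k))"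
        using c0[OF a, of j] c0[OF b, of k] w0 by (simp only: ennreal_mult[symmetric]
            mult_nonneg_nonneg mult_ac)
    qed
    finally show ?thesis using True unfolding yp by (simp add: w_def)
  qed simp
  then have "(\<integral>\<^sup>+y. indicator {0<..} y * ennreal (y powr (2 * al + 1) * exp (- q * y\<^sup>2) *
      bessel_series al (a * y\<^sup>2) * bessel_series al (b * y\<^sup>2)) \<partial>lborel)
    = (\<integral>\<^sup>+y. (\<Sum>j. \<Sum>k. ennreal (c a j * c b k) * (indicator {0<..} y * ennreal (y powr (2 * (real (j
        + k) + al) + 1) * exp (- q * y\<^sup>2)))) \<partial>lborel)"
    by simp
  also have "\<dots> = (\<Sum>j. \<Sum>k. (\<integral>\<^sup>+y. ennreal (c a j * c b k) * (indicator {0<..} y * ennreal (y powr (2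
      * (real (j + k) + al) + 1) * exp (- q * y\<^sup>2))) \<partial>lborel))"
    by (subst nn_integral_suminf, simp, intro suminf_cong, subst nn_integral_suminf, simp, rule
        refl)
  also have "\<dots> = (\<Sum>j. \<Sum>k. ennreal (1 / (2 * q powr (al + 1))) * ennreal ((a / q) ^ j * (b / q) ^ k *
      (rGamma (real j + al + 1) * rGamma (real k + al + 1) *
     Gamma (real (j + k) + al + 1) / (fact j * fact k))))"
  proof (intro suminf_cong)
    fix j k
    have "(\<integral>\<^sup>+y. ennreal (c a j * c b k) * (indicator {0<..} y * ennreal (y powr (2 * (real (j + k)
        + al) + 1) * exp (- q * y\<^sup>2))) \<partial>lborel)
      = ennreal (c a j * c b k) * ennreal (Gamma (real (j + k) + al + 1) / (2 * q powr (real (j + k)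
          + al + 1)))"
      using nn_integral_powr_gauss[of "real (j + k) + al" q] al q
      by (subst nn_integral_cmult) (simp_all del: of_nat_add)
    also have "\<dots> = ennreal (c a j * c b k * (Gamma (real (j + k) + al + 1) / (2 * q powr (real (j +
        k) + al + 1))))"
      using c0[OF a, of j] c0[OF b, of k] G0[of "j + k"] by (simp only: ennreal_mult
          mult_nonneg_nonneg)
    also have "c a j * c b k * (Gamma (real (j + k) + al + 1) / (2 * q powr (real (j + k) + al +
        1)))
       = (1 / (2 * q powr (al + 1))) * ((a / q) ^ j * (b / q) ^ k * (rGamma (real j + al + 1) *
           rGamma (real k + al + 1) *
     Gamma (real (j + k) + al + 1) / (fact j * fact k)))"
    proof -
      have "q powr (real (j + k) + al + 1) = q ^ j * q ^ k * q powr (al + 1)"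
        using q by (simp add: powr_add powr_realpow)
      then show ?thesis unfolding c_def by (simp add: power_divide mult_ac)
    qed
    also have "ennreal \<dots> = ennreal (1 / (2 * q powr (al + 1))) * ennreal ((a / q) ^ j * (b / q) ^ k
        * (rGamma (real j + al + 1) * rGamma (real k + al + 1) *
     Gamma (real (j + k) + al + 1) / (fact j * fact k)))"
      by (rule ennreal_mult') simp
    finally show "(\<integral>\<^sup>+y. ennreal (c a j * c b k) * (indicator {0<..} y * ennreal (y powr (2 * (real
        (j + k) + al) + 1) * exp (- q * y\<^sup>2))) \<partial>lborel)
      = ennreal (1 / (2 * q powr (al + 1))) * ennreal ((a / q) ^ j * (b / q) ^ k * (rGamma (real j +
          al + 1) * rGamma (real k + al + 1) *
     Gamma (real (j + k) + al + 1) / (fact j * fact k)))" .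
  qed
  also have "\<dots> = ennreal (1 / (2 * q powr (al + 1))) * ennreal (exp (a / q + b / q) * bessel_series
      al (a / q * (b / q)))"
    unfolding ennreal_suminf_cmult using bessel_series_double_sum[of al "a / q" "b / q"] al a b q by
        simp
  also have "\<dots> = ennreal (exp ((a + b) / q) * bessel_series al (a * b / q\<^sup>2) / (2 * q powr (al +
      1)))"
    using al a b q by (subst ennreal_mult[symmetric])
      (auto simp: add_divide_distrib power2_eq_square bessel_series_nonneg)
  finally show ?thesis .
qed

text \<open>The one-dimensional kernel after the power \<open>(x y) powr (-a)\<close> has cancelled
  against the leading power of the Bessel function, leaving the constant
  \<open>(2 * sinh (2 * t)) powr (-a)\<close>. This form is even in each variable and meaningful for
  all real \<open>x\<close> and \<open>y\<close>, so integrands on the half-line need no case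
  distinction at 0.\<close>

definition laguerre_factor :: "real \<Rightarrow> real \<Rightarrow> real \<Rightarrow> real \<Rightarrow> real" where
  "laguerre_factor a t x y = (2 * sinh (2 * t)) powr (- a) / sinh (2 * t) *
     exp (- (cosh (2 * t) / (2 * sinh (2 * t))) * (x\<^sup>2 + y\<^sup>2)) *
     bessel_series a ((x * y)\<^sup>2 / (4 * (sinh (2 * t))\<^sup>2))"

lemma laguerre_factor_nonneg: "-1 < a \<Longrightarrow> 0 < t \<Longrightarrow> 0 \<le> laguerre_factor a t x y"
  unfolding laguerre_factor_def by (intro mult_nonneg_nonneg divide_nonneg_nonneg
      bessel_series_nonneg) auto

lemma bessel_series_measurable[measurable (raw)]:
  "f \<in> borel_measurable M \<Longrightarrow> (\<lambda>x. bessel_series a (f x)) \<in> borel_measurable M"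
  unfolding bessel_series_def
  by (intro borel_measurable_suminf borel_measurable_divide borel_measurable_times
      borel_measurable_power borel_measurable_const)

lemma laguerre_factor_measurable[measurable (raw)]:
  assumes [measurable]: "f \<in> borel_measurable M" "g \<in> borel_measurable M"
  shows "(\<lambda>x. laguerre_factor a t (f x) (g x)) \<in> borel_measurable M"
  unfolding laguerre_factor_def by measurable

text \<open>As a function of \<open>z\<close> the integrand is exactly of Weber's type; it remains
  to see that prefactor, exponent and Bessel argument recombine, which is what the addition formulas
  for sinh and cosh provide.\<close>

lemma laguerre_factor_Chapman_Kolmogorov:
  assumes al: "-1 < al" and s: "0 < s" and t: "0 < t"
  shows "(\<integral>\<^sup>+z. indicator {0<..} z * ennreal (z powr (2 * al + 1)) *
      (ennreal (laguerre_factor al s x z) * ennreal (laguerre_factor al t z y)) \<partial>lborel)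
    = ennreal (laguerre_factor al (s + t) x y)"
proof -
  define s1 c1 s2 c2 where "s1 = sinh (2 * s)" and "c1 = cosh (2 * s)" and "s2 = sinh (2 * t)" and
      "c2 = cosh (2 * t)"
  define S C where "S = sinh (2 * (s + t))" and "C = cosh (2 * (s + t))"
  have pos: "0 < s1" "0 < s2" "0 < c1" "0 < c2" "0 < S"
    using s t by (auto simp: s1_def s2_def c1_def c2_def S_def)
  have SC: "S = s1 * c2 + c1 * s2" "C = c1 * c2 + s1 * s2"
    by (simp_all add: S_def C_def s1_def s2_def c1_def c2_def distrib_left sinh_add cosh_add)
  have hyp: "c1\<^sup>2 = 1 + s1\<^sup>2" "c2\<^sup>2 = 1 + s2\<^sup>2"
    by (simp_all add: s1_def s2_def c1_def c2_def cosh_square_eq)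
  \<comment> \<open>The coefficient of \<open>z^2\<close> in the product of the two Gaussians. By
    the addition formula it equals \<open>S / (2 * s1 * s2)\<close>, which is how the time
    \<open>s + t\<close> enters.\<close>
  define q where "q = c1 / (2 * s1) + c2 / (2 * s2)"
  have q: "0 < q" using pos by (auto simp: q_def intro!: add_pos_pos divide_pos_pos)
  have Sq: "S = 2 * s1 * s2 * q" using pos by (simp add: q_def SC field_simps)
  define a where "a = x\<^sup>2 / (4 * s1\<^sup>2)"
  define b where "b = y\<^sup>2 / (4 * s2\<^sup>2)"
  have ab: "0 \<le> a" "0 \<le> b" by (auto simp: a_def b_def)
  \<comment> \<open>Everything that does not depend on \<open>z\<close>.\<close>
  define K where "K = (2 * s1) powr (- al) / s1 * ((2 * s2) powr (- al) / s2) *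
    (exp (- (c1 / (2 * s1)) * x\<^sup>2) * exp (- (c2 / (2 * s2)) * y\<^sup>2))"
  have K0: "0 \<le> K" using pos by (auto simp: K_def)
  have "indicator {0<..} z * ennreal (z powr (2 * al + 1)) *
      (ennreal (laguerre_factor al s x z) * ennreal (laguerre_factor al t z y))
     = ennreal K * (indicator {0<..} z * ennreal (z powr (2 * al + 1) * exp (- q * z\<^sup>2) *
      bessel_series al (a * z\<^sup>2) * bessel_series al (b * z\<^sup>2)))" for z
  proof -
    have "laguerre_factor al s x z * laguerre_factor al t z y =
       K * (exp (- q * z\<^sup>2) * bessel_series al (a * z\<^sup>2) * bessel_series al (b * z\<^sup>2))"
    proof -
      have "exp (- (c1 / (2 * s1)) * (x\<^sup>2 + z\<^sup>2)) * exp (- (c2 / (2 * s2)) * (z\<^sup>2 + y\<^sup>2))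
        = exp (- (c1 / (2 * s1)) * x\<^sup>2) * exp (- (c2 / (2 * s2)) * y\<^sup>2) * exp (- q * z\<^sup>2)"
        unfolding exp_add[symmetric] by (simp add: q_def algebra_simps)
      moreover have "(x * z)\<^sup>2 / (4 * s1\<^sup>2) = a * z\<^sup>2" "(z * y)\<^sup>2 / (4 * s2\<^sup>2) = b * z\<^sup>2"
        by (simp_all add: a_def b_def power_mult_distrib)
      ultimately show ?thesis
        unfolding laguerre_factor_def K_def s1_def[symmetric] s2_def[symmetric] c1_def[symmetric]
            c2_def[symmetric]
        by (simp only: mult_ac)
    qed
    then have "z powr (2 * al + 1) * (laguerre_factor al s x z * laguerre_factor al t z y) =
      K * (z powr (2 * al + 1) * exp (- q * z\<^sup>2) * bessel_series al (a * z\<^sup>2) * bessel_series al (b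
          * z\<^sup>2))"
      by (simp only: mult_ac)
    moreover have "ennreal (z powr (2 * al + 1)) * (ennreal (laguerre_factor al s x z) * ennreal
        (laguerre_factor al t z y))
      = ennreal (z powr (2 * al + 1) * (laguerre_factor al s x z * laguerre_factor al t z y))"
      using laguerre_factor_nonneg[OF al s] laguerre_factor_nonneg[OF al t] by (simp add:
          ennreal_mult)
    ultimately have "ennreal (z powr (2 * al + 1)) * (ennreal (laguerre_factor al s x z) * ennreal
        (laguerre_factor al t z y))
      = ennreal K * ennreal (z powr (2 * al + 1) * exp (- q * z\<^sup>2) * bessel_series al (a * z\<^sup>2) *
          bessel_series al (b * z\<^sup>2))"
      by (simp only: ennreal_mult'[OF K0])
    then show ?thesis by (simp add: indicator_def)
  qed
  then have "(\<integral>\<^sup>+z. indicator {0<..} z * ennreal (z powr (2 * al + 1)) *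
      (ennreal (laguerre_factor al s x z) * ennreal (laguerre_factor al t z y)) \<partial>lborel)
     = ennreal K * ennreal (exp ((a + b) / q) * bessel_series al (a * b / q\<^sup>2) / (2 * q powr (al +
         1)))"
    by (simp only: nn_integral_bessel_series_product[OF al q ab, symmetric])
       (rule nn_integral_cmult, measurable)
  also have "\<dots> = ennreal (K * (exp ((a + b) / q) * bessel_series al (a * b / q\<^sup>2) / (2 * q powr (al
      + 1))))"
    by (simp only: ennreal_mult'[OF K0])
  also have "K * (exp ((a + b) / q) * bessel_series al (a * b / q\<^sup>2) / (2 * q powr (al + 1))) =
      laguerre_factor al (s + t) x y"
  proof -
    have "a * b / q\<^sup>2 = (x * y)\<^sup>2 / (4 * S\<^sup>2)"
      using pos q by (simp add: a_def b_def Sq power_mult_distrib)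
    moreover have "(2 * s1) powr (- al) / s1 * ((2 * s2) powr (- al) / s2) / (2 * q powr (al + 1)) =
        (2 * S) powr (- al) / S"
    proof -
      have "2 * S = (2 * s1) * (2 * s2) * q" using Sq by simp
      then have "(2 * S) powr (- al) = (2 * s1) powr (- al) * (2 * s2) powr (- al) * q powr (- al)"
        using pos q by (simp only: powr_mult)
      moreover have "q powr (al + 1) = q / q powr (- al)" using q by (simp add: powr_add powr_minus
          field_simps)
      ultimately show ?thesis using pos q unfolding Sq by (simp add: field_simps)
    qed
    moreover have "exp (- (c1 / (2 * s1)) * x\<^sup>2) * exp (- (c2 / (2 * s2)) * y\<^sup>2) * exp ((a + b) / q)
       = exp (- (C / (2 * S)) * (x\<^sup>2 + y\<^sup>2))"
    proof -
      \<comment> \<open>These two identities match the Gaussian exponents: Weber's factor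
        \<open>exp ((a + b) / q)\<close> corrects the coefficients of \<open>x^2\<close> and
        \<open>y^2\<close>, and \<open>cosh^2 = 1 + sinh^2\<close> makes both corrected coefficients
        equal to \<open>- C / (2 * S)\<close>.\<close>
      have "- c1 * S + s2 = - C * s1" "- c2 * S + s1 = - C * s2"
      proof -
        have "- c1 * S + s2 = - C * s1 - (c1\<^sup>2 - (1 + s1\<^sup>2)) * s2" "- c2 * S + s1 = - C * s2 - (c2\<^sup>2
            - (1 + s2\<^sup>2)) * s1"
          unfolding SC by (simp_all add: algebra_simps power2_eq_square)
        then show "- c1 * S + s2 = - C * s1" "- c2 * S + s1 = - C * s2" using hyp by simp_all
      qed
      then have "- (c1 / (2 * s1)) + s2 / (2 * s1 * S) = - (C / (2 * S))"
          "- (c2 / (2 * s2)) + s1 / (2 * s2 * S) = - (C / (2 * S))"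
      proof -
        have *: "- (c / (2 * s)) + r / (2 * s * S) = (- c * S + r) / (2 * s * S)" if "0 < s" for c s
            r
          using pos that by (simp add: field_simps)
        show "- (c1 / (2 * s1)) + s2 / (2 * s1 * S) = - (C / (2 * S))"
          using *[OF pos(1), of c1 s2] \<open>- c1 * S + s2 = - C * s1\<close> pos by simp
        show "- (c2 / (2 * s2)) + s1 / (2 * s2 * S) = - (C / (2 * S))"
          using *[OF pos(2), of c2 s1] \<open>- c2 * S + s1 = - C * s2\<close> pos by simp
      qed
      moreover have "a / q = s2 / (2 * s1 * S) * x\<^sup>2" "b / q = s1 / (2 * s2 * S) * y\<^sup>2"
        using pos q by (simp_all add: a_def b_def Sq field_simps power2_eq_square)
      ultimately have "- (c1 / (2 * s1)) * x\<^sup>2 + a / q = - (C / (2 * S)) * x\<^sup>2"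
          "- (c2 / (2 * s2)) * y\<^sup>2 + b / q = - (C / (2 * S)) * y\<^sup>2"
        by (simp_all only: distrib_right[symmetric])
      then have "- (c1 / (2 * s1)) * x\<^sup>2 + - (c2 / (2 * s2)) * y\<^sup>2 + (a / q + b / q) = - (C / (2 *
          S)) * x\<^sup>2 + - (C / (2 * S)) * y\<^sup>2"
        by linarith
      then have "- (C / (2 * S)) * (x\<^sup>2 + y\<^sup>2) = - (c1 / (2 * s1)) * x\<^sup>2 + - (c2 / (2 * s2)) * y\<^sup>2 +
          (a + b) / q"
        by (simp only: distrib_left add_divide_distrib)
      then show ?thesis by (simp only: exp_add)
    qed
    moreover have "K * (exp ((a + b) / q) * bessel_series al (a * b / q\<^sup>2) / (2 * q powr (al + 1)))
        =
      (2 * s1) powr (- al) / s1 * ((2 * s2) powr (- al) / s2) / (2 * q powr (al + 1)) *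
      (exp (- (c1 / (2 * s1)) * x\<^sup>2) * exp (- (c2 / (2 * s2)) * y\<^sup>2) * exp ((a + b) / q)) *
          bessel_series al (a * b / q\<^sup>2)"
      unfolding K_def by simp
    ultimately show ?thesis
      unfolding laguerre_factor_def S_def[symmetric] C_def[symmetric] by (simp only:)
  qed
  finally show ?thesis .
qed

text \<open>The degenerate case of Weber's integral in which one Bessel argument vanishes: a
  constant is a multiple of \<open>bessel_series al 0\<close>. The case \<open>u = 0\<close> gives
  the mass of the kernel, and \<open>u > 0\<close> the moments used for concentration.\<close>

lemma laguerre_factor_gauss:
  assumes al: "-1 < al" and t: "0 < t" and u: "0 \<le> u"
  shows "(\<integral>\<^sup>+y. indicator {0<..} y * ennreal (y powr (2 * al + 1)) *
      (ennreal (laguerre_factor al t x y) * ennreal (exp (- u * y\<^sup>2 / 2))) \<partial>lborel)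
    = ennreal ((cosh (2 * t) + u * sinh (2 * t)) powr (- (al + 1)) *
       exp (- (x\<^sup>2 / 2) * ((sinh (2 * t) + u * cosh (2 * t)) / (cosh (2 * t) + u * sinh (2 * t)))))"
proof -
  define s c where "s = sinh (2 * t)" and "c = cosh (2 * t)"
  have pos: "0 < s" "0 < c" using t by (auto simp: s_def c_def)
  have hyp: "c\<^sup>2 = 1 + s\<^sup>2" by (simp add: s_def c_def cosh_square_eq)
  define q where "q = (c + u * s) / (2 * s)"
  define b where "b = x\<^sup>2 / (4 * s\<^sup>2)"
  have cu: "0 < c + u * s" using pos u by (intro add_pos_nonneg) auto
  have q: "0 < q" using pos cu by (auto simp: q_def)
  have b: "0 \<le> b" by (simp add: b_def)
  \<comment> \<open>The factor \<open>Gamma (al + 1)\<close> compensates for the value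
    \<open>rGamma (al + 1)\<close> of the Bessel series at 0, which is inserted
    artificially.\<close>
  define K where "K = (2 * s) powr (- al) / s * exp (- (c / (2 * s)) * x\<^sup>2) * Gamma (al + 1)"
  have G: "0 < Gamma (al + 1)" using al by auto
  have K0: "0 \<le> K" using pos G by (auto simp: K_def)
  have "indicator {0<..} y * ennreal (y powr (2 * al + 1)) *
      (ennreal (laguerre_factor al t x y) * ennreal (exp (- u * y\<^sup>2 / 2)))
     = ennreal K * (indicator {0<..} y * ennreal (y powr (2 * al + 1) * exp (- q * y\<^sup>2) *
      bessel_series al (0 * y\<^sup>2) * bessel_series al (b * y\<^sup>2)))" for y
  proof -
    have "laguerre_factor al t x y * exp (- u * y\<^sup>2 / 2) =
       K * (exp (- q * y\<^sup>2) * bessel_series al (0 * y\<^sup>2) * bessel_series al (b * y\<^sup>2))"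
    proof -
      have "exp (- (c / (2 * s)) * (x\<^sup>2 + y\<^sup>2)) * exp (- u * y\<^sup>2 / 2)
        = exp (- (c / (2 * s)) * x\<^sup>2) * exp (- q * y\<^sup>2)"
        unfolding exp_add[symmetric] using pos by (simp add: q_def field_simps)
      moreover have "(x * y)\<^sup>2 / (4 * s\<^sup>2) = b * y\<^sup>2"
        by (simp add: b_def power_mult_distrib)
      moreover have "Gamma (al + 1) * bessel_series al (0 * y\<^sup>2) = 1"
        using G by (simp add: bessel_series_0 rGamma_inverse_Gamma)
      ultimately show ?thesis
        unfolding laguerre_factor_def K_def s_def[symmetric] c_def[symmetric]
        by (simp add: mult_ac)
    qed
    then have "y powr (2 * al + 1) * (laguerre_factor al t x y * exp (- u * y\<^sup>2 / 2)) =
      K * (y powr (2 * al + 1) * exp (- q * y\<^sup>2) * bessel_series al (0 * y\<^sup>2) * bessel_series al (b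
          * y\<^sup>2))"
      by (simp only: mult_ac)
    moreover have "ennreal (y powr (2 * al + 1)) * (ennreal (laguerre_factor al t x y) * ennreal
        (exp (- u * y\<^sup>2 / 2)))
      = ennreal (y powr (2 * al + 1) * (laguerre_factor al t x y * exp (- u * y\<^sup>2 / 2)))"
      using laguerre_factor_nonneg[OF al t] by (simp add: ennreal_mult)
    ultimately have "ennreal (y powr (2 * al + 1)) * (ennreal (laguerre_factor al t x y) * ennreal
        (exp (- u * y\<^sup>2 / 2)))
      = ennreal K * ennreal (y powr (2 * al + 1) * exp (- q * y\<^sup>2) * bessel_series al (0 * y\<^sup>2) *
          bessel_series al (b * y\<^sup>2))"
      by (simp only: ennreal_mult'[OF K0])
    then show ?thesis by (simp add: indicator_def)
  qed
  then have "(\<integral>\<^sup>+y. indicator {0<..} y * ennreal (y powr (2 * al + 1)) *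
      (ennreal (laguerre_factor al t x y) * ennreal (exp (- u * y\<^sup>2 / 2))) \<partial>lborel)
     = ennreal K * ennreal (exp ((0 + b) / q) * bessel_series al (0 * b / q\<^sup>2) / (2 * q powr (al +
         1)))"
    by (simp only: nn_integral_bessel_series_product[OF al q order_refl b, symmetric])
       (rule nn_integral_cmult, measurable)
  also have "\<dots> = ennreal (K * (exp (b / q) * rGamma (al + 1) / (2 * q powr (al + 1))))"
    by (simp only: ennreal_mult'[OF K0] bessel_series_0 mult_zero_left div_0 add_0_left)
  also have "K * (exp (b / q) * rGamma (al + 1) / (2 * q powr (al + 1))) =
    (c + u * s) powr (- (al + 1)) * exp (- (x\<^sup>2 / 2) * ((s + u * c) / (c + u * s)))"
  proof -
    have "(2 * s) powr (- al) / s / (2 * q powr (al + 1)) = (c + u * s) powr (- (al + 1))"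
    proof -
      have "(2 * s) powr (al + 1) * q powr (al + 1) = (c + u * s) powr (al + 1)"
        using pos q by (subst powr_mult[symmetric]) (auto simp: q_def)
      moreover have "(2 * s) powr (- al) / s / (2 * q powr (al + 1)) = 1 / ((2 * s) powr (al + 1) *
          q powr (al + 1))"
        using pos by (simp add: powr_add powr_minus field_simps)
      ultimately show ?thesis by (simp only: powr_minus_divide)
    qed
    moreover have "exp (- (c / (2 * s)) * x\<^sup>2) * exp (b / q) = exp (- (x\<^sup>2 / 2) * ((s + u * c) / (c
        + u * s)))"
    proof -
      \<comment> \<open>Again \<open>cosh^2 = 1 + sinh^2\<close>; this turns the sum of the two
        exponents into the Moebius transform of \<open>u\<close> in the claim.\<close>
      have "- c * (c + u * s) + 1 = - s * (s + u * c)" using hyp by (simp add: algebra_simps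
          power2_eq_square)
      then have "- (c / (2 * s)) + 1 / (2 * s * (c + u * s)) = - (1 / 2) * ((s + u * c) / (c + u *
          s))"
      proof -
        have "- (c / (2 * s)) + 1 / (2 * s * D) = (- c * D + 1) / (2 * s * D)" if "D \<noteq> 0" for D
          using pos that by (simp add: field_simps)
        from this[of "c + u * s"] \<open>- c * (c + u * s) + 1 = - s * (s + u * c)\<close> show ?thesis
          using pos cu by simp
      qed
      moreover have "b / q = 1 / (2 * s * (c + u * s)) * x\<^sup>2"
        using pos cu by (simp add: b_def q_def field_simps power2_eq_square)
      ultimately have "- (c / (2 * s)) * x\<^sup>2 + b / q = - (1 / 2) * ((s + u * c) / (c + u * s)) *
          x\<^sup>2"
        by (simp only: distrib_right[symmetric])
      then show ?thesis unfolding exp_add[symmetric] by (simp add: mult_ac)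
    qed
    moreover have "Gamma (al + 1) * rGamma (al + 1) = 1" using G by (simp add: rGamma_inverse_Gamma)
    moreover have "K * (exp (b / q) * rGamma (al + 1) / (2 * q powr (al + 1))) =
      (2 * s) powr (- al) / s / (2 * q powr (al + 1)) * (exp (- (c / (2 * s)) * x\<^sup>2) * exp (b / q))
          * (Gamma (al + 1) * rGamma (al + 1))"
      unfolding K_def by simp
    ultimately show ?thesis by (simp only: mult_1_right)
  qed
  finally show ?thesis unfolding s_def c_def .
qed

section \<open>Strong continuity of kernel operators on $L^2$\<close>

lemma ennreal_LIMSEQ_0_by_approximation:
  fixes a :: "nat \<Rightarrow> ennreal"
  assumes le: "\<And>n m. a n \<le> b m + c m n" and b: "b \<longlonglongrightarrow> 0" and c: "\<And>m. c m \<longlonglongrightarrow> 0"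
  shows "a \<longlonglongrightarrow> 0"
proof (rule order_tendstoI)
  fix e :: ennreal assume "0 < e"
  then obtain r' where "0 < r'" "r' < e" using dense by blast
  then obtain r where r: "0 < r" "ennreal r < e" by (cases r') auto
  then have r2: "0 < ennreal (r / 2)" by simp
  obtain m where m: "b m < ennreal (r / 2)"
    using order_tendstoD(2)[OF b r2] by (auto simp: eventually_sequentially)
  show "eventually (\<lambda>n. a n < e) sequentially"
    using order_tendstoD(2)[OF c[of m] r2]
  proof eventually_elim
    case (elim n)
    have "a n \<le> ennreal (r / 2) + ennreal (r / 2)"
      using le[of n m] m elim by (meson add_mono less_imp_le order_trans)
    also have "\<dots> = ennreal r" using r by (subst ennreal_plus[symmetric]) auto
    finally show "a n < e" using r by order
  qed
qed auto

definition L2_sqnorm :: "'a measure \<Rightarrow> ('a \<Rightarrow> complex) \<Rightarrow> ennreal" where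
  "L2_sqnorm M f = (\<integral>\<^sup>+x. ennreal ((cmod (f x))\<^sup>2) \<partial>M)"

lemma Lp_space_2_iff_L2_sqnorm: "f \<in> Lp_space M 2 \<longleftrightarrow> f \<in> borel_measurable M \<and> L2_sqnorm M f < \<infinity>"
  by (simp add: Lp_space_2_iff L2_sqnorm_def)

text \<open>A triangle inequality with constant 2 in place of Minkowski's: only convergence to 0 is
  at stake, and squared norms avoid roots of extended values. The hypothesis on \<open>h\<close> is
  almost everywhere because kernel operators are linear only in that sense.\<close>

lemma L2_sqnorm_lincomb:
  assumes [measurable]: "f \<in> borel_measurable M" "g \<in> borel_measurable M"
    and h: "AE x in M. h x = a * f x + b * g x"
  shows "L2_sqnorm M h \<le> ennreal (2 * (cmod a)\<^sup>2) * L2_sqnorm M f + ennreal (2 * (cmod b)\<^sup>2) *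
      L2_sqnorm M g"
proof -
  have *: "(cmod (a * u + b * v))\<^sup>2 \<le> 2 * (cmod a)\<^sup>2 * (cmod u)\<^sup>2 + 2 * (cmod b)\<^sup>2 * (cmod v)\<^sup>2" for
      u v
  proof -
    have "(cmod (a * u + b * v))\<^sup>2 \<le> (cmod (a * u) + cmod (b * v))\<^sup>2"
      by (intro power_mono norm_triangle_ineq) auto
    also have "\<dots> \<le> 2 * (cmod (a * u))\<^sup>2 + 2 * (cmod (b * v))\<^sup>2"
      using sum_squares_bound[of "cmod (a * u)" "cmod (b * v)"] by (simp add: power2_sum)
    finally show ?thesis by (simp add: norm_mult power_mult_distrib)
  qed
  have "L2_sqnorm M h \<le> (\<integral>\<^sup>+x. ennreal (2 * (cmod a)\<^sup>2) * ennreal ((cmod (f x))\<^sup>2) + ennreal (2 *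
      (cmod b)\<^sup>2) * ennreal ((cmod (g x))\<^sup>2) \<partial>M)"
    unfolding L2_sqnorm_def using h
    by (intro nn_integral_mono_AE, elim eventually_mono)
       (use * in \<open>simp add: ennreal_mult[symmetric] ennreal_plus[symmetric] ennreal_leI del:
           ennreal_plus\<close>)
  also have "\<dots> = ennreal (2 * (cmod a)\<^sup>2) * L2_sqnorm M f + ennreal (2 * (cmod b)\<^sup>2) * L2_sqnorm M
      g"
    unfolding L2_sqnorm_def by (simp add: nn_integral_add nn_integral_cmult)
  finally show ?thesis .
qed

lemma L2_sqnorm_indicator:
  "A \<in> sets M \<Longrightarrow> L2_sqnorm M (indicator A) = emeasure M A"
proof -
  assume A: "A \<in> sets M"
  have "ennreal ((cmod (indicator A x))\<^sup>2) = indicator A x" for x by (simp add: indicator_def)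
  then show ?thesis using A by (simp add: L2_sqnorm_def)
qed

lemma Lp_space_2_lincomb:
  assumes "f \<in> Lp_space M 2" "g \<in> Lp_space M 2"
  shows "(\<lambda>x. a * f x + b * g x) \<in> Lp_space M 2"
proof -
  have [measurable]: "f \<in> borel_measurable M" "g \<in> borel_measurable M"
    using assms by (auto simp: Lp_space_def)
  have "L2_sqnorm M (\<lambda>x. a * f x + b * g x) \<le> ennreal (2 * (cmod a)\<^sup>2) * L2_sqnorm M f + ennreal (2
      * (cmod b)\<^sup>2) * L2_sqnorm M g"
    by (intro L2_sqnorm_lincomb) auto
  also have "\<dots> < \<infinity>" using assms by (auto simp: Lp_space_2_iff_L2_sqnorm ennreal_mult_less_top)
  finally show ?thesis by (auto simp: Lp_space_2_iff_L2_sqnorm)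
qed

text \<open>Times are replaced by a sequence, as dominated convergence requires. The sets
  \<open>B m\<close> exhaust the space by open sets of finite measure, which gives room for
  complements and truncations although the whole space may have infinite measure.\<close>

locale kernel_approximate_identity =
  fixes M :: "'a::topological_space measure" and K :: "nat \<Rightarrow> 'a \<Rightarrow> 'a \<Rightarrow> real" and B :: "nat \<Rightarrow> 'a set"
  assumes kernel: "\<And>n. symmetric_kernel M (K n) 1"
    and sets_M: "sets M = sets (restrict_space borel (space M))"
    and open_B: "\<And>m. open (B m)" and incseq_B: "incseq B"
    and finite_B: "\<And>m. emeasure M (B m \<inter> space M) < \<infinity>"
    and cover_B: "space M \<subseteq> (\<Union>m. B m)"
    and concentration: "\<And>U x. open U \<Longrightarrow> x \<in> U \<Longrightarrow> x \<in> space M \<Longrightarrow>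
      (\<lambda>n. \<integral>\<^sup>+y. ennreal (K n x y) * indicator U y \<partial>M) \<longlonglongrightarrow> 1"
begin

definition L2_converges :: "('a \<Rightarrow> complex) \<Rightarrow> bool" where
  "L2_converges f \<longleftrightarrow> f \<in> Lp_space M 2 \<and> (\<lambda>n. L2_sqnorm M (\<lambda>x. kernel_op M (K n) f x - f x)) \<longlonglongrightarrow> 0"

lemma kernel_op_measurable': "f \<in> borel_measurable M \<Longrightarrow> kernel_op M (K n) f \<in> borel_measurable M"
  using symmetric_kernel.kernel_op_measurable[OF kernel] .

lemma L2_subset: "f \<in> Lp_space M 2 \<Longrightarrow> f \<in> L1_plus_Linf M"
  using Lp_space_subset_L1_plus_Linf[of 2 M] by auto

lemma L2_sqnorm_kernel_op_le:
  assumes "f \<in> borel_measurable M"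
  shows "L2_sqnorm M (kernel_op M (K n) f) \<le> L2_sqnorm M f"
  using symmetric_kernel.nn_integral_kernel_op_powr_le[OF kernel assms, of 2 n] by (simp add:
      L2_sqnorm_def)

lemma L2_converges_lincomb:
  assumes "L2_converges f" "L2_converges g"
  shows "L2_converges (\<lambda>x. a * f x + b * g x)"
proof -
  have L: "f \<in> Lp_space M 2" "g \<in> Lp_space M 2" using assms by (auto simp: L2_converges_def)
  then have [measurable]: "f \<in> borel_measurable M" "g \<in> borel_measurable M"
    by (auto simp: Lp_space_def)
  note [measurable] = kernel_op_measurable'
  let ?c = "\<lambda>n. ennreal (2 * (cmod a)\<^sup>2) * L2_sqnorm M (\<lambda>x. kernel_op M (K n) f x - f x)
      + ennreal (2 * (cmod b)\<^sup>2) * L2_sqnorm M (\<lambda>x. kernel_op M (K n) g x - g x)"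
  have le: "L2_sqnorm M (\<lambda>x. kernel_op M (K n) (\<lambda>x. a * f x + b * g x) x - (a * f x + b * g x)) \<le> ?c
      n" for n
  proof (rule L2_sqnorm_lincomb)
    show "AE x in M. kernel_op M (K n) (\<lambda>x. a * f x + b * g x) x - (a * f x + b * g x) =
      a * (kernel_op M (K n) f x - f x) + b * (kernel_op M (K n) g x - g x)"
      using symmetric_kernel.kernel_op_linear[OF kernel L2_subset[OF L(1)] L2_subset[OF L(2)], of n
          a b]
      by eventually_elim (simp add: algebra_simps)
  qed measurable
  have "?c \<longlonglongrightarrow> ennreal (2 * (cmod a)\<^sup>2) * 0 + ennreal (2 * (cmod b)\<^sup>2) * 0"
    using assms by (intro tendsto_add ennreal_tendsto_cmult) (auto simp: L2_converges_def)
  then have lim: "?c \<longlonglongrightarrow> 0" by (simp only: mult_zero_right add_0_left)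
  have "(\<lambda>n. L2_sqnorm M (\<lambda>x. kernel_op M (K n) (\<lambda>x. a * f x + b * g x) x - (a * f x + b * g x))) \<longlonglongrightarrow>
      0"
    by (rule tendsto_sandwich[OF always_eventually[OF allI[OF zero_le]] always_eventually[OF allI[OF
        le]] tendsto_const lim])
  then show ?thesis using Lp_space_2_lincomb[OF L] by (simp add: L2_converges_def)
qed

lemma L2_converges_zero: "L2_converges (\<lambda>_. 0)"
  by (simp add: L2_converges_def Lp_space_2_iff kernel_op_def L2_sqnorm_def)

lemma L2_converges_sum:
  assumes "finite I" "\<And>i. i \<in> I \<Longrightarrow> L2_converges (g i)"
  shows "L2_converges (\<lambda>x. \<Sum>i\<in>I. c i * g i x)"
  using assms
proof (induction I rule: finite_induct)
  case (insert i I)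
  then have "L2_converges (\<lambda>x. c i * g i x + 1 * (\<Sum>i\<in>I. c i * g i x))" by (intro
      L2_converges_lincomb) auto
  then show ?case using insert by simp
qed (simp add: L2_converges_zero)

lemma L2_converges_L2_limit:
  assumes f: "f \<in> Lp_space M 2" and g: "\<And>m. L2_converges (g m)"
    and lim: "(\<lambda>m. L2_sqnorm M (\<lambda>x. f x - g m x)) \<longlonglongrightarrow> 0"
  shows "L2_converges f"
proof -
  have gL: "g m \<in> Lp_space M 2" for m using g by (auto simp: L2_converges_def)
  have [measurable]: "f \<in> borel_measurable M" "g m \<in> borel_measurable M" for m
    using f gL by (auto simp: Lp_space_def)
  note [measurable] = kernel_op_measurable'
  have dL: "(\<lambda>x. f x - g m x) \<in> Lp_space M 2" for m
    using Lp_space_2_lincomb[OF f gL[of m], of 1 "-1"] by simp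
  let ?d = "\<lambda>m. L2_sqnorm M (\<lambda>x. f x - g m x)"
  \<comment> \<open>Split \<open>f\<close> as \<open>(f - g m) + g m\<close>. Contractivity bounds
    the defect of \<open>f - g m\<close> by 4 times its squared norm, and the splitting itself costs
    another factor 2.\<close>
  have le: "L2_sqnorm M (\<lambda>x. kernel_op M (K n) f x - f x)
     \<le> ennreal 8 * ?d m + ennreal 2 * L2_sqnorm M (\<lambda>x. kernel_op M (K n) (g m) x - g m x)" for n m
  proof -
    let ?e = "\<lambda>x. f x - g m x"
    have "L2_sqnorm M (\<lambda>x. kernel_op M (K n) ?e x - ?e x)
      \<le> ennreal (2 * (cmod 1)\<^sup>2) * L2_sqnorm M (kernel_op M (K n) ?e) + ennreal (2 * (cmod (-1))\<^sup>2)
          * L2_sqnorm M ?e"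
      by (rule L2_sqnorm_lincomb) (auto intro!: kernel_op_measurable' borel_measurable_diff)
    also have "\<dots> \<le> ennreal 2 * L2_sqnorm M ?e + ennreal 2 * L2_sqnorm M ?e"
      using L2_sqnorm_kernel_op_le[of ?e n] by (auto intro!: add_mono mult_left_mono)
    also have "\<dots> = ennreal 4 * L2_sqnorm M ?e"
      by (simp only: distrib_right[symmetric] ennreal_plus[symmetric] zero_le_numeral
          numeral_plus_numeral add_num_simps)
    finally have 1: "L2_sqnorm M (\<lambda>x. kernel_op M (K n) ?e x - ?e x) \<le> ennreal 4 * L2_sqnorm M ?e" .
    have "AE x in M. kernel_op M (K n) f x - f x = 1 * (kernel_op M (K n) ?e x - ?e x) + 1 *
        (kernel_op M (K n) (g m) x - g m x)"
      using symmetric_kernel.kernel_op_linear[OF kernel L2_subset[OF dL[of m]] L2_subset[OF gL[of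
          m]], of n 1 1]
      by eventually_elim simp
    then have "L2_sqnorm M (\<lambda>x. kernel_op M (K n) f x - f x) \<le> ennreal (2 * (cmod 1)\<^sup>2) * L2_sqnorm
        M (\<lambda>x. kernel_op M (K n) ?e x - ?e x)
       + ennreal (2 * (cmod 1)\<^sup>2) * L2_sqnorm M (\<lambda>x. kernel_op M (K n) (g m) x - g m x)"
      by (intro L2_sqnorm_lincomb) measurable
    also have "\<dots> \<le> ennreal (2 * (cmod 1)\<^sup>2) * (ennreal 4 * L2_sqnorm M ?e)
       + ennreal (2 * (cmod 1)\<^sup>2) * L2_sqnorm M (\<lambda>x. kernel_op M (K n) (g m) x - g m x)"
      by (intro add_mono mult_left_mono 1) auto
    also have "\<dots> = ennreal 8 * ?d m + ennreal 2 * L2_sqnorm M (\<lambda>x. kernel_op M (K n) (g m) x - g m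
        x)"
      by (simp add: mult.assoc[symmetric] ennreal_mult[symmetric] del: ennreal_numeral)
    finally show ?thesis .
  qed
  have l1: "(\<lambda>m. ennreal 8 * ?d m) \<longlonglongrightarrow> ennreal 8 * 0"
    using lim by (intro ennreal_tendsto_cmult) auto
  have l2: "(\<lambda>n. ennreal 2 * L2_sqnorm M (\<lambda>x. kernel_op M (K n) (g m) x - g m x)) \<longlonglongrightarrow> ennreal 2 * 0"
      for m
    using g by (intro ennreal_tendsto_cmult) (auto simp: L2_converges_def)
  have "(\<lambda>n. L2_sqnorm M (\<lambda>x. kernel_op M (K n) f x - f x)) \<longlonglongrightarrow> 0"
    by (rule ennreal_LIMSEQ_0_by_approximation[OF le l1[unfolded mult_zero_right] l2[unfolded
        mult_zero_right]])
  then show ?thesis using f by (simp add: L2_converges_def)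
qed

lemma L2_converges_dominated_limit:
  assumes f: "f \<in> borel_measurable M" and g: "\<And>m. L2_converges (g m)" and G: "G \<in> Lp_space M 2"
    and bound: "\<And>m x. x \<in> space M \<Longrightarrow> cmod (g m x) \<le> cmod (G x)"
    and lim: "\<And>x. x \<in> space M \<Longrightarrow> (\<lambda>m. g m x) \<longlonglongrightarrow> f x"
  shows "L2_converges f"
proof (rule L2_converges_L2_limit[OF _ g])
  have [measurable]: "f \<in> borel_measurable M" "g m \<in> borel_measurable M" "G \<in> borel_measurable M"
      for m
    using f g G by (auto simp: Lp_space_def L2_converges_def)
  have Gfin: "L2_sqnorm M G < \<infinity>" using G by (simp add: Lp_space_2_iff_L2_sqnorm)
  have fG: "cmod (f x) \<le> cmod (G x)" if "x \<in> space M" for x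
    using tendsto_norm[OF lim[OF that]] bound[OF that] by (intro LIMSEQ_le_const2) auto
  have "L2_sqnorm M f \<le> L2_sqnorm M G"
    unfolding L2_sqnorm_def by (intro nn_integral_mono ennreal_leI power_mono fG) auto
  then show "f \<in> Lp_space M 2" using Gfin by (auto simp: Lp_space_2_iff_L2_sqnorm)
  have "(\<lambda>m. \<integral>\<^sup>+x. ennreal ((cmod (f x - g m x))\<^sup>2) \<partial>M) \<longlonglongrightarrow> (\<integral>\<^sup>+x. 0 \<partial>M)"
  proof (rule nn_integral_dominated_convergence[where w = "\<lambda>x. ennreal 4 * ennreal ((cmod (G
      x))\<^sup>2)"])
    show "AE x in M. ennreal ((cmod (f x - g j x))\<^sup>2) \<le> ennreal 4 * ennreal ((cmod (G x))\<^sup>2)" for j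
    proof (rule AE_I2)
      fix x assume x: "x \<in> space M"
      have "cmod (f x - g j x) \<le> 2 * cmod (G x)"
        using norm_triangle_ineq4[of "f x" "g j x"] fG[OF x] bound[OF x, of j] by linarith
      then have "(cmod (f x - g j x))\<^sup>2 \<le> (2 * cmod (G x))\<^sup>2" by (intro power_mono) auto
      then show "ennreal ((cmod (f x - g j x))\<^sup>2) \<le> ennreal 4 * ennreal ((cmod (G x))\<^sup>2)"
        by (simp add: ennreal_mult[symmetric] power_mult_distrib ennreal_leI del: ennreal_numeral)
    qed
    show "(\<integral>\<^sup>+x. ennreal 4 * ennreal ((cmod (G x))\<^sup>2) \<partial>M) < \<infinity>"
      using Gfin by (simp add: nn_integral_cmult L2_sqnorm_def[symmetric] ennreal_mult_less_top del:
          ennreal_numeral)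
    show "AE x in M. (\<lambda>i. ennreal ((cmod (f x - g i x))\<^sup>2)) \<longlonglongrightarrow> 0"
    proof (rule AE_I2)
      fix x assume x: "x \<in> space M"
      have "(\<lambda>i. (cmod (f x - g i x))\<^sup>2) \<longlonglongrightarrow> (cmod (f x - f x))\<^sup>2" by (intro tendsto_intros lim x)
      then show "(\<lambda>i. ennreal ((cmod (f x - g i x))\<^sup>2)) \<longlonglongrightarrow> 0"
        using tendsto_ennrealI by fastforce
    qed
  qed measurable
  then show "(\<lambda>m. L2_sqnorm M (\<lambda>x. f x - g m x)) \<longlonglongrightarrow> 0" by (simp add: L2_sqnorm_def)
qed

text \<open>Contractivity gives \<open>\<parallel>T f - f\<parallel>\<^sup>2 \<le> 2 \<parallel>f\<parallel>\<^sup>2 - 2 \<langle>T f, f\<rangle>\<close>, so for an indicator it is enough that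
  \<open>\<langle>T 1\<^sub>U, 1\<^sub>U\<rangle>\<close> tends to the measure of \<open>U\<close>, and only points inside \<open>U\<close> matter.\<close>

lemma L2_converges_indicator_open:
  assumes U: "open U" and fin: "emeasure M (U \<inter> space M) < \<infinity>"
  shows "L2_converges (indicator (U \<inter> space M))"
proof -
  define A where "A = U \<inter> space M"
  have A[measurable]: "A \<in> sets M"
    unfolding sets_M A_def sets_restrict_space using U by auto
  let ?f = "indicator A :: 'a \<Rightarrow> complex"
  have fL: "?f \<in> Lp_space M 2" using fin A by (simp add: Lp_space_2_iff_L2_sqnorm
      L2_sqnorm_indicator A_def)
  \<comment> \<open>The image of the indicator as a real function with values in the unit interval,
    so that the defect becomes real algebra.\<close>
  define h where "h n x = enn2real (\<integral>\<^sup>+y. ennreal (K n x y) * indicator A y \<partial>M)" for n x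
  have h: "ennreal (h n x) = (\<integral>\<^sup>+y. ennreal (K n x y) * indicator A y \<partial>M)"
    and h1: "h n x \<le> 1" and Tf: "kernel_op M (K n) ?f x = complex_of_real (h n x)" if x[measurable]:
        "x \<in> space M" for n x
  proof -
    interpret symmetric_kernel M "K n" 1 by (rule kernel)
    have "(\<integral>\<^sup>+y. ennreal (K n x y) * indicator A y \<partial>M) \<le> (\<integral>\<^sup>+y. ennreal (K n x y) \<partial>M)"
      by (intro nn_integral_mono) (auto simp: indicator_def)
    also have "\<dots> \<le> ennreal 1" by (rule kernel_bound[OF x])
    finally have le: "(\<integral>\<^sup>+y. ennreal (K n x y) * indicator A y \<partial>M) \<le> ennreal 1" .
    then show "h n x \<le> 1" unfolding h_def by (intro enn2real_leI) auto
    show eq: "ennreal (h n x) = (\<integral>\<^sup>+y. ennreal (K n x y) * indicator A y \<partial>M)"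
      unfolding h_def using le by (intro ennreal_enn2real) (auto intro: le_less_trans)
    have "kernel_op M (K n) ?f x = (\<integral>y. complex_of_real (K n x y * indicator A y) \<partial>M)"
      unfolding kernel_op_def by (intro Bochner_Integration.integral_cong) (auto simp:
          indicator_def)
    also have "\<dots> = complex_of_real (\<integral>y. K n x y * indicator A y \<partial>M)" by (rule
        integral_complex_of_real)
    also have "(\<integral>y. K n x y * indicator A y \<partial>M) = enn2real (\<integral>\<^sup>+y. ennreal (K n x y * indicator A y)
        \<partial>M)"
      by (rule integral_eq_nn_integral) (use kernel_nonneg[OF x] in \<open>measurable, auto simp:
          indicator_def\<close>)
    also have "(\<integral>\<^sup>+y. ennreal (K n x y * indicator A y) \<partial>M) = (\<integral>\<^sup>+y. ennreal (K n x y) * indicator A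
        y \<partial>M)"
      by (intro nn_integral_cong) (auto simp: indicator_def)
    finally show "kernel_op M (K n) ?f x = complex_of_real (h n x)" by (simp add: h_def)
  qed
  have h0: "0 \<le> h n x" for n x by (simp add: h_def)
  have hm[measurable]: "h n \<in> borel_measurable M" for n
  proof -
    interpret symmetric_kernel M "K n" 1 by (rule kernel)
    show ?thesis unfolding h_def[abs_def] by measurable
  qed
  define I where "I n = (\<integral>\<^sup>+x. ennreal (h n x) * indicator A x \<partial>M)" for n
  have le: "L2_sqnorm M (\<lambda>x. kernel_op M (K n) ?f x - ?f x) \<le> 2 * emeasure M A - 2 * I n" for n
  proof -
    \<comment> \<open>The cross term is kept on the left so that nothing is subtracted in
      \<open>ennreal\<close>: on \<open>A\<close> the integrand uses
      \<open>(h - 1)^2 + 2 * h = h^2 + 1\<close>, and off \<open>A\<close> both sides are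
      \<open>h^2\<close>.\<close>
    have "L2_sqnorm M (\<lambda>x. kernel_op M (K n) ?f x - ?f x) + 2 * I n
       = (\<integral>\<^sup>+x. ennreal ((h n x - indicator A x)\<^sup>2) + 2 * (ennreal (h n x) * indicator A x) \<partial>M)"
    proof -
      have "L2_sqnorm M (\<lambda>x. kernel_op M (K n) ?f x - ?f x) = (\<integral>\<^sup>+x. ennreal ((h n x - indicator A
          x)\<^sup>2) \<partial>M)"
        unfolding L2_sqnorm_def
      proof (intro nn_integral_cong arg_cong[where f=ennreal])
        fix x assume "x \<in> space M"
        then have "kernel_op M (K n) ?f x - ?f x = complex_of_real (h n x - indicator A x)"
          by (simp add: Tf indicator_def)
        then show "(cmod (kernel_op M (K n) ?f x - ?f x))\<^sup>2 = (h n x - indicator A x)\<^sup>2"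
          by (simp only: norm_of_real power2_abs)
      qed
      then show ?thesis by (simp add: I_def nn_integral_add nn_integral_cmult)
    qed
    also have "\<dots> = (\<integral>\<^sup>+x. ennreal ((h n x)\<^sup>2) + indicator A x \<partial>M)"
    proof (intro nn_integral_cong)
      fix x
      show "ennreal ((h n x - indicator A x)\<^sup>2) + 2 * (ennreal (h n x) * indicator A x) = ennreal
          ((h n x)\<^sup>2) + indicator A x"
      proof (cases "x \<in> A")
        case True
        have "ennreal ((h n x - 1)\<^sup>2) + ennreal 2 * ennreal (h n x) = ennreal ((h n x)\<^sup>2) + ennreal
            1"
          using h0[of n x] by (simp only: ennreal_plus[symmetric] ennreal_mult[symmetric]
              zero_le_power2 zero_le_numeral zero_le_one mult_nonneg_nonneg)
            (simp add: power2_diff)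
        then show ?thesis using True by simp
      qed simp
    qed
    also have "\<dots> = L2_sqnorm M (kernel_op M (K n) ?f) + emeasure M A"
    proof -
      have "(\<integral>\<^sup>+x. ennreal ((h n x)\<^sup>2) \<partial>M) = L2_sqnorm M (kernel_op M (K n) ?f)"
        unfolding L2_sqnorm_def by (intro nn_integral_cong) (simp add: Tf)
      then show ?thesis by (simp add: nn_integral_add)
    qed
    also have "\<dots> \<le> emeasure M A + emeasure M A"
      using L2_sqnorm_kernel_op_le[of ?f n] by (intro add_right_mono) (simp add:
          L2_sqnorm_indicator)
    finally show ?thesis by (auto simp: mult_2 ennreal_le_minus_iff)
  qed
  have "I \<longlonglongrightarrow> emeasure M A"
  proof -
    have "I \<longlonglongrightarrow> (\<integral>\<^sup>+x. indicator A x \<partial>M)"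
      unfolding I_def
    proof (rule nn_integral_dominated_convergence[where w = "indicator A"])
      show "AE x in M. ennreal (h j x) * indicator A x \<le> indicator A x" for j
        using h1 by (intro AE_I2) (auto simp: indicator_def ennreal_le_1)
      show "integral\<^sup>N M (indicator A) < \<infinity>" using fin by (simp add: A_def[symmetric])
      show "AE x in M. (\<lambda>i. ennreal (h i x) * indicator A x) \<longlonglongrightarrow> indicator A x"
      proof (rule AE_I2)
        fix x assume x: "x \<in> space M"
        show "(\<lambda>i. ennreal (h i x) * indicator A x) \<longlonglongrightarrow> (indicator A x :: ennreal)"
        proof (cases "x \<in> A")
          case True
          have "(\<lambda>n. \<integral>\<^sup>+y. ennreal (K n x y) * indicator U y \<partial>M) \<longlonglongrightarrow> 1"
            using concentration[OF U _ x] True by (simp add: A_def)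
          moreover have "(\<integral>\<^sup>+y. ennreal (K n x y) * indicator U y \<partial>M) = ennreal (h n x)" for n
            unfolding h[OF x] by (intro nn_integral_cong) (auto simp: A_def indicator_def)
          ultimately show ?thesis using True by simp
        qed simp
      qed
    qed measurable
    then show ?thesis by simp
  qed
  then have "(\<lambda>n. 2 * emeasure M A - 2 * I n) \<longlonglongrightarrow> 2 * emeasure M A - 2 * emeasure M A"
    using fin by (intro tendsto_diff_ennreal tendsto_const ennreal_tendsto_cmult)
      (auto simp: A_def[symmetric] ennreal_mult_eq_top_iff)
  moreover have "2 * emeasure M A - 2 * emeasure M A = 0"
    using fin by (intro diff_eq_0_ennreal) (auto simp: A_def[symmetric] ennreal_mult_less_top)
  ultimately have lim: "(\<lambda>n. 2 * emeasure M A - 2 * I n) \<longlonglongrightarrow> 0" by simp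
  have "(\<lambda>n. L2_sqnorm M (\<lambda>x. kernel_op M (K n) ?f x - ?f x)) \<longlonglongrightarrow> 0"
    by (rule tendsto_sandwich[OF always_eventually[OF allI[OF zero_le]] always_eventually[OF allI[OF
        le]] tendsto_const lim])
  then show ?thesis using fL by (simp add: L2_converges_def A_def)
qed

text \<open>Dynkin's theorem on the traces of open sets. Everything is intersected with
  \<open>B m\<close>: a complement becomes the difference of the indicators of \<open>B m\<close>
  and \<open>A \<inter> B m\<close>, both square integrable, and the indicator of \<open>B m\<close>
  dominates the partial sums of a disjoint union.\<close>

lemma L2_converges_indicator:
  assumes A: "A \<in> sets M"
  shows "L2_converges (indicator (A \<inter> B m))"
proof -
  define G where "G = {U \<inter> space M | U. open U}"
  have sets_G: "sets M = sigma_sets (space M) G"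
  proof -
    have "sets M = {(\<lambda>x. x) -` A \<inter> space M |A. A \<in> sigma_sets UNIV {S. open S}}"
      by (subst sets_M) (auto simp: sets_restrict_space borel_def)
    also have "\<dots> = sigma_sets (space M) {(\<lambda>x. x) -` A \<inter> space M |A. A \<in> {S. open S}}"
      by (rule sigma_sets_vimage_commute) auto
    also have "{(\<lambda>x. x) -` A \<inter> space M |A. A \<in> {S::'a set. open S}} = G" by (auto simp: G_def)
    finally show ?thesis .
  qed
  have Bm: "B m \<inter> space M \<in> sets M" unfolding sets_G G_def using open_B by auto
  have ind_meas: "S \<in> sets M \<Longrightarrow> indicator (S \<inter> B m) \<in> borel_measurable M" for S
  proof -
    assume S: "S \<in> sets M"
    then have "S \<inter> B m = S \<inter> (B m \<inter> space M)" using sets.sets_into_space by auto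
    then show ?thesis using S Bm by auto
  qed
  have BL: "indicator (B m \<inter> space M) \<in> Lp_space M 2"
    using L2_converges_indicator_open[OF open_B finite_B] by (simp add: L2_converges_def)
  have "Int_stable G"
    unfolding Int_stable_def G_def
  proof safe
    fix U V :: "'a set" assume "open U" "open V"
    then show "\<exists>W. (U \<inter> space M) \<inter> (V \<inter> space M) = W \<inter> space M \<and> open W"
      by (intro exI[of _ "U \<inter> V"]) auto
  qed
  moreover have "G \<subseteq> Pow (space M)" by (auto simp: G_def)
  moreover have "A \<in> sigma_sets (space M) G" using A by (simp add: sets_G)
  ultimately show ?thesis
  proof (induction rule: sigma_sets_induct_disjoint)
    case (basic A)
    then obtain U where U: "A = U \<inter> space M" "open U" by (auto simp: G_def)
    have "emeasure M (U \<inter> B m \<inter> space M) \<le> emeasure M (B m \<inter> space M)"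
      using Bm by (intro emeasure_mono) auto
    also have "\<dots> < \<infinity>" by (rule finite_B)
    finally have "L2_converges (indicator (U \<inter> B m \<inter> space M))"
      using U open_B by (intro L2_converges_indicator_open) auto
    moreover have "U \<inter> B m \<inter> space M = A \<inter> B m" using U by auto
    ultimately show ?case by simp
  next
    case empty
    show ?case using L2_converges_zero by (simp add: indicator_def)
  next
    case (compl A)
    have "L2_converges (\<lambda>x. 1 * indicator (B m \<inter> space M) x + (-1) * indicator (A \<inter> B m) x)"
      by (intro L2_converges_lincomb compl L2_converges_indicator_open open_B finite_B)
    moreover have "A \<subseteq> space M" using compl sets.sets_into_space[of A M] by (simp add: sets_G)
    then have "1 * indicator (B m \<inter> space M) x + (-1) * indicator (A \<inter> B m) x = (indicator ((space M
        - A) \<inter> B m) x :: complex)" for x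
      by (auto simp: indicator_def)
    ultimately show ?case by simp
  next
    case (union A)
    have Am: "A i \<in> sets M" for i using union by (auto simp: sets_G)
    have part: "L2_converges (indicator ((\<Union>i<N. A i) \<inter> B m))" for N
    proof -
      have "L2_converges (\<lambda>x. \<Sum>i<N. 1 * indicator (A i \<inter> B m) x)"
        by (intro L2_converges_sum union) auto
      moreover have "(\<Sum>i<N. 1 * indicator (A i \<inter> B m) x) = (indicator ((\<Union>i<N. A i) \<inter> B m) x ::
          complex)" for x
      proof -
        have "disjoint_family_on (\<lambda>i. A i \<inter> B m) {..<N}"
          using union(1) by (auto simp: disjoint_family_on_def)
        then have "indicator (\<Union>i<N. A i \<inter> B m) x = (\<Sum>i<N. indicator (A i \<inter> B m) x :: complex)"
          by (intro indicator_UN_disjoint) auto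
        then show ?thesis by (simp add: Int_UN_distrib2)
      qed
      ultimately show ?thesis by simp
    qed
    show ?case
    proof (rule L2_converges_dominated_limit[OF _ part BL])
      show "indicator (\<Union> (range A) \<inter> B m) \<in> borel_measurable M" using Am by (intro ind_meas) auto
      show "cmod (indicator ((\<Union>i<N. A i) \<inter> B m) x) \<le> cmod (indicator (B m \<inter> space M) x)" if "x \<in>
          space M" for N x
        using that by (auto simp: indicator_def)
      show "(\<lambda>N. indicator ((\<Union>i<N. A i) \<inter> B m) x) \<longlonglongrightarrow> (indicator (\<Union> (range A) \<inter> B m) x :: complex)" if
          "x \<in> space M" for x
      proof (cases "x \<in> \<Union> (range A)")
        case True
        then obtain i where i: "x \<in> A i" by auto
        have "indicator ((\<Union>i<N. A i) \<inter> B m) x = (indicator (\<Union> (range A) \<inter> B m) x :: complex)" if "N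
            > i" for N
          using i that by (auto simp: indicator_def)
        then show ?thesis
          by (intro tendsto_eventually) (auto simp: eventually_at_top_dense)
      qed (auto simp: indicator_def)
    qed
  qed
qed

text \<open>Simple functions approximate \<open>f\<close> pointwise with majorant
  \<open>2 * cmod (f x)\<close>. Cutting the m-th one off outside \<open>B m\<close> makes it a
  finite combination of the indicators already treated, and it does not disturb the limit because
  every point eventually lies in \<open>B m\<close>.\<close>

lemma L2_converges_L2:
  assumes f: "f \<in> Lp_space M 2"
  shows "L2_converges f"
proof -
  have [measurable]: "f \<in> borel_measurable M" using f by (simp add: Lp_space_def)
  have "\<exists>F. (\<forall>i. simple_function M (F i)) \<and> (\<forall>x\<in>space M. (\<lambda>i. F i x) \<longlonglongrightarrow> f x) \<and>
    (\<forall>i. \<forall>x\<in>space M. norm (F i x) \<le> 2 * norm (f x))"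
    using borel_measurable_implies_sequence_metric[of f M 0] unfolding dist_0_norm[symmetric]
        dist_commute[of 0] by simp
  then obtain s where s: "\<And>i. simple_function M (s i)" "\<And>x. x \<in> space M \<Longrightarrow> (\<lambda>i. s i x) \<longlonglongrightarrow> f x"
    "\<And>i x. x \<in> space M \<Longrightarrow> norm (s i x) \<le> 2 * norm (f x)"
    by blast
  \<comment> \<open>The majorant \<open>2 * f\<close>, written as a linear combination so that
    closure under linear combinations applies.\<close>
  have G: "(\<lambda>x. 2 * f x + 0 * f x) \<in> Lp_space M 2" using f f by (rule Lp_space_2_lincomb)
  define g where "g m x = (\<Sum>c\<in>s m ` space M. c * indicator ((s m -` {c} \<inter> space M) \<inter> B m) x)" for m
      x
  have g_eq: "g m x = s m x * indicator (B m) x" if x: "x \<in> space M" for m x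
  proof -
    have "g m x = (\<Sum>c\<in>s m ` space M. if c = s m x then c * indicator (B m) x else 0)"
      unfolding g_def using x by (intro sum.cong) (auto simp: indicator_def)
    also have "\<dots> = s m x * indicator (B m) x"
      using simple_functionD(1)[OF s(1)[of m]] x by (subst sum.delta) auto
    finally show ?thesis .
  qed
  show ?thesis
  proof (rule L2_converges_dominated_limit[OF _ _ G])
    show "L2_converges (g m)" for m
      unfolding g_def using simple_functionD[OF s(1)[of m]] by (intro L2_converges_sum
          L2_converges_indicator) auto
    show "cmod (g m x) \<le> cmod (2 * f x + 0 * f x)" if "x \<in> space M" for m x
      using s(3)[OF that, of m] by (auto simp: g_eq[OF that] norm_mult indicator_def)
    show "(\<lambda>m. g m x) \<longlonglongrightarrow> f x" if x: "x \<in> space M" for x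
    proof -
      obtain j where "x \<in> B j" using x cover_B by auto
      then have "x \<in> B m" if "j \<le> m" for m using incseqD[OF incseq_B that] by auto
      then have "eventually (\<lambda>m. s m x = g m x) sequentially"
        by (auto simp: eventually_sequentially g_eq[OF x] intro!: exI[of _ j])
      then show ?thesis using s(2)[OF x] by (rule Lim_transform_eventually[rotated])
    qed
  qed measurable
qed

end

section \<open>The Laguerre kernel on the orthant\<close>

lemma space_laguerre_measure: "space (laguerre_measure \<alpha>) = orthant"
  by (simp add: laguerre_measure_def space_restrict_space)

lemma sets_laguerre_measure: "sets (laguerre_measure \<alpha>) = sets (restrict_space borel orthant)"
  by (simp add: laguerre_measure_def sets_restrict_space)

lemma orthant_eq_Inter: "(orthant :: (real ^ 'n) set) = (\<Inter>i. {x. 0 < x $ i})"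
  by (auto simp: orthant_def)

lemma open_orthant: "open (orthant :: (real ^ 'n) set)"
  unfolding orthant_eq_Inter by (intro open_INT ballI open_Collect_less continuous_intros) auto

lemma orthant_borel[measurable]: "(orthant :: (real ^ 'n) set) \<in> sets borel"
  using open_orthant by (rule borel_open)

lemma vec_nth_measurable[measurable]: "(\<lambda>x. (x :: real ^ 'n) $ i) \<in> borel_measurable borel"
  by (intro borel_measurable_continuous_onI continuous_intros)

lemma measurable_laguerre_measure:
  "f \<in> measurable borel N \<Longrightarrow> f \<in> measurable (laguerre_measure \<alpha>) N"
  using measurable_cong_sets[OF sets_laguerre_measure[of \<alpha>] refl] measurable_restrict_space1 by
      blast

lemma nn_integral_laguerre_measure:
  fixes \<alpha> :: "real ^ 'n"
  assumes [measurable]: "f \<in> borel_measurable borel"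
  shows "(\<integral>\<^sup>+y. f y \<partial>laguerre_measure \<alpha>) =
    (\<integral>\<^sup>+y. ennreal (\<Prod>i\<in>UNIV. y $ i powr (2 * \<alpha> $ i + 1)) * f y * indicator orthant y \<partial>lborel)"
proof -
  have "(\<integral>\<^sup>+y. f y \<partial>laguerre_measure \<alpha>) = (\<integral>\<^sup>+y. ennreal (\<Prod>i\<in>UNIV. y $ i powr (2 * \<alpha> $ i + 1)) * f y
      \<partial>restrict_space lborel orthant)"
    unfolding laguerre_measure_def by (intro nn_integral_density measurable_restrict_space1)
        measurable
  also have "\<dots> = (\<integral>\<^sup>+y. ennreal (\<Prod>i\<in>UNIV. y $ i powr (2 * \<alpha> $ i + 1)) * f y * indicator orthant y
      \<partial>lborel)"
    by (intro nn_integral_restrict_space) simp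
  finally show ?thesis .
qed

lemma nn_integral_laguerre_measure_prod:
  fixes \<alpha> :: "real ^ 'n"
  assumes F[measurable]: "\<And>i. F i \<in> borel_measurable borel"
  shows "(\<integral>\<^sup>+y. (\<Prod>i\<in>UNIV. F i (y $ i)) \<partial>laguerre_measure \<alpha>) =
    (\<Prod>i\<in>UNIV. \<integral>\<^sup>+y. indicator {0<..} y * ennreal (y powr (2 * \<alpha> $ i + 1)) * F i y \<partial>lborel)"
proof -
  \<comment> \<open>The product formula for \<open>lborel\<close> is indexed by
    \<open>Basis\<close>, whereas the factors depend on coordinates; \<open>THE\<close> recovers the
    coordinate, as \<open>axis i 1\<close> determines \<open>i\<close>.\<close>
  define f :: "real ^ 'n \<Rightarrow> real \<Rightarrow> ennreal" where
    "f b y = (let i = (THE i. b = axis i 1) in indicator {0<..} y * ennreal (y powr (2 * \<alpha> $ i + 1))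
        * F i y)" for b y
  have f_axis: "f (axis i 1) y = indicator {0<..} y * ennreal (y powr (2 * \<alpha> $ i + 1)) * F i y" for
      i y
  proof -
    have "(THE j. axis i 1 = (axis j 1 :: real ^ 'n)) = i" by (rule the_equality) (auto simp:
        axis_eq_axis)
    then show ?thesis by (simp add: f_def Let_def)
  qed
  have Basis: "Basis = range (\<lambda>i. axis i 1 :: real ^ 'n)" by (auto simp: Basis_vec_def)
  have inj: "inj (\<lambda>i. axis i 1 :: real ^ 'n)" by (auto simp: inj_on_def axis_eq_axis)
  have prod_Basis: "(\<Prod>b\<in>Basis. g b) = (\<Prod>i\<in>UNIV. g (axis i 1 :: real ^ 'n))" for g :: "real ^ 'n \<Rightarrow>
      ennreal"
    unfolding Basis by (subst prod.reindex[OF inj]) simp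
  have "(\<integral>\<^sup>+y. (\<Prod>i\<in>UNIV. F i (y $ i)) \<partial>laguerre_measure \<alpha>) =
    (\<integral>\<^sup>+y. ennreal (\<Prod>i\<in>UNIV. y $ i powr (2 * \<alpha> $ i + 1)) * (\<Prod>i\<in>UNIV. F i (y $ i)) * indicator
        orthant y \<partial>lborel)"
    by (rule nn_integral_laguerre_measure) measurable
  also have "\<dots> = (\<integral>\<^sup>+y. (\<Prod>b\<in>Basis. f b (y \<bullet> b)) \<partial>lborel)"
  proof (rule nn_integral_cong)
    fix y :: "real ^ 'n"
    have "indicator orthant y = (\<Prod>i\<in>UNIV. indicator {0<..} (y $ i) :: ennreal)"
      by (auto simp: orthant_def indicator_def prod_zero_iff intro!: prod.neutral[symmetric])
    then have "ennreal (\<Prod>i\<in>UNIV. y $ i powr (2 * \<alpha> $ i + 1)) * (\<Prod>i\<in>UNIV. F i (y $ i)) * indicator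
        orthant y
      = (\<Prod>i\<in>UNIV. indicator {0<..} (y $ i) * ennreal (y $ i powr (2 * \<alpha> $ i + 1)) * F i (y $ i))"
      by (simp add: prod_ennreal[symmetric] prod.distrib mult_ac)
    also have "\<dots> = (\<Prod>b\<in>Basis. f b (y \<bullet> b))"
      unfolding prod_Basis f_axis by (simp add: inner_axis)
    finally show "ennreal (\<Prod>i\<in>UNIV. y $ i powr (2 * \<alpha> $ i + 1)) * (\<Prod>i\<in>UNIV. F i (y $ i)) * indicator
        orthant y
      = (\<Prod>b\<in>Basis. f b (y \<bullet> b))" .
  qed
  also have "\<dots> = (\<Prod>b\<in>Basis. (\<integral>\<^sup>+x. f b x \<partial>lborel))"
    by (rule nn_integral_lborel_prod) (auto simp: f_def Let_def)
  also have "\<dots> = (\<Prod>i\<in>UNIV. \<integral>\<^sup>+y. indicator {0<..} y * ennreal (y powr (2 * \<alpha> $ i + 1)) * F i y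
      \<partial>lborel)"
    unfolding prod_Basis f_axis ..
  finally show ?thesis .
qed

lemma power2_norm_vec: "(norm (x :: real ^ 'n))\<^sup>2 = (\<Sum>i\<in>UNIV. (x $ i)\<^sup>2)"
  by (simp add: norm_vec_def L2_set_def sum_nonneg)

text \<open>The powers of \<open>x $ i * y $ i\<close> cancel only where this product is positive,
  hence the restriction to the orthant. From here on measurability and integrals concern only the
  regular factors.\<close>

lemma laguerre_kernel_eq_prod:
  fixes \<alpha> :: "real ^ 'n"
  assumes \<alpha>: "\<And>i. - 1 < \<alpha> $ i" and t: "0 < t" and x: "x \<in> orthant" and y: "y \<in> orthant"
  shows "laguerre_kernel \<alpha> t x y = (\<Prod>i\<in>UNIV. laguerre_factor (\<alpha> $ i) t (x $ i) (y $ i))"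
proof -
  define s c where "s = sinh (2 * t)" and "c = cosh (2 * t)"
  have s: "0 < s" using t by (simp add: s_def)
  have "(norm x)\<^sup>2 + (norm y)\<^sup>2 = (\<Sum>i\<in>UNIV. (x $ i)\<^sup>2 + (y $ i)\<^sup>2)"
    by (simp add: power2_norm_vec sum.distrib)
  then have "exp (- (1 / 2) * (c / s) * ((norm x)\<^sup>2 + (norm y)\<^sup>2)) = (\<Prod>i\<in>UNIV. exp (- (c / (2 * s))
      * ((x $ i)\<^sup>2 + (y $ i)\<^sup>2)))"
    by (simp add: sum_distrib_left exp_sum[symmetric])
  moreover have "inverse (s ^ CARD('n)) = (\<Prod>i\<in>(UNIV :: 'n set). 1 / s)"
    by (simp add: power_inverse inverse_eq_divide power_one_over)
  moreover have "(x $ i * y $ i) powr (- \<alpha> $ i) * bessel_I (\<alpha> $ i) (x $ i * y $ i / s) =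
     (2 * s) powr (- \<alpha> $ i) * bessel_series (\<alpha> $ i) ((x $ i * y $ i)\<^sup>2 / (4 * s\<^sup>2))" for i
  proof -
    have p: "0 < x $ i * y $ i" using x y by (auto simp: orthant_def)
    then have "bessel_I (\<alpha> $ i) (x $ i * y $ i / s) = (x $ i * y $ i / s / 2) powr (\<alpha> $ i) *
        bessel_series (\<alpha> $ i) ((x $ i * y $ i / s / 2)\<^sup>2)"
      using s \<alpha> by (intro bessel_I_eq_bessel_series) auto
    moreover have "(x $ i * y $ i / s / 2)\<^sup>2 = (x $ i * y $ i)\<^sup>2 / (4 * s\<^sup>2)"
      by (simp add: power_divide power_mult_distrib)
    moreover have "(x $ i * y $ i) powr (- \<alpha> $ i) * (x $ i * y $ i / s / 2) powr (\<alpha> $ i) = (2 * s)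
        powr (- \<alpha> $ i)"
    proof -
      have "r powr (- \<alpha> $ i) * (r / s / 2) powr (\<alpha> $ i) = (2 * s) powr (- \<alpha> $ i)" if "0 < r" for r
      proof -
        have "(r / s / 2) powr (\<alpha> $ i) = r powr (\<alpha> $ i) / (2 * s) powr (\<alpha> $ i)"
          using that s by (simp add: powr_divide[symmetric] mult.commute)
        moreover have "r powr (- \<alpha> $ i) * r powr (\<alpha> $ i) = 1" using that by (simp add:
            powr_add[symmetric])
        ultimately show ?thesis by (simp add: powr_minus_divide[of "2 * s"])
      qed
      then show ?thesis using p by blast
    qed
    ultimately show ?thesis by (simp add: mult.assoc[symmetric])
  qed
  ultimately show ?thesis
    unfolding laguerre_kernel_def laguerre_factor_def s_def[symmetric] c_def[symmetric]
    by (simp only: prod.distrib[symmetric]) (simp add: mult_ac)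
qed

text \<open>On the ball the indicator is at most \<open>exp (r^2)\<close> times a Gaussian, whose
  integral is a product of Gamma integrals. They are finite because each
  \<open>\<alpha> $ i > -1\<close>, although the density may blow up at the boundary.\<close>

lemma emeasure_laguerre_measure_ball_finite:
  fixes \<alpha> :: "real ^ 'n"
  assumes \<alpha>: "\<And>i. - 1 < \<alpha> $ i"
  shows "emeasure (laguerre_measure \<alpha>) (ball 0 r \<inter> orthant) < \<infinity>"
proof -
  let ?M = "laguerre_measure \<alpha>"
  have A: "ball 0 r \<inter> orthant \<in> sets ?M" by (auto simp: sets_laguerre_measure sets_restrict_space)
  have "(\<integral>\<^sup>+y. (\<Prod>i\<in>UNIV. ennreal (exp (- 1 * (y $ i)\<^sup>2))) \<partial>?M) =
    (\<Prod>i\<in>UNIV. \<integral>\<^sup>+y. indicator {0<..} y * ennreal (y powr (2 * \<alpha> $ i + 1)) * ennreal (exp (- 1 *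
        y\<^sup>2)) \<partial>lborel)"
    by (rule nn_integral_laguerre_measure_prod) measurable
  also have "\<dots> = (\<Prod>i\<in>UNIV. ennreal (Gamma (\<alpha> $ i + 1) / (2 * 1 powr (\<alpha> $ i + 1))))"
    by (intro prod.cong refl) (simp only: nn_integral_powr_gauss[OF \<alpha> zero_less_one, symmetric]
        ennreal_mult powr_ge_zero exp_ge_zero mult.assoc)
  also have "\<dots> < \<infinity>" by (simp add: ennreal_prod_eq_top less_top[symmetric])
  finally have fin: "(\<integral>\<^sup>+y. (\<Prod>i\<in>UNIV. ennreal (exp (- 1 * (y $ i)\<^sup>2))) \<partial>?M) < \<infinity>" .
  have "emeasure ?M (ball 0 r \<inter> orthant) = (\<integral>\<^sup>+y. indicator (ball 0 r \<inter> orthant) y \<partial>?M)"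
    using A by simp
  also have "\<dots> \<le> (\<integral>\<^sup>+y. ennreal (exp (r\<^sup>2)) * (\<Prod>i\<in>UNIV. ennreal (exp (- 1 * (y $ i)\<^sup>2))) \<partial>?M)"
  proof (rule nn_integral_mono)
    fix y :: "real ^ 'n"
    show "indicator (ball 0 r \<inter> orthant) y \<le> ennreal (exp (r\<^sup>2)) * (\<Prod>i\<in>UNIV. ennreal (exp (- 1 * (y
        $ i)\<^sup>2)))"
    proof (cases "y \<in> ball 0 r \<inter> orthant")
      case True
      have "(\<Prod>i\<in>UNIV. exp (- 1 * (y $ i)\<^sup>2)) = exp (- (norm y)\<^sup>2)"
        by (simp add: power2_norm_vec exp_sum[symmetric] sum_negf)
      moreover have "(norm y)\<^sup>2 \<le> r\<^sup>2" using True by (intro power_mono) auto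
      then have "1 \<le> exp (r\<^sup>2) * exp (- (norm y)\<^sup>2)" by (simp add: exp_add[symmetric])
      ultimately have "ennreal 1 \<le> ennreal (exp (r\<^sup>2) * (\<Prod>i\<in>UNIV. exp (- 1 * (y $ i)\<^sup>2)))"
        by (intro ennreal_leI) simp
      then show ?thesis using True by (simp add: ennreal_mult prod_nonneg prod_ennreal)
    qed simp
  qed
  also have "\<dots> = ennreal (exp (r\<^sup>2)) * (\<integral>\<^sup>+y. (\<Prod>i\<in>UNIV. ennreal (exp (- 1 * (y $ i)\<^sup>2))) \<partial>?M)"
    by (intro nn_integral_cmult measurable_laguerre_measure) measurable
  also have "\<dots> < \<infinity>" using fin by (simp add: ennreal_mult_less_top)
  finally show ?thesis .
qed

lemma sigma_finite_laguerre_measure: "sigma_finite_measure (laguerre_measure \<alpha>)"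
proof -
  interpret R: sigma_finite_measure "restrict_space lborel orthant"
    by (rule sigma_finite_measure_restrict_space[OF sigma_finite_lborel]) simp
  show ?thesis unfolding laguerre_measure_def
    by (subst R.sigma_finite_iff_density_finite) (auto intro!: measurable_restrict_space1)
qed

text \<open>The value at \<open>x\<close> of the semigroup applied to the Gaussian with exponent
  \<open>- (\<Sum>i. u i * y_i^2) / 2\<close>. The parameters \<open>u i\<close> are independent so
  that a single coordinate can be probed.\<close>

definition laguerre_gauss :: "real ^ 'n \<Rightarrow> real \<Rightarrow> real ^ 'n \<Rightarrow> ('n \<Rightarrow> real) \<Rightarrow> real" where
  "laguerre_gauss \<alpha> t x u = (\<Prod>i\<in>UNIV. (cosh (2 * t) + u i * sinh (2 * t)) powr (- (\<alpha> $ i + 1)) *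
       exp (- ((x $ i)\<^sup>2 / 2) * ((sinh (2 * t) + u i * cosh (2 * t)) / (cosh (2 * t) + u i * sinh (2
           * t)))))"

section \<open>Mass, moments and composition of the kernel\<close>

context
  fixes \<alpha> :: "real ^ 'n"
  assumes \<alpha>: "\<And>i. - 1 < \<alpha> $ i"
begin

lemma laguerre_kernel_nonneg:
  "0 < t \<Longrightarrow> x \<in> orthant \<Longrightarrow> y \<in> orthant \<Longrightarrow> 0 \<le> laguerre_kernel \<alpha> t x y"
  by (simp add: laguerre_kernel_eq_prod \<alpha> prod_nonneg laguerre_factor_nonneg)

lemma nn_integral_laguerre_kernel_gauss:
  assumes t: "0 < t" and x: "x \<in> orthant" and u: "\<And>i. 0 \<le> u i"
  shows "(\<integral>\<^sup>+y. ennreal (laguerre_kernel \<alpha> t x y) * ennreal (\<Prod>i\<in>UNIV. exp (- u i * (y $ i)\<^sup>2 / 2))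
      \<partial>laguerre_measure \<alpha>)
    = ennreal (laguerre_gauss \<alpha> t x u)"
proof -
  have "(\<integral>\<^sup>+y. ennreal (laguerre_kernel \<alpha> t x y) * ennreal (\<Prod>i\<in>UNIV. exp (- u i * (y $ i)\<^sup>2 / 2))
      \<partial>laguerre_measure \<alpha>)
    = (\<integral>\<^sup>+y. (\<Prod>i\<in>UNIV. ennreal (laguerre_factor (\<alpha> $ i) t (x $ i) (y $ i)) * ennreal (exp (- u i *
        (y $ i)\<^sup>2 / 2))) \<partial>laguerre_measure \<alpha>)"
    by (intro nn_integral_cong)
       (simp add: space_laguerre_measure laguerre_kernel_eq_prod \<alpha> t x prod.distrib prod_ennreal
           laguerre_factor_nonneg)
  also have "\<dots> = (\<Prod>i\<in>UNIV. \<integral>\<^sup>+y. indicator {0<..} y * ennreal (y powr (2 * \<alpha> $ i + 1)) *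
      (ennreal (laguerre_factor (\<alpha> $ i) t (x $ i) y) * ennreal (exp (- u i * y\<^sup>2 / 2))) \<partial>lborel)"
    by (rule nn_integral_laguerre_measure_prod) measurable
  also have "\<dots> = ennreal (laguerre_gauss \<alpha> t x u)"
    unfolding laguerre_gauss_def laguerre_factor_gauss[OF \<alpha> t u] by (rule prod_ennreal) simp
  finally show ?thesis .
qed

lemma laguerre_kernel_Chapman_Kolmogorov:
  assumes s: "0 < s" and t: "0 < t" and x: "x \<in> orthant" and y: "y \<in> orthant"
  shows "(\<integral>\<^sup>+z. ennreal (laguerre_kernel \<alpha> s x z) * ennreal (laguerre_kernel \<alpha> t z y)
      \<partial>laguerre_measure \<alpha>)
    = ennreal (laguerre_kernel \<alpha> (s + t) x y)"
proof -
  have "(\<integral>\<^sup>+z. ennreal (laguerre_kernel \<alpha> s x z) * ennreal (laguerre_kernel \<alpha> t z y)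
      \<partial>laguerre_measure \<alpha>)
    = (\<integral>\<^sup>+z. (\<Prod>i\<in>UNIV. ennreal (laguerre_factor (\<alpha> $ i) s (x $ i) (z $ i)) * ennreal
        (laguerre_factor (\<alpha> $ i) t (z $ i) (y $ i))) \<partial>laguerre_measure \<alpha>)"
    by (intro nn_integral_cong)
       (simp add: space_laguerre_measure laguerre_kernel_eq_prod \<alpha> s t x y prod.distrib prod_ennreal
           laguerre_factor_nonneg)
  also have "\<dots> = (\<Prod>i\<in>UNIV. \<integral>\<^sup>+z. indicator {0<..} z * ennreal (z powr (2 * \<alpha> $ i + 1)) *
      (ennreal (laguerre_factor (\<alpha> $ i) s (x $ i) z) * ennreal (laguerre_factor (\<alpha> $ i) t z (y $
          i))) \<partial>lborel)"
    by (rule nn_integral_laguerre_measure_prod) measurable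
  also have "\<dots> = ennreal (laguerre_kernel \<alpha> (s + t) x y)"
    unfolding laguerre_factor_Chapman_Kolmogorov[OF \<alpha> s t]
    using s t x y by (simp add: laguerre_kernel_eq_prod \<alpha> prod_ennreal laguerre_factor_nonneg)
  finally show ?thesis .
qed

lemma nn_integral_laguerre_kernel:
  assumes t: "0 < t" and x: "x \<in> orthant"
  shows "(\<integral>\<^sup>+y. ennreal (laguerre_kernel \<alpha> t x y) \<partial>laguerre_measure \<alpha>) = ennreal (laguerre_gauss \<alpha> t
      x (\<lambda>_. 0))"
  using nn_integral_laguerre_kernel_gauss[OF t x, of "\<lambda>_. 0"] by simp

lemma laguerre_gauss_0:
  assumes t: "0 < t"
  shows "laguerre_gauss \<alpha> t x (\<lambda>_. 0) = cosh (2 * t) powr (- ((\<Sum>i\<in>UNIV. \<alpha> $ i) + real CARD('n))) *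
     exp (- ((norm x)\<^sup>2 / 2) * (sinh (2 * t) / cosh (2 * t)))"
proof -
  have "(\<Prod>i\<in>UNIV. cosh (2 * t) powr (- (\<alpha> $ i + 1))) = cosh (2 * t) powr (\<Sum>i\<in>UNIV. - (\<alpha> $ i + 1))"
    by (rule powr_sum[symmetric]) auto
  also have "(\<Sum>i\<in>UNIV. - (\<alpha> $ i + 1)) = - ((\<Sum>i\<in>UNIV. \<alpha> $ i) + real CARD('n))"
    by (simp add: sum_negf sum.distrib sum_subtractf)
  moreover have "(\<Prod>i\<in>UNIV. exp (- ((x $ i)\<^sup>2 / 2) * (sinh (2 * t) / cosh (2 * t)))) = exp (- ((norm
      x)\<^sup>2 / 2) * (sinh (2 * t) / cosh (2 * t)))"
  proof -
    show ?thesis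
      by (simp only: power2_norm_vec exp_sum[OF finite, symmetric] sum_distrib_right[symmetric]
          sum_negf sum_divide_distrib[symmetric])
  qed
  ultimately show ?thesis unfolding laguerre_gauss_def by (simp add: prod.distrib)
qed

lemma exponent_pos: "0 < (\<Sum>i\<in>UNIV. \<alpha> $ i) + real CARD('n)"
proof -
  have "0 < \<alpha> $ i + 1" for i using \<alpha>[of i] by linarith
  then have "0 < (\<Sum>i\<in>UNIV. \<alpha> $ i + 1)" by (intro sum_pos) auto
  then show ?thesis by (simp add: sum.distrib)
qed

text \<open>The strict inequality rules out the Markov property; its weak form allows the constant 1
  in Schur's test at every positive time.\<close>

lemma cosh_powr_less_1:
  assumes "0 < t"
  shows "cosh (2 * t) powr (- ((\<Sum>i\<in>UNIV. \<alpha> $ i) + real CARD('n))) < 1"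
proof -
  have "1 < cosh (2 * t)" using assms cosh_real_strict_mono[of 0 "2 * t"] by simp
  then show ?thesis using exponent_pos powr_less_one[of "cosh (2 * t)"] by simp
qed

lemma laguerre_gauss_0_le:
  assumes t: "0 < t"
  shows "laguerre_gauss \<alpha> t x (\<lambda>_. 0) \<le> cosh (2 * t) powr (- ((\<Sum>i\<in>UNIV. \<alpha> $ i) + real CARD('n)))"
proof -
  have "exp (- ((norm x)\<^sup>2 / 2) * (sinh (2 * t) / cosh (2 * t))) \<le> 1" using t by simp
  then show ?thesis unfolding laguerre_gauss_0[OF t] by (intro mult_left_le) auto
qed

lemma laguerre_kernel_measurable:
  assumes t: "0 < t"
  shows "case_prod (laguerre_kernel \<alpha> t) \<in> borel_measurable (laguerre_measure \<alpha> \<Otimes>\<^sub>M laguerre_measure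
      \<alpha>)"
proof -
  have [measurable]: "(\<lambda>x. x $ i) \<in> borel_measurable (laguerre_measure \<alpha>)" for i
    by (rule measurable_laguerre_measure) measurable
  have "(\<lambda>z. \<Prod>i\<in>UNIV. laguerre_factor (\<alpha> $ i) t (fst z $ i) (snd z $ i)) \<in> borel_measurable
      (laguerre_measure \<alpha> \<Otimes>\<^sub>M laguerre_measure \<alpha>)"
    by measurable
  then show ?thesis
    by (rule measurable_cong[THEN iffD1, rotated])
       (auto simp: space_pair_measure space_laguerre_measure laguerre_kernel_eq_prod \<alpha> t)
qed

text \<open>The mass of the kernel at \<open>x\<close> is the power of cosh times a Gaussian in
  \<open>x\<close> that is at most 1, so any \<open>C\<close> above that power is
  admissible.\<close>

lemma symmetric_kernel_laguerre:
  assumes t: "0 < t" and C: "cosh (2 * t) powr (- ((\<Sum>i\<in>UNIV. \<alpha> $ i) + real CARD('n))) \<le> C"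
  shows "symmetric_kernel (laguerre_measure \<alpha>) (laguerre_kernel \<alpha> t) C"
proof -
  interpret sigma_finite_measure "laguerre_measure \<alpha>" by (rule sigma_finite_laguerre_measure)
  show ?thesis
  proof
    show "case_prod (laguerre_kernel \<alpha> t) \<in> borel_measurable (laguerre_measure \<alpha> \<Otimes>\<^sub>M
        laguerre_measure \<alpha>)"
      by (rule laguerre_kernel_measurable[OF t])
    show "0 < C" by (rule less_le_trans[OF _ C]) simp
    fix x assume "x \<in> space (laguerre_measure \<alpha>)"
    then have x: "x \<in> orthant" by (simp add: space_laguerre_measure)
    show "(\<integral>\<^sup>+y. ennreal (laguerre_kernel \<alpha> t x y) \<partial>laguerre_measure \<alpha>) \<le> ennreal C"
      unfolding nn_integral_laguerre_kernel[OF t x] using laguerre_gauss_0_le[OF t] C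
      by (intro ennreal_leI order_trans[OF _ C])
    fix y assume "y \<in> space (laguerre_measure \<alpha>)"
    then have y: "y \<in> orthant" by (simp add: space_laguerre_measure)
    show "0 \<le> laguerre_kernel \<alpha> t x y" by (rule laguerre_kernel_nonneg[OF t x y])
    show "laguerre_kernel \<alpha> t x y = laguerre_kernel \<alpha> t y x"
      by (simp add: laguerre_kernel_def mult.commute add.commute)
  qed
qed

end

section \<open>Concentration of the kernel for small times\<close>

lemma gauss_separation:
  fixes x e :: real
  assumes x: "0 < x" and e: "0 < e"
  obtains c where "0 < c" "\<And>v. 0 < v \<Longrightarrow> e \<le> \<bar>v - x\<bar> \<Longrightarrow> c \<le> (exp (- v\<^sup>2 / 2) - exp (- x\<^sup>2 / 2))\<^sup>2"
proof -
  \<comment> \<open>The cap \<open>x / 2\<close> keeps \<open>x - d\<close> positive, where squaring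
    is increasing. The two gaps \<open>c1\<close> and \<open>c2\<close> are those at distance
    \<open>d\<close> to the right and left of \<open>x\<close>; monotonicity of the Gaussian on the
    half-line extends them to all points farther away.\<close>
  define d where "d = min e (x / 2)"
  have d: "0 < d" "d < x" "d \<le> e" using x e by (auto simp: d_def min_def)
  define c1 where "c1 = exp (- x\<^sup>2 / 2) - exp (- (x + d)\<^sup>2 / 2)"
  define c2 where "c2 = exp (- (x - d)\<^sup>2 / 2) - exp (- x\<^sup>2 / 2)"
  have "x\<^sup>2 < (x + d)\<^sup>2" "(x - d)\<^sup>2 < x\<^sup>2" using x d by (auto intro!: power_strict_mono)
  then have c: "0 < c1" "0 < c2" by (auto simp: c1_def c2_def)
  have "(min c1 c2)\<^sup>2 \<le> (exp (- v\<^sup>2 / 2) - exp (- x\<^sup>2 / 2))\<^sup>2" if v: "0 < v" "e \<le> \<bar>v - x\<bar>" for v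
  proof -
    have "min c1 c2 \<le> \<bar>exp (- v\<^sup>2 / 2) - exp (- x\<^sup>2 / 2)\<bar>"
    proof (cases "x \<le> v")
      case True
      then have "x + d \<le> v" using v d by auto
      then have "(x + d)\<^sup>2 \<le> v\<^sup>2" using x d by (intro power_mono) auto
      then have "exp (- v\<^sup>2 / 2) \<le> exp (- (x + d)\<^sup>2 / 2)" by simp
      then show ?thesis unfolding c1_def by linarith
    next
      case False
      then have "v \<le> x - d" using v d by auto
      then have "v\<^sup>2 \<le> (x - d)\<^sup>2" using v by (intro power_mono) auto
      then have "exp (- (x - d)\<^sup>2 / 2) \<le> exp (- v\<^sup>2 / 2)" by simp
      then show ?thesis unfolding c2_def by linarith
    qed
    then have "(min c1 c2)\<^sup>2 \<le> \<bar>exp (- v\<^sup>2 / 2) - exp (- x\<^sup>2 / 2)\<bar>\<^sup>2"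
      using c by (intro power_mono) auto
    then show ?thesis by simp
  qed
  moreover have "0 < (min c1 c2)\<^sup>2" using c by simp
  ultimately show ?thesis by (rule that[rotated])
qed

lemma open_vec_contains_box:
  fixes x :: "real ^ 'n"
  assumes "open U" "x \<in> U"
  obtains e where "0 < e" "\<And>y. (\<And>i. \<bar>y $ i - x $ i\<bar> < e) \<Longrightarrow> y \<in> U"
proof -
  obtain r where r: "0 < r" "ball x r \<subseteq> U" using assms open_contains_ball by blast
  have "y \<in> U" if y: "\<And>i. \<bar>y $ i - x $ i\<bar> < r / real CARD('n)" for y
  proof -
    have "norm (y - x) \<le> (\<Sum>i\<in>UNIV. \<bar>(y - x) $ i\<bar>)" by (rule norm_le_l1_cart)
    also have "\<dots> < (\<Sum>i\<in>(UNIV::'n set). r / real CARD('n))"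
      using y by (intro sum_strict_mono) auto
    also have "\<dots> = r" by simp
    finally show ?thesis using r by (auto simp: dist_norm norm_minus_commute subset_iff)
  qed
  then show ?thesis using r that[of "r / real CARD('n)"] by auto
qed

context
  fixes \<alpha> :: "real ^ 'n"
  assumes \<alpha>: "\<And>i. - 1 < \<alpha> $ i"
begin

lemma laguerre_gauss_tendsto:
  assumes T: "\<And>n. 0 < T n" "T \<longlonglongrightarrow> 0"
  shows "(\<lambda>n. laguerre_gauss \<alpha> (T n) x u) \<longlonglongrightarrow> (\<Prod>i\<in>UNIV. exp (- u i * (x $ i)\<^sup>2 / 2))"
proof -
  have s: "(\<lambda>n. sinh (2 * T n)) \<longlonglongrightarrow> sinh (2 * 0)" and c: "(\<lambda>n. cosh (2 * T n)) \<longlonglongrightarrow> cosh (2 * 0)"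
    by (intro tendsto_intros T)+
  then have s: "(\<lambda>n. sinh (2 * T n)) \<longlonglongrightarrow> 0" and c: "(\<lambda>n. cosh (2 * T n)) \<longlonglongrightarrow> 1" by simp_all
  have "(\<lambda>n. laguerre_gauss \<alpha> (T n) x u) \<longlonglongrightarrow>
     (\<Prod>i\<in>UNIV. (1 + u i * 0) powr (- (\<alpha> $ i + 1)) * exp (- ((x $ i)\<^sup>2 / 2) * ((0 + u i * 1) / (1 + u
         i * 0))))"
    unfolding laguerre_gauss_def by (intro tendsto_intros s c) auto
  then show ?thesis by (simp add: mult_ac)
qed

text \<open>Chebyshev's inequality for the Gaussian observable \<open>exp (- (y $ i)\<^sup>2 / 2)\<close>, whose first two moments
  are explicit.\<close>

lemma laguerre_kernel_variance_tendsto: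
  assumes T: "\<And>n. 0 < T n" "T \<longlonglongrightarrow> 0" and x: "x \<in> orthant"
  shows "(\<lambda>n. \<integral>\<^sup>+y. ennreal (laguerre_kernel \<alpha> (T n) x y) * ennreal ((exp (- (y $ i)\<^sup>2 / 2) - exp (-
      (x $ i)\<^sup>2 / 2))\<^sup>2) \<partial>laguerre_measure \<alpha>) \<longlonglongrightarrow> 0"
proof -
  define r where "r = exp (- (x $ i)\<^sup>2 / 2)"
  \<comment> \<open>The parameter vector that probes coordinate \<open>i\<close> alone. The values
    \<open>a = 0\<close>, \<open>1\<close>, \<open>2\<close> give the mass and the first two moments
    of the observable, whose value at \<open>x\<close> is \<open>r\<close>.\<close>
  define w where "w a j = (if j = i then a else (0::real))" for a j
  define J where "J n = (\<integral>\<^sup>+y. ennreal (laguerre_kernel \<alpha> (T n) x y) * ennreal ((exp (- (y $ i)\<^sup>2 /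
      2) - r)\<^sup>2) \<partial>laguerre_measure \<alpha>)" for n
  define E where "E a n = laguerre_gauss \<alpha> (T n) x (w a)" for a n
  have prod_w: "(\<Prod>j\<in>UNIV. exp (- w a j * (y $ j)\<^sup>2 / 2)) = exp (- a * (y $ i)\<^sup>2 / 2)" for a y
  proof -
    have "(\<Prod>j\<in>UNIV. exp (- w a j * (y $ j)\<^sup>2 / 2)) = (\<Prod>j\<in>UNIV. if j = i then exp (- a * (y $ i)\<^sup>2 /
        2) else 1)"
      by (intro prod.cong) (auto simp: w_def)
    then show ?thesis by (simp add: prod.delta)
  qed
  have E: "(\<integral>\<^sup>+y. ennreal (laguerre_kernel \<alpha> (T n) x y) * ennreal (exp (- a * (y $ i)\<^sup>2 / 2))
      \<partial>laguerre_measure \<alpha>) = ennreal (E a n)" if "0 \<le> a" for a n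
    using nn_integral_laguerre_kernel_gauss[OF \<alpha> T(1) x, of "w a" n] that unfolding prod_w by (simp
        add: E_def w_def)
  have E0: "0 \<le> E a n" if "0 \<le> a" for a n
    unfolding E_def laguerre_gauss_def by (intro prod_nonneg) auto
  have r0: "0 \<le> r" by (simp add: r_def)
  have lim: "E a \<longlonglongrightarrow> r powr a" for a
    using laguerre_gauss_tendsto[OF T, of x "w a"] unfolding prod_w E_def[symmetric]
    by (simp add: r_def powr_def mult_ac)
  have J: "J n = ennreal (E 2 n + r\<^sup>2 * E 0 n - 2 * r * E 1 n)" for n
  proof -
    interpret symmetric_kernel "laguerre_measure \<alpha>" "laguerre_kernel \<alpha> (T n)" "cosh (2 * T n) powr
        (- ((\<Sum>i\<in>UNIV. \<alpha> $ i) + real CARD('n)))"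
      by (rule symmetric_kernel_laguerre[OF \<alpha> T(1) order_refl])
    have [measurable]: "(\<lambda>y. y $ i) \<in> borel_measurable (laguerre_measure \<alpha>)"
      by (rule measurable_laguerre_measure) measurable
    have [measurable]: "(\<lambda>y. laguerre_kernel \<alpha> (T n) x y) \<in> borel_measurable (laguerre_measure \<alpha>)"
      using x by (intro kernel_measurable') (auto simp: space_laguerre_measure)
    let ?k = "\<lambda>y. ennreal (laguerre_kernel \<alpha> (T n) x y)"
    \<comment> \<open>The square is expanded with its negative term moved to the left; being finite,
      that term can be subtracted again at the end.\<close>
    have "J n + ennreal (2 * r) * ennreal (E 1 n)
      = (\<integral>\<^sup>+y. ?k y * ennreal ((exp (- (y $ i)\<^sup>2 / 2) - r)\<^sup>2) + ennreal (2 * r) * (?k y * ennreal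
          (exp (- 1 * (y $ i)\<^sup>2 / 2))) \<partial>laguerre_measure \<alpha>)"
      unfolding J_def E[OF zero_le_one, symmetric] by (subst nn_integral_add) (simp_all add:
          nn_integral_cmult)
    also have "\<dots> = (\<integral>\<^sup>+y. ?k y * ennreal (exp (- 2 * (y $ i)\<^sup>2 / 2)) + ennreal (r\<^sup>2) * (?k y *
        ennreal (exp (- 0 * (y $ i)\<^sup>2 / 2))) \<partial>laguerre_measure \<alpha>)"
    proof (rule nn_integral_cong)
      fix y :: "real ^ 'n"
      define z where "z = exp (- (y $ i)\<^sup>2 / 2)"
      have z: "exp (- 2 * (y $ i)\<^sup>2 / 2) = z\<^sup>2" "exp (- 1 * (y $ i)\<^sup>2 / 2) = z" "0 \<le> z"
        by (simp_all add: z_def exp_double[symmetric])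
      have "ennreal ((z - r)\<^sup>2) + ennreal (2 * r) * ennreal z = ennreal (z\<^sup>2) + ennreal (r\<^sup>2)"
      proof -
        have "ennreal ((z - r)\<^sup>2) + ennreal (2 * r) * ennreal z = ennreal ((z - r)\<^sup>2 + 2 * r * z)"
          using z(3) r0 by (simp add: ennreal_mult)
        also have "(z - r)\<^sup>2 + 2 * r * z = z\<^sup>2 + r\<^sup>2" by (simp add: power2_diff)
        finally show ?thesis by simp
      qed
      then have "?k y * (ennreal ((z - r)\<^sup>2) + ennreal (2 * r) * ennreal z) = ?k y * (ennreal (z\<^sup>2)
          + ennreal (r\<^sup>2))" by simp
      then show "?k y * ennreal ((exp (- (y $ i)\<^sup>2 / 2) - r)\<^sup>2) + ennreal (2 * r) * (?k y * ennreal
          (exp (- 1 * (y $ i)\<^sup>2 / 2)))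
        = ?k y * ennreal (exp (- 2 * (y $ i)\<^sup>2 / 2)) + ennreal (r\<^sup>2) * (?k y * ennreal (exp (- 0 *
            (y $ i)\<^sup>2 / 2)))"
        unfolding z z_def[symmetric] by (simp add: distrib_left mult_ac)
    qed
    also have "\<dots> = ennreal (E 2 n) + ennreal (r\<^sup>2) * ennreal (E 0 n)"
      unfolding E[OF zero_le_numeral, symmetric] E[OF order_refl, symmetric]
      by (subst nn_integral_add) (simp_all add: nn_integral_cmult)
    also have "\<dots> = ennreal (E 2 n + r\<^sup>2 * E 0 n)"
      using E0[of 2 n] E0[of 0 n] by (simp add: ennreal_mult ennreal_plus)
    finally have eq: "J n + ennreal (2 * r * E 1 n) = ennreal (E 2 n + r\<^sup>2 * E 0 n)"
      using E0[of 1 n] r0 by (simp add: ennreal_mult)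
    have "J n = J n + ennreal (2 * r * E 1 n) - ennreal (2 * r * E 1 n)" by simp
    also have "\<dots> = ennreal (E 2 n + r\<^sup>2 * E 0 n - 2 * r * E 1 n)"
      unfolding eq using E0[of 1 n] r0 by (intro ennreal_minus) auto
    finally show ?thesis .
  qed
  \<comment> \<open>The mass \<open>E 0 n\<close> is not 1, but it tends to 1, so in the limit the
    three terms cancel as \<open>r^2 + r^2 - 2 * r^2\<close>.\<close>
  have "(\<lambda>n. E 2 n + r\<^sup>2 * E 0 n - 2 * r * E 1 n) \<longlonglongrightarrow> r powr 2 + r\<^sup>2 * r powr 0 - 2 * r * r powr 1"
    by (intro tendsto_intros lim)
  moreover have "r powr 2 + r\<^sup>2 * r powr 0 - 2 * r * r powr 1 = 0"
    by (simp add: r_def power2_eq_square powr_numeral)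
  ultimately have "J \<longlonglongrightarrow> ennreal 0" unfolding J by (intro tendsto_ennrealI) simp
  then show ?thesis unfolding J_def[abs_def] r_def by simp
qed

text \<open>A point outside \<open>U\<close> is at distance at least \<open>e\<close> from
  \<open>x\<close> in some coordinate, where the squared deviation of the Gaussian is at least
  \<open>c i\<close>. Hence the mass outside \<open>U\<close> is at most the sum \<open>R n\<close>
  of the variances divided by \<open>c i\<close>, and the total mass tends to 1.\<close>

lemma laguerre_kernel_concentration:
  assumes T: "\<And>n. 0 < T n" "T \<longlonglongrightarrow> 0" and U: "open U" "x \<in> U" and x: "x \<in> orthant"
  shows "(\<lambda>n. \<integral>\<^sup>+y. ennreal (laguerre_kernel \<alpha> (T n) x y) * indicator U y \<partial>laguerre_measure \<alpha>) \<longlonglongrightarrow> 1"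
proof -
  let ?M = "laguerre_measure \<alpha>"
  obtain e where e: "0 < e" "\<And>y. (\<And>i. \<bar>y $ i - x $ i\<bar> < e) \<Longrightarrow> y \<in> U"
    using open_vec_contains_box[OF U] by metis
  define \<phi> where "\<phi> i y = (exp (- (y $ i)\<^sup>2 / 2) - exp (- (x $ i)\<^sup>2 / 2))\<^sup>2" for i and y :: "real ^
      'n"
  have "\<exists>c>0. \<forall>v>0. e \<le> \<bar>v - x $ i\<bar> \<longrightarrow> c \<le> (exp (- v\<^sup>2 / 2) - exp (- (x $ i)\<^sup>2 / 2))\<^sup>2" for i
    using gauss_separation[of "x $ i" e] x e(1) by (metis mem_Collect_eq orthant_def)
  then obtain c where c: "\<And>i. 0 < c i"
    "\<And>i v. 0 < v \<Longrightarrow> e \<le> \<bar>v - x $ i\<bar> \<Longrightarrow> c i \<le> (exp (- v\<^sup>2 / 2) - exp (- (x $ i)\<^sup>2 / 2))\<^sup>2"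
    by metis
  define k where "k n y = ennreal (laguerre_kernel \<alpha> (T n) x y)" for n y
  have km[measurable]: "k n \<in> borel_measurable ?M" for n
  proof -
    interpret symmetric_kernel ?M "laguerre_kernel \<alpha> (T n)" "cosh (2 * T n) powr (- ((\<Sum>i\<in>UNIV. \<alpha> $
        i) + real CARD('n)))"
      by (rule symmetric_kernel_laguerre[OF \<alpha> T(1) order_refl])
    have "(\<lambda>y. laguerre_kernel \<alpha> (T n) x y) \<in> borel_measurable ?M"
      using x by (intro kernel_measurable') (auto simp: space_laguerre_measure)
    then show ?thesis unfolding k_def by measurable
  qed
  have [measurable]: "(\<lambda>y. y $ i) \<in> borel_measurable ?M" for i
    by (rule measurable_laguerre_measure) measurable
  have \<phi>m[measurable]: "\<phi> i \<in> borel_measurable ?M" for i unfolding \<phi>_def by measurable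
  have [measurable]: "indicator U \<in> borel_measurable ?M"
    using U by (intro measurable_laguerre_measure borel_measurable_indicator) auto
  define g where "g n = (\<integral>\<^sup>+y. k n y * indicator U y \<partial>?M)" for n
  define R where "R n = (\<Sum>i\<in>UNIV. ennreal (1 / c i) * (\<integral>\<^sup>+y. k n y * ennreal (\<phi> i y) \<partial>?M))" for n
  define E where "E n = laguerre_gauss \<alpha> (T n) x (\<lambda>_. 0)" for n
  have kE: "(\<integral>\<^sup>+y. k n y \<partial>?M) = ennreal (E n)" for n
    unfolding k_def E_def by (rule nn_integral_laguerre_kernel[OF \<alpha> T(1) x])
  have "ennreal (E n) \<le> g n + R n" for n
  proof -
    have "ennreal (E n) \<le> (\<integral>\<^sup>+y. k n y * indicator U y + (\<Sum>i\<in>UNIV. ennreal (1 / c i) * (k n y *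
        ennreal (\<phi> i y))) \<partial>?M)"
      unfolding kE[symmetric]
    proof (rule nn_integral_mono)
      fix y assume "y \<in> space ?M"
      then have y: "0 < y $ i" for i by (simp add: space_laguerre_measure orthant_def)
      show "k n y \<le> k n y * indicator U y + (\<Sum>i\<in>UNIV. ennreal (1 / c i) * (k n y * ennreal (\<phi> i
          y)))"
      proof (cases "y \<in> U")
        case False
        then obtain i where i: "e \<le> \<bar>y $ i - x $ i\<bar>" using e(2)[of y] by (meson not_le)
        have "1 \<le> 1 / c i * \<phi> i y" using c(1)[of i] c(2)[OF y i] by (simp add: \<phi>_def)
        then have "ennreal 1 \<le> ennreal (1 / c i * \<phi> i y)" by (rule ennreal_leI)
        also have "\<dots> = ennreal (1 / c i) * ennreal (\<phi> i y)"
          using c(1)[of i] by (intro ennreal_mult) (auto simp: \<phi>_def)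
        finally have "k n y * 1 \<le> k n y * (ennreal (1 / c i) * ennreal (\<phi> i y))" by (intro
            mult_left_mono) auto
        also have "\<dots> = ennreal (1 / c i) * (k n y * ennreal (\<phi> i y))" by (simp only: mult_ac)
        also have "\<dots> \<le> (\<Sum>i\<in>UNIV. ennreal (1 / c i) * (k n y * ennreal (\<phi> i y)))"
          by (rule member_le_sum) auto
        finally show ?thesis by (simp add: add_increasing)
      qed simp
    qed
    also have "\<dots> = g n + R n"
      unfolding g_def R_def by (simp add: nn_integral_add nn_integral_sum nn_integral_cmult)
    finally show ?thesis .
  qed
  \<comment> \<open>Truncated subtraction is harmless, since only a lower bound for
    \<open>g n\<close> is wanted.\<close>
  then have lower: "ennreal (E n) - R n \<le> g n" for n by (simp add: ennreal_minus_le_iff add.commute)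
  have upper: "g n \<le> ennreal (E n)" for n
    unfolding g_def kE[symmetric] by (intro nn_integral_mono) (auto simp: indicator_def)
  have "E \<longlonglongrightarrow> 1" using laguerre_gauss_tendsto[OF T, of x "\<lambda>_. 0"] by (simp add: E_def[abs_def])
  then have Elim: "(\<lambda>n. ennreal (E n)) \<longlonglongrightarrow> 1" using tendsto_ennrealI by fastforce
  have "R \<longlonglongrightarrow> (\<Sum>i\<in>(UNIV :: 'n set). ennreal (1 / c i) * 0)"
    unfolding R_def k_def \<phi>_def
    by (intro tendsto_sum ennreal_tendsto_cmult laguerre_kernel_variance_tendsto T x) auto
  then have Rlim: "R \<longlonglongrightarrow> 0" by simp
  have "(\<lambda>n. ennreal (E n) - R n) \<longlonglongrightarrow> 1 - 0"
    by (intro tendsto_diff_ennreal Elim Rlim) auto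
  then have "(\<lambda>n. ennreal (E n) - R n) \<longlonglongrightarrow> 1" by simp
  then have "g \<longlonglongrightarrow> 1"
    by (rule tendsto_sandwich[OF always_eventually[OF allI[OF lower]] always_eventually[OF allI[OF
        upper]] _ Elim])
  then show ?thesis unfolding g_def[abs_def] k_def .
qed

lemma laguerre_approximate_identity:
  assumes T: "\<And>n. 0 < T n" "T \<longlonglongrightarrow> 0"
  shows "kernel_approximate_identity (laguerre_measure \<alpha>) (\<lambda>n. laguerre_kernel \<alpha> (T n)) (\<lambda>m. ball 0
      (real m))"
proof (rule kernel_approximate_identity.intro)
  show "symmetric_kernel (laguerre_measure \<alpha>) (laguerre_kernel \<alpha> (T n)) 1" for n
    by (intro symmetric_kernel_laguerre \<alpha> T less_imp_le[OF cosh_powr_less_1])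
  show "sets (laguerre_measure \<alpha>) = sets (restrict_space borel (space (laguerre_measure \<alpha>)))"
    by (simp add: space_laguerre_measure sets_laguerre_measure)
  show "incseq (\<lambda>m. ball (0 :: real ^ 'n) (real m))" by (auto simp: incseq_def)
  show "emeasure (laguerre_measure \<alpha>) (ball 0 (real m) \<inter> space (laguerre_measure \<alpha>)) < \<infinity>" for m
    using emeasure_laguerre_measure_ball_finite[OF \<alpha>] by (simp add: space_laguerre_measure)
  show "space (laguerre_measure \<alpha>) \<subseteq> (\<Union>m. ball 0 (real m))"
    using reals_Archimedean2 by auto
  show "(\<lambda>n. \<integral>\<^sup>+y. ennreal (laguerre_kernel \<alpha> (T n) x y) * indicator U y \<partial>laguerre_measure \<alpha>) \<longlonglongrightarrow> 1"
    if "open U" "x \<in> U" "x \<in> space (laguerre_measure \<alpha>)" for U x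
    using laguerre_kernel_concentration[OF T] that by (simp add: space_laguerre_measure)
qed auto

end

lemma Lp_norm_2_tendsto_0:
  assumes "(\<lambda>n. L2_sqnorm M (g n)) \<longlonglongrightarrow> 0"
  shows "(\<lambda>n. Lp_norm M 2 (g n)) \<longlonglongrightarrow> 0"
proof (rule order_tendstoI)
  fix e :: ennreal assume "0 < e"
  then obtain r' where "0 < r'" "r' < e" using dense by blast
  then obtain r where r: "0 < r" "ennreal r < e" by (cases r') auto
  have "0 < ennreal (r\<^sup>2)" using r by simp
  from order_tendstoD(2)[OF assms this]
  show "eventually (\<lambda>n. Lp_norm M 2 (g n) < e) sequentially"
  proof eventually_elim
    case (elim n)
    then obtain I where I: "0 \<le> I" "L2_sqnorm M (g n) = ennreal I" "I < r\<^sup>2"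
      by (cases "L2_sqnorm M (g n)") (auto simp: ennreal_less_iff)
    then have "Lp_norm M 2 (g n) = ennreal (I powr (1 / 2))"
      using Lp_norm_ennreal[of 2 M "g n"] by (simp add: L2_sqnorm_def)
    also have "I powr (1 / 2) \<le> (r\<^sup>2) powr (1 / 2)" using I by (intro powr_mono2) auto
    also have "(r\<^sup>2) powr (1 / 2) = r" using r by (simp add: powr_half_sqrt)
    finally show ?case using r by (meson ennreal_leI le_less_trans)
  qed
qed auto

lemma laguerre_semigroup_eq_kernel_op:
  "t \<noteq> 0 \<Longrightarrow> laguerre_semigroup \<alpha> t = kernel_op (laguerre_measure \<alpha>) (laguerre_kernel \<alpha> t)"
  by (simp add: fun_eq_iff laguerre_semigroup_def kernel_op_def)

lemma laguerre_semigroup_0: "laguerre_semigroup \<alpha> 0 f = f"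
  by (simp add: fun_eq_iff laguerre_semigroup_def)

lemma Lp_opnorm_id_le: "Lp_opnorm M p (\<lambda>f. f) \<le> 1"
  unfolding Lp_opnorm_def by (rule SUP_least) simp

section \<open>The Laguerre semigroup\<close>

context
  fixes \<alpha> :: "real ^ 'n"
  assumes \<alpha>: "\<And>i. - 1 < \<alpha> $ i"
begin

lemma symmetric_kernel_laguerre_1: "0 < t \<Longrightarrow> symmetric_kernel (laguerre_measure \<alpha>) (laguerre_kernel \<alpha>
    t) 1"
  by (intro symmetric_kernel_laguerre \<alpha> less_imp_le[OF cosh_powr_less_1])

lemma Lp_opnorm_laguerre_semigroup_le:
  assumes "1 \<le> p" "0 < t"
  shows "Lp_opnorm (laguerre_measure \<alpha>) p (laguerre_semigroup \<alpha> t)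
    \<le> ennreal (cosh (2 * t) powr (- ((\<Sum>i\<in>UNIV. \<alpha> $ i) + real CARD('n))))"
  using symmetric_kernel.Lp_opnorm_kernel_op_le[OF symmetric_kernel_laguerre[OF \<alpha> assms(2)
      order_refl] assms(1)] assms(2)
  by (simp add: laguerre_semigroup_eq_kernel_op)

lemma laguerre_semigroup_continuous:
  assumes f: "f \<in> Lp_space (laguerre_measure \<alpha>) 2"
  shows "((\<lambda>t. Lp_norm (laguerre_measure \<alpha>) 2 (\<lambda>x. laguerre_semigroup \<alpha> t f x - f x)) \<longlongrightarrow> 0) (at_right
      0)"
  \<comment> \<open>The approximate identity is formulated for sequences of times, and these
    determine the one-sided limit.\<close>
  unfolding tendsto_at_iff_sequentially
proof (intro allI impI)
  fix X :: "nat \<Rightarrow> real" assume X: "\<forall>i. X i \<in> {0<..} - {0}" "X \<longlonglongrightarrow> 0"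
  then have pos: "0 < X n" for n by auto
  interpret kernel_approximate_identity "laguerre_measure \<alpha>" "\<lambda>n. laguerre_kernel \<alpha> (X n)" "\<lambda>m. ball
      0 (real m)"
    by (rule laguerre_approximate_identity[OF \<alpha> pos X(2)])
  have "(\<lambda>n. L2_sqnorm (laguerre_measure \<alpha>) (\<lambda>x. laguerre_semigroup \<alpha> (X n) f x - f x)) \<longlonglongrightarrow> 0"
    using L2_converges_L2[OF f] pos by (simp add: L2_converges_def laguerre_semigroup_eq_kernel_op
        order_less_imp_not_eq2)
  then show "((\<lambda>t. Lp_norm (laguerre_measure \<alpha>) 2 (\<lambda>x. laguerre_semigroup \<alpha> t f x - f x)) \<circ> X) \<longlonglongrightarrow> 0"
    unfolding comp_def by (rule Lp_norm_2_tendsto_0)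
qed

lemma symmetric_diffusion_semigroup_laguerre:
  "symmetric_diffusion_semigroup (laguerre_measure \<alpha>) (L1_plus_Linf (laguerre_measure \<alpha>))
      (laguerre_semigroup \<alpha>)"
    (is "symmetric_diffusion_semigroup ?M ?D ?T")
proof (intro symmetric_diffusion_semigroup.intro symmetric_diffusion_semigroup_axioms.intro)
  show "sigma_finite_measure ?M" by (rule sigma_finite_laguerre_measure)
  show "?D \<subseteq> borel_measurable ?M" by (rule L1_plus_Linf_measurable)
  then have Dm: "f \<in> borel_measurable ?M" if "f \<in> ?D" for f using that by auto
  show "(\<lambda>x. a * f x + b * g x) \<in> ?D" if "f \<in> ?D" "g \<in> ?D" for a b f g
    using that by (rule L1_plus_Linf_lincomb)
  show "Lp_space ?M p \<subseteq> ?D" if "1 \<le> p" for p using that by (rule Lp_space_subset_L1_plus_Linf)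
  have K: "symmetric_kernel ?M (laguerre_kernel \<alpha> t) 1" and T: "?T t = kernel_op ?M (laguerre_kernel
      \<alpha> t)"
    if "0 \<le> t" "t \<noteq> 0" for t
    using that by (auto intro: symmetric_kernel_laguerre_1 laguerre_semigroup_eq_kernel_op)
  show "?T t f \<in> borel_measurable ?M" if "0 \<le> t" "f \<in> ?D" for t f
  proof (cases "t = 0")
    case False
    show ?thesis unfolding T[OF that(1) False]
      by (rule symmetric_kernel.kernel_op_measurable[OF K[OF that(1) False] Dm[OF that(2)]])
  qed (use that Dm in \<open>simp add: laguerre_semigroup_0\<close>)
  show "AE x in ?M. ?T t f x = ?T t g x" if "0 \<le> t" "f \<in> ?D" "g \<in> ?D" "AE x in ?M. f x = g x" for t
      f g
  proof (cases "t = 0")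
    case False
    show ?thesis unfolding T[OF that(1) False]
      by (rule AE_I2) (rule symmetric_kernel.kernel_op_cong[OF K[OF that(1) False] Dm[OF that(2)]
          Dm[OF that(3)] that(4)])
  qed (use that in \<open>simp add: laguerre_semigroup_0\<close>)
  show "AE x in ?M. ?T t (\<lambda>y. a * f y + b * g y) x = a * ?T t f x + b * ?T t g x"
    if "0 \<le> t" "f \<in> ?D" "g \<in> ?D" for t a b f g
  proof (cases "t = 0")
    case False
    show ?thesis unfolding T[OF that(1) False]
      by (rule symmetric_kernel.kernel_op_linear[OF K[OF that(1) False] that(2,3)])
  qed (simp add: laguerre_semigroup_0)
  show "AE x in ?M. ?T 0 f x = f x" for f by (simp add: laguerre_semigroup_0)
  show "?T t f \<in> Lp_space ?M p" if "0 \<le> t" "1 \<le> p" "f \<in> Lp_space ?M p" for t p f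
  proof (cases "t = 0")
    case False
    show ?thesis unfolding T[OF that(1) False]
      by (rule symmetric_kernel.kernel_op_Lp[OF K[OF that(1) False] that(3,2)])
  qed (use that in \<open>simp add: laguerre_semigroup_0\<close>)
  show "Lp_opnorm ?M p (?T t) \<le> 1" if "0 \<le> t" "1 \<le> p" for t p
  proof (cases "t = 0")
    case True
    have "?T 0 = (\<lambda>f. f)" by (simp add: fun_eq_iff laguerre_semigroup_def)
    then show ?thesis using True Lp_opnorm_id_le[of ?M p] by simp
  next
    case False
    show ?thesis unfolding T[OF that(1) False]
      using symmetric_kernel.Lp_opnorm_kernel_op_le[OF K[OF that(1) False] that(2)] by simp
  qed
  show "AE x in ?M. ?T (s + t) f x = ?T s (?T t f) x"
    if st: "0 \<le> s" "0 \<le> t" "1 \<le> p" "f \<in> Lp_space ?M p" for s t p f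
  \<comment> \<open>Chapman-Kolmogorov needs two positive times; at time 0 the operator is the
    identity on representatives.\<close>
  proof (cases "s = 0 \<or> t = 0")
    case True
    then show ?thesis by (auto simp: laguerre_semigroup_0)
  next
    case False
    then have pos: "0 < s" "0 < t" using st by auto
    have "AE x in ?M. kernel_op ?M (laguerre_kernel \<alpha> (s + t)) f x
        = kernel_op ?M (laguerre_kernel \<alpha> s) (kernel_op ?M (laguerre_kernel \<alpha> t) f) x"
    proof (rule kernel_op_compose)
      show "f \<in> ?D" using Lp_space_subset_L1_plus_Linf st by blast
      show "(\<integral>\<^sup>+z. ennreal (laguerre_kernel \<alpha> s x z) * ennreal (laguerre_kernel \<alpha> t z y) \<partial>?M) =
          ennreal (laguerre_kernel \<alpha> (s + t) x y)"
        if "x \<in> space ?M" "y \<in> space ?M" for x y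
        using that pos by (intro laguerre_kernel_Chapman_Kolmogorov \<alpha>) (auto simp:
            space_laguerre_measure)
    qed (use pos in \<open>auto intro: symmetric_kernel_laguerre_1\<close>)
    then show ?thesis using pos by (simp add: T)
  qed
  show "(\<integral>x. ?T t f x * cnj (g x) \<partial>?M) = (\<integral>x. f x * cnj (?T t g x) \<partial>?M)"
    if "0 \<le> t" "f \<in> Lp_space ?M 2" "g \<in> Lp_space ?M 2" for t f g
  proof (cases "t = 0")
    case False
    show ?thesis unfolding T[OF that(1) False]
      by (rule symmetric_kernel.kernel_op_selfadjoint[OF K[OF that(1) False] that(2,3)])
  qed (simp add: laguerre_semigroup_0)
  show "((\<lambda>t. Lp_norm ?M 2 (\<lambda>x. ?T t f x - f x)) \<longlongrightarrow> 0) (at_right 0)" if "f \<in> Lp_space ?M 2" for f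
    using that by (rule laguerre_semigroup_continuous)
qed

lemma laguerre_semigroup_one:
  assumes t: "0 < t" and x: "x \<in> orthant"
  shows "laguerre_semigroup \<alpha> t (\<lambda>_. 1) x = complex_of_real (laguerre_gauss \<alpha> t x (\<lambda>_. 0))"
proof -
  interpret symmetric_kernel "laguerre_measure \<alpha>" "laguerre_kernel \<alpha> t" 1
    by (rule symmetric_kernel_laguerre_1[OF t])
  have "laguerre_semigroup \<alpha> t (\<lambda>_. 1) x = (\<integral>y. complex_of_real (laguerre_kernel \<alpha> t x y)
      \<partial>laguerre_measure \<alpha>)"
    using t by (simp add: laguerre_semigroup_def)
  also have "\<dots> = complex_of_real (\<integral>y. laguerre_kernel \<alpha> t x y \<partial>laguerre_measure \<alpha>)"
    by (rule integral_complex_of_real)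
  also have "(\<integral>y. laguerre_kernel \<alpha> t x y \<partial>laguerre_measure \<alpha>) = enn2real (\<integral>\<^sup>+y. ennreal
      (laguerre_kernel \<alpha> t x y) \<partial>laguerre_measure \<alpha>)"
  proof (rule integral_eq_nn_integral)
    show "(\<lambda>y. laguerre_kernel \<alpha> t x y) \<in> borel_measurable (laguerre_measure \<alpha>)"
      using x by (intro kernel_measurable') (auto simp: space_laguerre_measure)
    show "AE y in laguerre_measure \<alpha>. 0 \<le> laguerre_kernel \<alpha> t x y"
      using x kernel_nonneg by (intro AE_I2) (auto simp: space_laguerre_measure)
  qed
  also have "\<dots> = laguerre_gauss \<alpha> t x (\<lambda>_. 0)"
    unfolding nn_integral_laguerre_kernel[OF \<alpha> t x]
    by (rule enn2real_ennreal) (auto simp: laguerre_gauss_def intro!: prod_nonneg)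
  finally show ?thesis .
qed

lemma submarkovian_semigroup_laguerre:
  "submarkovian_semigroup (laguerre_measure \<alpha>) (L1_plus_Linf (laguerre_measure \<alpha>))
      (laguerre_semigroup \<alpha>)"
    (is "submarkovian_semigroup ?M ?D ?T")
proof (intro submarkovian_semigroup.intro submarkovian_semigroup_axioms.intro
    symmetric_diffusion_semigroup_laguerre)
  show "AE x in ?M. 0 \<le> ?T t f x" if "0 \<le> t" "f \<in> ?D" "AE x in ?M. 0 \<le> f x" for t f
  proof (cases "t = 0")
    case False
    then interpret symmetric_kernel ?M "laguerre_kernel \<alpha> t" 1
      using that by (intro symmetric_kernel_laguerre_1) auto
    have "f \<in> borel_measurable ?M" using that L1_plus_Linf_measurable by auto
    then show ?thesis using that False
      by (intro AE_I2) (simp add: laguerre_semigroup_eq_kernel_op kernel_op_nonneg)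
  qed (use that in \<open>simp add: laguerre_semigroup_0\<close>)
  show "AE x in ?M. ?T t (\<lambda>_. 1) x \<le> 1" if "0 \<le> t" for t
  proof (cases "t = 0")
    case False
    then have t: "0 < t" using that by simp
    have "laguerre_gauss \<alpha> t x (\<lambda>_. 0) \<le> 1" for x
      using laguerre_gauss_0_le[OF \<alpha> t, of x] cosh_powr_less_1[OF \<alpha> t] by linarith
    then show ?thesis using t
      by (intro AE_I2) (simp add: space_laguerre_measure laguerre_semigroup_one less_eq_complex_def)
  qed (simp add: laguerre_semigroup_0)
qed

text \<open>On a null space every almost-everywhere statement would hold, including the Markov
  identity, so the negative result depends on this. A null space would also give the kernel mass 0,
  contrary to its explicit positive value.\<close>

lemma emeasure_space_laguerre_measure: "emeasure (laguerre_measure \<alpha>) (space (laguerre_measure \<alpha>)) \<noteq>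
    0"
proof
  let ?M = "laguerre_measure \<alpha>"
  assume "emeasure ?M (space ?M) = 0"
  then have "AE x in ?M. False" by (intro AE_I[of _ _ "space ?M"]) auto
  then have "(\<integral>\<^sup>+y. ennreal (laguerre_kernel \<alpha> 1 1 y) \<partial>?M) = (\<integral>\<^sup>+y. 0 \<partial>?M)"
    by (intro nn_integral_cong_AE) (auto elim: eventually_mono)
  moreover have "(1 :: real ^ 'n) \<in> orthant" by (simp add: orthant_def)
  ultimately have "ennreal (laguerre_gauss \<alpha> 1 1 (\<lambda>_. 0)) = 0"
    using nn_integral_laguerre_kernel[OF \<alpha> zero_less_one] by simp
  moreover have "0 < laguerre_gauss \<alpha> 1 1 (\<lambda>_. 0)"
    unfolding laguerre_gauss_0[OF \<alpha> zero_less_one] by simp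
  ultimately show False by simp
qed

lemma not_markovian_semigroup_laguerre:
  "\<not> markovian_semigroup (laguerre_measure \<alpha>) (L1_plus_Linf (laguerre_measure \<alpha>))
      (laguerre_semigroup \<alpha>)"
proof
  let ?M = "laguerre_measure \<alpha>"
  assume "markovian_semigroup ?M (L1_plus_Linf ?M) (laguerre_semigroup \<alpha>)"
  then have "AE x in ?M. laguerre_semigroup \<alpha> 1 (\<lambda>_. 1) x = 1"
    by (rule markovian_semigroup.T_one) simp
  then have "AE x in ?M. False"
    using AE_space
  proof eventually_elim
    case (elim x)
    have "laguerre_gauss \<alpha> 1 x (\<lambda>_. 0) < 1"
      using laguerre_gauss_0_le[OF \<alpha> zero_less_one, of x] cosh_powr_less_1[OF \<alpha> zero_less_one] by
          linarith
    with elim show ?case by (simp add: space_laguerre_measure laguerre_semigroup_one)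
  qed
  then have "emeasure ?M (space ?M) = 0" by (simp add: AE_iff_measurable[OF sets.top])
  then show False using emeasure_space_laguerre_measure by simp
qed

end

theorem theorem5p1:
  fixes \<alpha> :: "real ^ 'n"
  assumes "\<And>i. - 1 < \<alpha> $ i"
  shows "submarkovian_semigroup (laguerre_measure \<alpha>) (L1_plus_Linf (laguerre_measure \<alpha>))
           (laguerre_semigroup \<alpha>) \<and>
         \<not> markovian_semigroup (laguerre_measure \<alpha>) (L1_plus_Linf (laguerre_measure \<alpha>))
           (laguerre_semigroup \<alpha>) \<and>
         (\<forall>p t. 1 \<le> p \<longrightarrow> 0 < t \<longrightarrow>
           Lp_opnorm (laguerre_measure \<alpha>) p (laguerre_semigroup \<alpha> t)
             \<le> ennreal (cosh (2 * t) powr (- ((\<Sum>i\<in>UNIV. \<alpha> $ i) + real CARD('n)))))"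
  using submarkovian_semigroup_laguerre[OF assms] not_markovian_semigroup_laguerre[OF assms]
    Lp_opnorm_laguerre_semigroup_le[OF assms] by blast

end
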